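(* Let $\mu\in\mathbb{R}$. For $x\in\mathbb{S}^2$ denote by $(\theta_x,\varphi_x)$ its spherical coordinates. There exists a function $p_\mu^\Phi:[0,\infty)\times\mathbb{S}^2\times\mathbb{S}^2\to\mathbb{R}$ (for each $\mu\in\mathbb{R}$) with the following properties: (i) For any $x\in\mathbb{S}^2$, $t>0$ and any Borel set $A\subseteq\mathbb{S}^2$, $$\mathbb{P}_x(W^\mu_\Phi(t)\in A)=\int_Ap_\mu^\Phi(t,y|x)\,d\sigma(y).$$ (ii) For any $x,y\in\mathbb{S}^2$ such that $\theta_x\ne\theta_y$ and $\theta_x\neq\pi-\theta_y$, and any $t>0$, $$p_\mu^\Phi(t,y|x)=\sum_{\ell=0}^{+\infty}\sum_{m=-\ell}^{\ell}\mathfrak{e}_\Phi(t;i\mu m-\ell(\ell+1))\,Y_{\ell,m}(x)\,\overline{Y}_{\ell,m}(y).$$ (iii) For any $t>0$ and $x,y\in\mathbb{S}^2$ such that $\theta_x\ne\theta_y$ and $\theta_x\ne\pi-\theta_y$, $$p_\mu^\Phi(t,y|x)=\mathbb{E}[p_\mu(L_\Phi(t),y|x)]=p_{-\mu}^\Phi(t,x|y).$$ (iv) For fixed $x\in\mathbb{S}^2$ and $t>0$, $p_\mu^\Phi(t,\cdot|x)\in L^2(\mathbb{S}^2)$ and $p_\mu^\Phi(t,x|\cdot)\in L^2(\mathbb{S}^2)$. (v) For any $f\in C(\mathbb{S}^2)$ and any $x\in\mathbb{S}^2$, $$\lim_{t\to0}\int_{\mathbb{S}^2}p_\mu^\Ph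i(t,y|x)f(y)\,d\sigma(y)=f(x).$$
   Context: Sphere. $\mathbb{S}^2\subset\mathbb{R}^3$ is the unit sphere with the round metric $g$, surface measure $\sigma$ and spherical coordinates $(\sin\theta\cos\varphi,\sin\theta\sin\varphi,\cos\theta)$, $\theta\in[0,\pi]$ (colatitude), $\varphi\in[0,2\pi)$ (longitude). $L^2(\mathbb{S}^2)=L^2(\mathbb{S}^2,\sigma)$. $\Delta_g$ is the Laplace–Beltrami operator, $X_\mu$ is the smooth vector field equal to $\mu\,\partial/\partial\varphi$ in spherical coordinates (and zero at the poles), and $\mathcal{G}_\mu=\Delta_g+X_\mu$. The spherical harmonics are $Y_{\ell,m}(\theta,\varphi)=\sqrt{\frac{(2\ell+1)(\ell-m)!}{4\pi(\ell+m)!}}P_\ell^m(\cos\theta)e^{im\varphi}$, $\ell=0,1,\dots$, $m=-\ell,\dots,\ell$, with $P_\ell^m(x)=\frac{(-1)^m}{2^\ell\ell!}(1-x^2)^{m/2}\frac{d^{\ell+m}}{dx^{\ell+m}}(x^2-1)^\ell$. Subordinator. $\Phi(\lambda)=\int_0^{+\infty}(1-e^{-\lambda t})\nu_\Phi(dt)$, $\lambda\ge0$, where $\nu_\Phi$ is a measure on $(0,+\infty)$ with $\int_0^{+\infty}(1\wedge t)\nu_\Phi(dt)<\infty$ and $\nu_\Phi(0,+\infty)=+\infty$. $S_\Phi$ is a subordinator (increasing Lévy process with $S_\Phi(0)=0$) with $\mathbb{E}[e^{-\lambda S_\Phi(t)}]=e^{-t\Phi(\lambda)}$, $L_\Phi(t)=\inf\{s>0:S_\Phi(s)>t\}$,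 and $\mathfrak{e}_\Phi(t;\lambda)=\mathbb{E}[e^{\lambda L_\Phi(t)}]$ for $\lambda\in\mathbb{C}$, $t\ge0$. Process. $W^\mu$ is the diffusion (Feller) process on $\mathbb{S}^2$ generated by $\mathcal{G}_\mu$, $S_\Phi$ is independent of $W^\mu$, and $W^\mu_\Phi(t):=W^\mu(L_\Phi(t))$. $\mathbb{P}_x$ is the probability conditional on $W^\mu(0)=x$. For $t>0$, $p_\mu(t,y|x)=\sum_{\ell=0}^{+\infty}\sum_{m=-\ell}^{\ell}e^{(i\mu m-\ell(\ell+1))t}Y_{\ell,m}(x)\overline{Y}_{\ell,m}(y)$ is the transition density of $W^\mu$ with respect to $\sigma$. In the series in (ii), the summation is over $\ell$ of the inner finite sums over $m$. *)

theory Defs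
  imports "HOL-Probability.Probability"
begin

abbreviation S2 :: "(real^3) set" where
  "S2 \<equiv> sphere 0 1"

abbreviation S2_borel :: "(real^3) measure" where
  "S2_borel \<equiv> restrict_space borel S2"

definition sph :: "real \<Rightarrow> real \<Rightarrow> real^3" where
  "sph \<theta> \<phi> = vector [sin \<theta> * cos \<phi>, sin \<theta> * sin \<phi>, cos \<theta>]"

definition colat :: "real^3 \<Rightarrow> real" where
  "colat x = arccos (x $ 3)"

text \<open>The value lies in \<open>[0, 2 * pi)\<close>; at the two poles, where the longitude is not
  determined, it is 0.\<close>
definition longit :: "real^3 \<Rightarrow> real" where
  "longit x = Arg2pi (Complex (x $ 1) (x $ 2))"

text \<open>The Riemannian area element of the round metric
  \<open>g = d\<theta>\<^sup>2 + (sin \<theta>)\<^sup>2 d\<phi>\<^sup>2\<close> is \<open>sin \<theta> d\<theta> d\<phi>\<close>.\<close>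
definition surf :: "(real^3) measure" where
  "surf = distr (density (restrict_space lborel ({0..pi} \<times> {0..<2*pi})) (\<lambda>(\<theta>, \<phi>). ennreal (sin \<theta>)))
     S2_borel (\<lambda>(\<theta>, \<phi>). sph \<theta> \<phi>)"

definition square_integrable :: "(real^3 \<Rightarrow> real) \<Rightarrow> bool" where
  "square_integrable f \<longleftrightarrow> f \<in> borel_measurable surf \<and> integrable surf (\<lambda>y. (f y)\<^sup>2)"

text \<open>The factor \<open>(1 - x\<^sup>2)\<close> to the power \<open>m / 2\<close> is written as an integer power of a square
  root: then it is 1 for \<open>m = 0\<close> also at \<open>x = 1\<close> and \<open>x = -1\<close> (whereas \<open>0 powr 0 = 0\<close>), and for
  negative \<open>m\<close> the convention \<open>inverse 0 = 0\<close> produces at these points the continuous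
  extension of \<open>P\<close>, which is 0.\<close>
definition assoc_legendre :: "nat \<Rightarrow> int \<Rightarrow> real \<Rightarrow> real" where
  "assoc_legendre l m x =
     (-1) powi m / (2 ^ l * fact l) * sqrt (1 - x\<^sup>2) powi m *
     (deriv ^^ nat (int l + m)) (\<lambda>z. (z\<^sup>2 - 1) ^ l) x"

definition sph_harm :: "nat \<Rightarrow> int \<Rightarrow> real^3 \<Rightarrow> complex" where
  "sph_harm l m x =
     complex_of_real
       (sqrt ((2 * real l + 1) * fact (nat (int l - m)) / (4 * pi * fact (nat (int l + m)))) *
        assoc_legendre l m (cos (colat x))) *
     exp (\<i> * of_int m * complex_of_real (longit x))"

primrec Ck_on :: "nat \<Rightarrow> (real^3) set \<Rightarrow> (real^3 \<Rightarrow> real) \<Rightarrow> bool" where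
  "Ck_on 0 U F \<longleftrightarrow> continuous_on U F"
| "Ck_on (Suc k) U F \<longleftrightarrow> (\<exists>G. (\<forall>x\<in>U. GDERIV F x :> G x) \<and> (\<forall>i. Ck_on k U (\<lambda>x. G x $ i)))"

text \<open>Smooth functions on the sphere are the restrictions of functions that are smooth on an
  open neighbourhood of it.\<close>
definition smooth_S2 :: "(real^3 \<Rightarrow> real) \<Rightarrow> bool" where
  "smooth_S2 f \<longleftrightarrow>
     (\<exists>U F. open U \<and> S2 \<subseteq> U \<and> (\<forall>k. Ck_on k U F) \<and> (\<forall>x\<in>S2. f x = F x))"

text \<open>The local expression \<open>(1 / w) * (\<Sum>i j. \<partial>\<^sub>i (w * g\<^sup>i\<^sup>j * \<partial>\<^sub>j f))\<close>, \<open>w = sqrt (det g)\<close>, of the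
  Laplace-Beltrami operator, for the round metric in the spherical chart. It is meaningful away
  from the poles.\<close>
definition laplace_coord :: "(real^3 \<Rightarrow> real) \<Rightarrow> real \<Rightarrow> real \<Rightarrow> real" where
  "laplace_coord f \<theta> \<phi> =
     (1 / sin \<theta>) * deriv (\<lambda>\<theta>'. sin \<theta>' * deriv (\<lambda>\<theta>''. f (sph \<theta>'' \<phi>)) \<theta>') \<theta> +
     (1 / (sin \<theta>)\<^sup>2) * deriv (deriv (\<lambda>\<phi>'. f (sph \<theta> \<phi>'))) \<phi>"

text \<open>For smooth \<open>f\<close> the function \<open>\<Delta>\<^sub>g f\<close> is continuous on the sphere, so that its values at
  the two poles are limits of the values nearby.\<close>
definition laplace_beltrami :: "(real^3 \<Rightarrow> real) \<Rightarrow> real^3 \<Rightarrow> real" where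
  "laplace_beltrami f x =
     (if sin (colat x) \<noteq> 0 then laplace_coord f (colat x) (longit x)
      else Lim (at x within S2) (\<lambda>z. laplace_coord f (colat z) (longit z)))"

text \<open>At the poles \<open>sph \<theta> \<phi>'\<close> does not depend on \<open>\<phi>'\<close>, so the value there is 0.\<close>
definition rot_field :: "real \<Rightarrow> (real^3 \<Rightarrow> real) \<Rightarrow> real^3 \<Rightarrow> real" where
  "rot_field \<mu> f x = \<mu> * deriv (\<lambda>\<phi>'. f (sph (colat x) \<phi>')) (longit x)"

definition G_op :: "real \<Rightarrow> (real^3 \<Rightarrow> real) \<Rightarrow> real^3 \<Rightarrow> real" where
  "G_op \<mu> f x = laplace_beltrami f x + rot_field \<mu> f x"

definition trans_op ::
  "(real^3 \<Rightarrow> 'a measure) \<Rightarrow> (real \<Rightarrow> 'a \<Rightarrow> real^3) \<Rightarrow> real \<Rightarrow> (real^3 \<Rightarrow> real) \<Rightarrow> real^3 \<Rightarrow> real" where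
  "trans_op P W t f x = (\<integral>\<omega>. f (W t \<omega>) \<partial>P x)"

definition history :: "'a measure \<Rightarrow> (real \<Rightarrow> 'a \<Rightarrow> real^3) \<Rightarrow> real \<Rightarrow> 'a measure" where
  "history M W s =
     sigma (space M) {W u -` A \<inter> space M | u A. 0 \<le> u \<and> u \<le> s \<and> A \<in> sets S2_borel}"

text \<open>The measures \<open>P x\<close>, for \<open>x\<close> in the sphere, are the laws of the process started at \<open>x\<close>, on
  a common measurable space. The smooth functions form a core, so the generator (the uniform
  limit of the difference quotients of the Feller semigroup) is determined by its values on them.\<close>
locale sphere_diffusion =
  fixes P :: "real^3 \<Rightarrow> 'a measure" and W :: "real \<Rightarrow> 'a \<Rightarrow> real^3" and \<mu> :: real
  assumes prob: "x \<in> S2 \<Longrightarrow> prob_space (P x)"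
    and same_space: "x \<in> S2 \<Longrightarrow> y \<in> S2 \<Longrightarrow> sets (P x) = sets (P y)"
    and measurable: "x \<in> S2 \<Longrightarrow> 0 \<le> t \<Longrightarrow> W t \<in> measurable (P x) S2_borel"
    and start: "x \<in> S2 \<Longrightarrow> AE \<omega> in P x. W 0 \<omega> = x"
    and continuous_paths: "x \<in> S2 \<Longrightarrow> \<omega> \<in> space (P x) \<Longrightarrow> continuous_on {0..} (\<lambda>t. W t \<omega>)"
    and markov: "x \<in> S2 \<Longrightarrow> 0 \<le> s \<Longrightarrow> 0 \<le> t \<Longrightarrow> continuous_on S2 f \<Longrightarrow>
      AE \<omega> in P x. real_cond_exp (P x) (history (P x) W s) (\<lambda>\<omega>'. f (W (s + t) \<omega>')) \<omega>
        = trans_op P W t f (W s \<omega>)"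
    and feller: "0 \<le> t \<Longrightarrow> continuous_on S2 f \<Longrightarrow> continuous_on S2 (trans_op P W t f)"
    and strongly_continuous: "continuous_on S2 f \<Longrightarrow>
      uniform_limit S2 (\<lambda>t. trans_op P W t f) f (at_right 0)"
    and generator: "smooth_S2 f \<Longrightarrow>
      uniform_limit S2 (\<lambda>t x. (trans_op P W t f x - f x) / t) (G_op \<mu> f) (at_right 0)"

definition trans_density :: "real \<Rightarrow> real \<Rightarrow> real^3 \<Rightarrow> real^3 \<Rightarrow> complex" where
  "trans_density \<mu> t y x =
     (\<Sum>l. \<Sum>m = - int l..int l.
        exp ((\<i> * complex_of_real \<mu> * of_int m - of_nat (l * (l + 1))) * complex_of_real t) *
        sph_harm l m x * cnj (sph_harm l m y))"

locale infinite_levy_measure =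
  fixes \<nu> :: "real measure"
  assumes sets_eq: "sets \<nu> = sets (restrict_space borel {0<..})"
    and integrability: "(\<integral>\<^sup>+t. ennreal (min 1 t) \<partial>\<nu>) < \<infinity>"
    and infinite_mass: "emeasure \<nu> {0<..} = \<infinity>"

definition laplace_exponent :: "real measure \<Rightarrow> real \<Rightarrow> real" where
  "laplace_exponent \<nu> r = (\<integral>t. (1 - exp (- r * t)) \<partial>\<nu>)"

locale subordinator = prob_space M for M :: "'a measure" +
  fixes S :: "real \<Rightarrow> 'a \<Rightarrow> real" and \<Phi> :: "real \<Rightarrow> real"
  assumes rv: "0 \<le> t \<Longrightarrow> S t \<in> borel_measurable M"
    and zero: "\<omega> \<in> space M \<Longrightarrow> S 0 \<omega> = 0"
    and increasing: "\<omega> \<in> space M \<Longrightarrow> mono_on {0..} (\<lambda>t. S t \<omega>)"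
    and right_continuous:
      "\<omega> \<in> space M \<Longrightarrow> 0 \<le> t \<Longrightarrow> continuous (at_right t) (\<lambda>s. S s \<omega>)"
    and independent_increments: "0 \<le> \<tau> 0 \<Longrightarrow> incseq \<tau> \<Longrightarrow>
      indep_vars (\<lambda>_. borel) (\<lambda>i \<omega>. S (\<tau> (Suc i)) \<omega> - S (\<tau> i) \<omega>) (UNIV :: nat set)"
    and stationary_increments: "0 \<le> s \<Longrightarrow> 0 \<le> t \<Longrightarrow>
      distr M borel (\<lambda>\<omega>. S (s + t) \<omega> - S s \<omega>) = distr M borel (S t)"
    and laplace: "0 \<le> t \<Longrightarrow> 0 \<le> r \<Longrightarrow> expectation (\<lambda>\<omega>. exp (- r * S t \<omega>)) = exp (- t * \<Phi> r)"

text \<open>If the level \<open>t\<close> is never exceeded, which has probability 0 for a subordinator with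
  nonzero Laplace exponent, the infimum would be infinite; the value 0 is used instead.\<close>
definition inv_sub :: "(real \<Rightarrow> 'a \<Rightarrow> real) \<Rightarrow> real \<Rightarrow> 'a \<Rightarrow> real" where
  "inv_sub S t \<omega> = (if \<exists>s>0. S s \<omega> > t then Inf {s. s > 0 \<and> S s \<omega> > t} else 0)"

definition e_fun :: "'a measure \<Rightarrow> (real \<Rightarrow> 'a \<Rightarrow> real) \<Rightarrow> real \<Rightarrow> complex \<Rightarrow> complex" where
  "e_fun M S t z = (\<integral>\<omega>. exp (z * complex_of_real (inv_sub S t \<omega>)) \<partial>M)"

definition indep_processes ::
  "'a measure \<Rightarrow> (real \<Rightarrow> 'a \<Rightarrow> real^3) \<Rightarrow> (real \<Rightarrow> 'a \<Rightarrow> real) \<Rightarrow> bool" where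
  "indep_processes M W S \<longleftrightarrow>
     prob_space.indep_set M
       (sets (vimage_algebra (space M) (\<lambda>\<omega>. \<lambda>t\<in>{0..}. W t \<omega>) (\<Pi>\<^sub>M t\<in>{0..}. S2_borel)))
       (sets (vimage_algebra (space M) (\<lambda>\<omega>. \<lambda>t\<in>{0..}. S t \<omega>) (\<Pi>\<^sub>M t\<in>{0..}. borel)))"

definition time_changed :: "(real \<Rightarrow> 'a \<Rightarrow> real^3) \<Rightarrow> (real \<Rightarrow> 'a \<Rightarrow> real) \<Rightarrow> real \<Rightarrow> 'a \<Rightarrow> real^3" where
  "time_changed W S t \<omega> = W (inv_sub S t \<omega>) \<omega>"

end

theory Submission
  imports Defs
begin

text \<open>The law of the time-changed diffusion is determined through its spherical harmonic
  coefficients. Every spherical harmonic is an eigenfunction of the generator, with eigenvalue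
  \<open>\<lambda> = \<i> * \<mu> * m - l * (l + 1)\<close>, so the semigroup multiplies it by \<open>exp (\<lambda> * t)\<close>. The random time
  \<open>L = inv_sub S t\<close> is independent of the diffusion, so the mean of \<open>sph_harm l m\<close> at the time-changed
  process started at \<open>x\<close> is \<open>E[exp (\<lambda> * L)] * sph_harm l m x\<close>
  (\<open>expectation_time_changed_sph_harm\<close>). These means are exactly the coefficients of the series for
  the density. Finite combinations of spherical harmonics are uniformly dense among the continuous
  functions (\<open>harm_span_dense\<close>), hence an \<open>L\<^sup>2\<close> function that has these coefficients is a density of
  the law.

  Convergence rests on two estimates. The subordinator has to pass the level \<open>t\<close> before time \<open>s\<close> if
  \<open>L < s\<close>, which has probability at most \<open>C * s\<close>; therefore \<open>E[exp (- r * L)] \<le> C / r\<close>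
  (\<open>laplace_inv_sub_decay\<close>). As the squares of the harmonics of degree \<open>l\<close> add up to
  \<open>(2 * l + 1) / (4 * pi)\<close>, the coefficients are square summable, and the series converges in \<open>L\<^sup>2\<close>.
  For pointwise convergence this is not enough: the bound for the terms of degree \<open>l\<close> is of order
  \<open>1 / l\<close>. By the addition theorem the inner sum over \<open>m\<close> is the Legendre polynomial of degree \<open>l\<close>, up to
  the factor \<open>(2 * l + 1) / (4 * pi)\<close>, at the cosine of the angle between \<open>y\<close> and the point \<open>x\<close> rotated
  about the axis by \<open>\<mu> * L\<close>. If the colatitudes of \<open>x\<close> and \<open>y\<close> are neither equal nor supplementary,
  this angle stays away from \<open>0\<close> and \<open>pi\<close>, whatever the rotation, and there the Legendre polynomials are
  of order \<open>1 / sqrt l\<close> (\<open>legendre_decay\<close>). The terms are then of order \<open>l powr (- 3 / 2)\<close> already under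
  the expectation with absolute values, so that the sum and the expectation can be exchanged; this
  gives the series and the mean of \<open>trans_density\<close> at once (\<open>block_series\<close>).

  The law of \<open>L\<close> depends only on the Laplace exponent, by uniqueness of Laplace transforms
  (\<open>e_fun_unique\<close>), and the inner sums are real, so exchanging \<open>x\<close> and \<open>y\<close> has the effect of complex
  conjugation, that is, of changing the sign of \<open>\<mu>\<close>. Finally \<open>L\<close> tends to \<open>0\<close> with \<open>t\<close> because the
  infinite Levy measure makes the subordinator positive at all positive times, and the paths of the
  diffusion are continuous; this gives the initial condition.\<close>

definition rodrigues_base :: "nat \<Rightarrow> real poly" where
  "rodrigues_base l = [:-1, 0, 1:] ^ l"

section \<open>Derivatives of the Rodrigues polynomials\<close>

text \<open>For \<open>n = l + m\<close> this is, up to a constant and the power of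
  \<open>sqrt (1 - z\<^sup>2)\<close>, the associated Legendre function of degree \<open>l\<close> and order \<open>m\<close>.\<close>
definition rodrigues :: "nat \<Rightarrow> nat \<Rightarrow> real poly" where
  "rodrigues l n = (pderiv ^^ n) (rodrigues_base l)"

lemma rodrigues_0: "rodrigues l 0 = rodrigues_base l"
  by (simp add: rodrigues_def)

lemma pderiv_rodrigues [simp]: "pderiv (rodrigues l n) = rodrigues l (Suc n)"
  by (simp add: rodrigues_def)

lemma poly_rodrigues_base: "poly (rodrigues_base l) z = (z\<^sup>2 - 1) ^ l"
  by (simp add: rodrigues_base_def power2_eq_square algebra_simps)

lemma iterated_deriv_rodrigues: "(deriv ^^ n) (\<lambda>z::real. (z\<^sup>2 - 1) ^ l) = poly (rodrigues l n)"
proof (induction n)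
  case 0
  show ?case by (auto simp: rodrigues_0 poly_rodrigues_base)
next
  case (Suc n)
  have "deriv (poly (rodrigues l n)) = poly (rodrigues l (Suc n))"
    by (rule ext, rule DERIV_imp_deriv) (use poly_DERIV pderiv_rodrigues in metis)
  then show ?case using Suc by simp
qed

lemma poly_rodrigues_has_derivative [derivative_intros]:
  assumes "(f has_real_derivative f') (at x within A)"
  shows "((\<lambda>x. poly (rodrigues l n) (f x)) has_real_derivative poly (rodrigues l (Suc n)) (f x) * f') (at x within A)"
  using DERIV_chain2[OF poly_DERIV assms, of "rodrigues l n"] by (simp add: pderiv_rodrigues)

text \<open>The base function \<open>w = (z\<^sup>2 - 1) ^ l\<close> satisfies \<open>(z\<^sup>2 - 1) * w' = 2 * l * z * w\<close>; the identity is the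
  derivative of order \<open>n + 1\<close> of this equation. Everything that is needed about Legendre functions
  follows from it: their differential equation, the symmetry in the order, the norms and the action
  of rotations.\<close>
lemma rodrigues_ladder:
  "(z\<^sup>2 - 1) * poly (rodrigues l (Suc (Suc n))) z + 2 * (real n + 1 - real l) * z * poly (rodrigues l (Suc n)) z
     = (real n + 1) * (2 * real l - real n) * poly (rodrigues l n) z"
proof (induction n arbitrary: z)
  case 0
  have D: "((\<lambda>z. (z\<^sup>2 - 1) ^ l) has_real_derivative poly (rodrigues l (Suc 0)) z) (at z)" for z
    using poly_rodrigues_has_derivative[OF DERIV_ident, of l 0] by (simp add: poly_rodrigues_base[symmetric] rodrigues_0)
  have first: "(z\<^sup>2 - 1) * poly (rodrigues l (Suc 0)) z = 2 * real l * z * poly (rodrigues l 0) z" for z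
  proof (cases l)
    case (Suc k)
    have "((\<lambda>z. (z\<^sup>2 - 1) ^ l) has_real_derivative (real l * (z\<^sup>2 - 1) ^ k * (2 * z))) (at z)"
      by (rule derivative_eq_intros refl | simp add: Suc)+
    then have "poly (rodrigues l (Suc 0)) z = real l * (z\<^sup>2 - 1) ^ k * (2 * z)"
      using D DERIV_unique by blast
    then show ?thesis by (simp add: rodrigues_0 poly_rodrigues_base Suc algebra_simps)
  qed (simp add: rodrigues_def rodrigues_base_def)
  have "((\<lambda>z. (z\<^sup>2 - 1) * poly (rodrigues l (Suc 0)) z) has_real_derivative
      (2 * z * poly (rodrigues l (Suc 0)) z + (z\<^sup>2 - 1) * poly (rodrigues l (Suc (Suc 0))) z)) (at z)"
    by (rule derivative_eq_intros refl | simp)+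
  moreover have "((\<lambda>z. 2 * real l * z * poly (rodrigues l 0) z) has_real_derivative
      (2 * real l * poly (rodrigues l 0) z + 2 * real l * z * poly (rodrigues l (Suc 0)) z)) (at z)"
    by (rule derivative_eq_intros refl | simp)+
  ultimately have "2 * z * poly (rodrigues l (Suc 0)) z + (z\<^sup>2 - 1) * poly (rodrigues l (Suc (Suc 0))) z
      = 2 * real l * poly (rodrigues l 0) z + 2 * real l * z * poly (rodrigues l (Suc 0)) z"
    unfolding first by (rule DERIV_unique)
  then show ?case by (simp add: algebra_simps)
next
  case (Suc n)
  have "((\<lambda>z. (z\<^sup>2 - 1) * poly (rodrigues l (Suc (Suc n))) z
        + 2 * (real n + 1 - real l) * z * poly (rodrigues l (Suc n)) z) has_real_derivative
      (2 * z * poly (rodrigues l (Suc (Suc n))) z + (z\<^sup>2 - 1) * poly (rodrigues l (Suc (Suc (Suc n)))) z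
        + (2 * (real n + 1 - real l) * poly (rodrigues l (Suc n)) z
           + 2 * (real n + 1 - real l) * z * poly (rodrigues l (Suc (Suc n))) z))) (at z)"
    by (rule derivative_eq_intros refl | simp)+
  moreover have "((\<lambda>z. (real n + 1) * (2 * real l - real n) * poly (rodrigues l n) z) has_real_derivative
      (real n + 1) * (2 * real l - real n) * poly (rodrigues l (Suc n)) z) (at z)"
    by (rule derivative_eq_intros refl | simp)+
  ultimately have "2 * z * poly (rodrigues l (Suc (Suc n))) z + (z\<^sup>2 - 1) * poly (rodrigues l (Suc (Suc (Suc n)))) z
        + (2 * (real n + 1 - real l) * poly (rodrigues l (Suc n)) z
           + 2 * (real n + 1 - real l) * z * poly (rodrigues l (Suc (Suc n))) z)
      = (real n + 1) * (2 * real l - real n) * poly (rodrigues l (Suc n)) z"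
    unfolding Suc.IH by (rule DERIV_unique)
  then show ?case by (simp add: algebra_simps)
qed

lemma rodrigues_lowering:
  assumes "m \<le> l"
  shows "(z\<^sup>2 - 1) * poly (rodrigues l (l + m + 2)) z + 2 * (real m + 1) * z * poly (rodrigues l (l + m + 1)) z
     = (real l + real m + 1) * (real l - real m) * poly (rodrigues l (l + m)) z"
  using rodrigues_ladder[of z l "l + m"] by (simp add: algebra_simps)

lemma degree_rodrigues_base: "degree (rodrigues_base l) = 2 * l"
  by (simp add: rodrigues_base_def degree_power_eq)

lemma coeff_rodrigues_base_top: "coeff (rodrigues_base l) (2 * l) = 1"
proof -
  have "lead_coeff (rodrigues_base l) = 1" by (simp add: rodrigues_base_def lead_coeff_power)
  then show ?thesis by (simp add: degree_rodrigues_base)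
qed

lemma degree_rodrigues: "degree (rodrigues l n) = 2 * l - n"
  by (simp add: rodrigues_def degree_higher_pderiv degree_rodrigues_base)

lemma rodrigues_top: "rodrigues l (2 * l) = [:fact (2 * l):]"
proof -
  have "degree (rodrigues l (2 * l)) = 0" by (simp add: degree_rodrigues)
  then obtain c where c: "rodrigues l (2 * l) = [:c:]" using degree_eq_zeroE by blast
  have "coeff (rodrigues l (2 * l)) 0 = fact (2 * l)"
    unfolding rodrigues_def coeff_higher_pderiv by (simp add: coeff_rodrigues_base_top pochhammer_fact[symmetric])
  with c show ?thesis by simp
qed

text \<open>Differentiating the right-hand side once lowers \<open>m\<close> by one, by \<open>rodrigues_lowering\<close>; so the identity
  descends from \<open>m = l\<close>, where it says that the derivative of order \<open>2 * l\<close> is \<open>fact (2 * l)\<close>.\<close>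
lemma rodrigues_symmetry:
  assumes "m \<le> l"
  shows "poly (rodrigues l (l - m)) z = fact (l - m) / fact (l + m) * (z\<^sup>2 - 1) ^ m * poly (rodrigues l (l + m)) z"
  using assms
proof (induction arbitrary: z rule: inc_induct)
  case base
  show ?case using rodrigues_top[of l] by (simp add: rodrigues_0 poly_rodrigues_base mult_2[symmetric])
next
  case (step m)
  then obtain k where l: "l = Suc (m + k)" using less_iff_Suc_add by auto
  have sub: "l - m = Suc (l - Suc m)" using step by simp
  define c where "c = (fact (l - Suc m) / fact (l + Suc m) :: real)"
  have "((\<lambda>z. poly (rodrigues l (l - Suc m)) z) has_real_derivative poly (rodrigues l (l - m)) z) (at z)"
    by (rule derivative_eq_intros refl | simp add: sub)+
  moreover have "((\<lambda>z. c * (z\<^sup>2 - 1) ^ Suc m * poly (rodrigues l (l + Suc m)) z) has_real_derivative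
     c * (z\<^sup>2 - 1) ^ m * ((z\<^sup>2 - 1) * poly (rodrigues l (l + m + 2)) z
        + 2 * (real m + 1) * z * poly (rodrigues l (l + m + 1)) z)) (at z)"
    apply (rule derivative_eq_intros refl | simp)+
    apply (simp add: algebra_simps)
    done
  ultimately have "poly (rodrigues l (l - m)) z = c * (z\<^sup>2 - 1) ^ m * ((z\<^sup>2 - 1) * poly (rodrigues l (l + m + 2)) z
        + 2 * (real m + 1) * z * poly (rodrigues l (l + m + 1)) z)"
    unfolding step.IH[folded c_def] by (rule DERIV_unique)
  also have "\<dots> = c * (z\<^sup>2 - 1) ^ m * ((real l + real m + 1) * (real l - real m) * poly (rodrigues l (l + m)) z)"
    using step by (subst rodrigues_lowering) auto
  also have "\<dots> = (c * (real l + real m + 1) * (real l - real m)) * (z\<^sup>2 - 1) ^ m * poly (rodrigues l (l + m)) z"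
    by (simp only: mult_ac)
  also have "c * (real l + real m + 1) * (real l - real m) = fact (l - m) / fact (l + m)"
  proof -
    have 1: "fact (l - m) = (real l - real m) * fact (l - Suc m)" unfolding sub fact_Suc using step by simp
    have 2: "(fact (l + Suc m) :: real) = (real l + real m + 1) * fact (l + m)" by (simp add: algebra_simps)
    have "real l + real m + 1 \<noteq> 0" by linarith
    then have "A / (B * C) * B * D = D * A / C" if "B = real l + real m + 1" for A B C D :: real
      using that by simp
    from this[OF refl] show ?thesis unfolding c_def 1 2 .
  qed
  finally show ?case .
qed

text \<open>At \<open>z = 1\<close> the second derivative drops out of \<open>rodrigues_lowering\<close>, which leaves a recursion from the
  known top derivative downwards.\<close>
lemma rodrigues_at_1:
  assumes "j \<le> l"
  shows "poly (rodrigues l (l + j)) 1 * (fact j * fact (l - j)) = fact (l + j) * fact l * 2 ^ (l - j)"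
  using assms
proof (induction rule: inc_induct)
  case base
  show ?case using rodrigues_top[of l] by (simp add: mult_2[symmetric])
next
  case (step j)
  have sub: "l - j = Suc (l - Suc j)" using step by simp
  have low: "2 * (real j + 1) * poly (rodrigues l (l + Suc j)) 1
      = (real l + real j + 1) * (real l - real j) * poly (rodrigues l (l + j)) 1"
    using rodrigues_lowering[of j l 1] step by simp
  have f1: "fact (l - j) = (real l - real j) * fact (l - Suc j)" unfolding sub fact_Suc using step by simp
  have f2: "(fact (l + Suc j) :: real) = (real l + real j + 1) * fact (l + j)" by (simp add: algebra_simps)
  have f3: "fact (Suc j) = (real j + 1) * fact j" by (simp add: algebra_simps)
  have pos: "real l + real j + 1 \<noteq> 0" by linarith
  have "(real l + real j + 1) * (poly (rodrigues l (l + j)) 1 * (fact j * fact (l - j)))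
      = ((real l + real j + 1) * (real l - real j) * poly (rodrigues l (l + j)) 1) * (fact j * fact (l - Suc j))"
    unfolding f1 by (simp only: mult_ac)
  also have "\<dots> = 2 * (poly (rodrigues l (l + Suc j)) 1 * (fact (Suc j) * fact (l - Suc j)))"
    unfolding low[symmetric] f3 by (simp only: mult_ac)
  also have "\<dots> = (real l + real j + 1) * (fact (l + j) * fact l * 2 ^ (l - j))"
    unfolding step.IH f2 sub by (simp only: power_Suc mult_ac)
  finally show ?case using pos by (simp only: mult_cancel_left) blast
qed

lemma legendre_at_1: "poly (rodrigues l l) 1 = 2 ^ l * fact l"
  using rodrigues_at_1[of 0 l] by simp

section \<open>Norms and pointwise decay of Legendre functions\<close>

lemma has_integral_of_derivative:
  assumes "\<And>x. (F has_real_derivative f x) (at x)"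
  shows "(f has_integral (F 1 - F (-1))) {-1..1}"
  using assms by (intro fundamental_theorem_of_calculus)
    (auto simp: has_real_derivative_iff_has_vector_derivative[symmetric] intro: DERIV_subset)

definition rodrigues_inner :: "nat \<Rightarrow> nat \<Rightarrow> nat \<Rightarrow> real" where
  "rodrigues_inner m l k = integral {-1..1} (\<lambda>z. (1 - z\<^sup>2) ^ m * poly (rodrigues l (l + m)) z * poly (rodrigues k (k + m)) z)"

lemma rodrigues_inner_commute: "rodrigues_inner m l k = rodrigues_inner m k l"
  unfolding rodrigues_inner_def by (simp only: mult_ac)

text \<open>Integration by parts: the difference of the two integrands is the derivative of a polynomial with
  the factor \<open>(1 - z\<^sup>2) ^ Suc m\<close>, which vanishes at both end points.\<close>
lemma rodrigues_inner_Suc: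
  assumes "m \<le> k"
  shows "rodrigues_inner (Suc m) l k = (real k + real m + 1) * (real k - real m) * rodrigues_inner m l k"
proof -
  let ?f = "\<lambda>z. (1 - z\<^sup>2) ^ Suc m * poly (rodrigues l (l + Suc m)) z * poly (rodrigues k (k + Suc m)) z"
  let ?g = "\<lambda>z. (1 - z\<^sup>2) ^ m * poly (rodrigues l (l + m)) z * poly (rodrigues k (k + m)) z"
  let ?c = "(real k + real m + 1) * (real k - real m)"
  have "((\<lambda>z. ?f z - ?c * ?g z) has_integral
     ((\<lambda>z. (1 - z\<^sup>2) ^ Suc m * poly (rodrigues l (l + m)) z * poly (rodrigues k (k + Suc m)) z) 1 -
      (\<lambda>z. (1 - z\<^sup>2) ^ Suc m * poly (rodrigues l (l + m)) z * poly (rodrigues k (k + Suc m)) z) (-1))) {-1..1}"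
  proof (rule has_integral_of_derivative)
    fix z :: real
    have low: "?c * poly (rodrigues k (k + m)) z = (z\<^sup>2 - 1) * poly (rodrigues k (k + m + 2)) z
      + 2 * (real m + 1) * z * poly (rodrigues k (k + m + 1)) z"
      using rodrigues_lowering[OF assms, of z] by simp
    have eq: "?c * ?g z = (1 - z\<^sup>2) ^ m * poly (rodrigues l (l + m)) z * ((z\<^sup>2 - 1) * poly (rodrigues k (k + m + 2)) z
      + 2 * (real m + 1) * z * poly (rodrigues k (k + m + 1)) z)"
      unfolding low[symmetric] by (simp only: mult_ac)
    show "((\<lambda>z. (1 - z\<^sup>2) ^ Suc m * poly (rodrigues l (l + m)) z * poly (rodrigues k (k + Suc m)) z)
       has_real_derivative ?f z - ?c * ?g z) (at z)"
      unfolding eq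
      apply (rule derivative_eq_intros refl | simp)+
      apply (simp add: algebra_simps)
      done
  qed
  then have "integral {-1..1} (\<lambda>z. ?f z - ?c * ?g z) = 0"
    by (simp add: integral_unique)
  moreover have "integral {-1..1} (\<lambda>z. ?f z - ?c * ?g z)
      = integral {-1..1} ?f - integral {-1..1} (\<lambda>z. ?c * ?g z)"
    by (rule Henstock_Kurzweil_Integration.integral_diff)
       (auto intro!: integrable_continuous_real continuous_intros)
  ultimately show ?thesis unfolding rodrigues_inner_def by simp
qed

text \<open>By symmetry of the inner product, \<open>rodrigues_inner_Suc\<close> gives two expressions for the same number, with
  factors that differ by \<open>k * (k + 1) - l * (l + 1)\<close>.\<close>
lemma rodrigues_inner_orthogonal:
  assumes "m \<le> l" "m \<le> k" "l \<noteq> k"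
  shows "rodrigues_inner m l k = 0"
proof -
  have "(real k + real m + 1) * (real k - real m) * rodrigues_inner m l k
      = (real l + real m + 1) * (real l - real m) * rodrigues_inner m l k"
    using rodrigues_inner_Suc[OF assms(1), of k] rodrigues_inner_Suc[OF assms(2), of l]
    unfolding rodrigues_inner_commute[of _ k l] by simp
  then have "((real k + real l + 1) * (real k - real l)) * rodrigues_inner m l k = 0"
    by (simp add: algebra_simps)
  moreover have "(real k + real l + 1) * (real k - real l) \<noteq> 0" using assms by simp
  ultimately show ?thesis by simp
qed

lemma rodrigues_inner_norm_0: "m \<le> l \<Longrightarrow> rodrigues_inner m l l * fact (l - m) = fact (l + m) * rodrigues_inner 0 l l"
proof (induction m)
  case (Suc m)
  have sub: "l - m = Suc (l - Suc m)" using Suc by simp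
  have f1: "fact (l - m) = (real l - real m) * fact (l - Suc m)" unfolding sub fact_Suc using Suc by simp
  have f2: "(fact (l + Suc m) :: real) = (real l + real m + 1) * fact (l + m)" by (simp add: algebra_simps)
  have "rodrigues_inner (Suc m) l l * fact (l - Suc m) = (real l + real m + 1) * (rodrigues_inner m l l * fact (l - m))"
    using Suc.prems unfolding f1 by (subst rodrigues_inner_Suc) auto
  then show ?case using Suc unfolding f2 by simp
qed simp

lemma beta_recursion:
  "integral {-1..1} (\<lambda>z::real. (1 - z\<^sup>2) ^ Suc l) * (2 * real l + 3)
     = 2 * (real l + 1) * integral {-1..1} (\<lambda>z::real. (1 - z\<^sup>2) ^ l)"
proof -
  have "((\<lambda>z::real. (2 * real l + 3) * (1 - z\<^sup>2) ^ Suc l - 2 * (real l + 1) * (1 - z\<^sup>2) ^ l) has_integral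
     ((\<lambda>z. z * (1 - z\<^sup>2) ^ Suc l) 1 - (\<lambda>z. z * (1 - z\<^sup>2) ^ Suc l) (-1))) {-1..1}"
    apply (rule has_integral_of_derivative)
    apply (rule derivative_eq_intros refl | simp)+
    apply (simp add: algebra_simps power2_eq_square)
    done
  then have "integral {-1..1} (\<lambda>z::real. (2 * real l + 3) * (1 - z\<^sup>2) ^ Suc l - 2 * (real l + 1) * (1 - z\<^sup>2) ^ l) = 0"
    by (simp add: integral_unique)
  moreover have "integral {-1..1} (\<lambda>z::real. (2 * real l + 3) * (1 - z\<^sup>2) ^ Suc l - 2 * (real l + 1) * (1 - z\<^sup>2) ^ l)
     = integral {-1..1} (\<lambda>z::real. (2 * real l + 3) * (1 - z\<^sup>2) ^ Suc l) - integral {-1..1} (\<lambda>z. 2 * (real l + 1) * (1 - z\<^sup>2) ^ l)"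
    by (rule Henstock_Kurzweil_Integration.integral_diff)
       (auto intro!: integrable_continuous_real continuous_intros)
  ultimately show ?thesis by (simp add: mult.commute)
qed

lemma beta_value:
  "fact (2 * l) * integral {-1..1} (\<lambda>z::real. (1 - z\<^sup>2) ^ l) * (2 * real l + 1) = 2 * (2 ^ l * fact l)\<^sup>2"
proof (induction l)
  case (Suc l)
  let ?b = "\<lambda>l. integral {-1..1} (\<lambda>z::real. (1 - z\<^sup>2) ^ l)"
  have f: "(fact (2 * Suc l) :: real) = (2 * real l + 2) * (2 * real l + 1) * fact (2 * l)"
    by (simp add: algebra_simps)
  have "fact (2 * Suc l) * ?b (Suc l) * (2 * real (Suc l) + 1)
     = (2 * real l + 2) * (2 * real l + 1) * fact (2 * l) * (?b (Suc l) * (2 * real l + 3))"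
    unfolding f by (simp add: algebra_simps)
  also have "\<dots> = (2 * real l + 2)\<^sup>2 * (fact (2 * l) * ?b l * (2 * real l + 1))"
    unfolding beta_recursion by (simp add: power2_eq_square algebra_simps)
  also have "\<dots> = 2 * (2 ^ Suc l * fact (Suc l))\<^sup>2"
    unfolding Suc by (simp add: power2_eq_square algebra_simps)
  finally show ?case .
qed simp

text \<open>The norms of all orders \<open>m\<close> are tied together by \<open>rodrigues_inner_Suc\<close>, and for \<open>m = l\<close> the
  polynomials are constant, so that the norm is a beta integral.\<close>
lemma rodrigues_inner_norm:
  assumes "m \<le> l"
  shows "rodrigues_inner m l l = fact (l + m) / fact (l - m) * (2 * (2 ^ l * fact l)\<^sup>2 / (2 * real l + 1))"
proof -
  have "rodrigues_inner l l l = (fact (2 * l))\<^sup>2 * integral {-1..1} (\<lambda>z::real. (1 - z\<^sup>2) ^ l)"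
    unfolding rodrigues_inner_def using rodrigues_top[of l] by (simp add: mult_2[symmetric] power2_eq_square mult_ac)
  then have "rodrigues_inner 0 l l * fact (2 * l) = (fact (2 * l))\<^sup>2 * integral {-1..1} (\<lambda>z::real. (1 - z\<^sup>2) ^ l)"
    using rodrigues_inner_norm_0[of l l] by (simp add: mult_2[symmetric] mult_ac)
  then have "rodrigues_inner 0 l l = fact (2 * l) * integral {-1..1} (\<lambda>z::real. (1 - z\<^sup>2) ^ l)"
    by (simp add: power2_eq_square)
  then have "rodrigues_inner 0 l l = 2 * (2 ^ l * fact l)\<^sup>2 / (2 * real l + 1)"
    using beta_value[of l] by (simp add: eq_divide_eq)
  moreover have "rodrigues_inner m l l = fact (l + m) * rodrigues_inner 0 l l / fact (l - m)"
    using rodrigues_inner_norm_0[OF assms] by (simp add: eq_divide_eq)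
  ultimately show ?thesis by simp
qed

text \<open>The energy \<open>u = q\<^sup>2 + (1 - z\<^sup>2) * q'\<^sup>2 / (l * (l + 1))\<close> of a solution \<open>q\<close> of the Legendre equation has
  derivative \<open>2 * z * q'\<^sup>2 / (l * (l + 1))\<close>, and \<open>(1 - z\<^sup>2) * u\<close> has derivative \<open>- 2 * z * q\<^sup>2\<close>. So \<open>u\<close> is
  smallest at \<open>0\<close> and \<open>(1 - z\<^sup>2) * u\<close> is largest there, while the mean of \<open>u\<close> over \<open>[-1, 1]\<close> is the
  squared norm of \<open>q\<close>.\<close>
lemma legendre_decay:
  assumes "\<bar>z\<bar> \<le> 1"
  shows "(1 - z\<^sup>2) * (poly (rodrigues l l) z)\<^sup>2 \<le> 2 * (2 ^ l * fact l)\<^sup>2 / (2 * real l + 1)"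
proof (cases "l = 0")
  case True
  have "- 1 \<le> z\<^sup>2" by (rule order_trans[of _ 0]) auto
  then show ?thesis using True by (simp add: rodrigues_def rodrigues_base_def)
next
  case False
  define L where "L = real l * (real l + 1)"
  have L: "L > 0" using False by (simp add: L_def)
  let ?q = "poly (rodrigues l l)" and ?q1 = "poly (rodrigues l (Suc l))" and ?q2 = "poly (rodrigues l (Suc (Suc l)))"
  have ode: "(1 - z\<^sup>2) * ?q2 z = 2 * z * ?q1 z - L * ?q z" for z
    using rodrigues_lowering[of 0 l z] by (simp add: L_def algebra_simps)
  define u where "u z = (?q z)\<^sup>2 + (1 - z\<^sup>2) * (?q1 z)\<^sup>2 / L" for z
  have du: "(u has_real_derivative 2 * z * (?q1 z)\<^sup>2 / L) (at z)" for z
  proof -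
    have "(u has_real_derivative 2 * ?q z * ?q1 z + (- 2 * z * (?q1 z)\<^sup>2 + 2 * ?q1 z * ((1 - z\<^sup>2) * ?q2 z)) / L) (at z)"
      unfolding u_def
      by (rule derivative_eq_intros refl | use L in \<open>simp add: field_simps power2_eq_square\<close>)+
    also have "2 * ?q z * ?q1 z + (- 2 * z * (?q1 z)\<^sup>2 + 2 * ?q1 z * ((1 - z\<^sup>2) * ?q2 z)) / L
       = 2 * z * (?q1 z)\<^sup>2 / L"
      unfolding ode using L by (simp add: field_simps power2_eq_square)
    finally show ?thesis .
  qed
  have dv: "((\<lambda>z. (1 - z\<^sup>2) * u z) has_real_derivative - (2 * z * (?q z)\<^sup>2)) (at z)" for z
    apply (rule derivative_eq_intros du refl | simp)+
    apply (use L in \<open>simp add: u_def field_simps power2_eq_square\<close>)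
    done
  \<comment> \<open>the energy grows and the weighted energy decays away from the origin\<close>
  have u_min: "u 0 \<le> u z" for z
  proof (cases "z \<ge> 0")
    case True
    show ?thesis
    proof (rule DERIV_nonneg_imp_nondecreasing[OF True])
      fix x :: real assume "0 \<le> x"
      then have "0 \<le> 2 * x * (?q1 x)\<^sup>2 / L" using L by simp
      with du show "\<exists>y. (u has_real_derivative y) (at x) \<and> 0 \<le> y" by blast
    qed
  next
    case False
    then have "z \<le> 0" by simp
    then show ?thesis
    proof (rule DERIV_nonpos_imp_nonincreasing)
      fix x :: real assume "x \<le> 0"
      then have "2 * x * (?q1 x)\<^sup>2 / L \<le> 0" using L by (simp add: divide_le_0_iff mult_le_0_iff)
      with du show "\<exists>y. (u has_real_derivative y) (at x) \<and> y \<le> 0" by blast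
    qed
  qed
  have v_max: "(1 - z\<^sup>2) * u z \<le> u 0" for z
  proof -
    let ?v = "\<lambda>z. (1 - z\<^sup>2) * u z"
    have "?v z \<le> ?v 0"
    proof (cases "z \<ge> 0")
      case True
      show ?thesis
      proof (rule DERIV_nonpos_imp_nonincreasing[OF True])
        fix x :: real assume "0 \<le> x"
        then have "- (2 * x * (?q x)\<^sup>2) \<le> 0" by simp
        with dv show "\<exists>y. (?v has_real_derivative y) (at x) \<and> y \<le> 0" by blast
      qed
    next
      case False
      then have "z \<le> 0" by simp
      then show ?thesis
      proof (rule DERIV_nonneg_imp_nondecreasing)
        fix x :: real assume "x \<le> 0"
        then have "0 \<le> - (2 * x * (?q x)\<^sup>2)" by (simp add: mult_le_0_iff)
        with dv show "\<exists>y. (?v has_real_derivative y) (at x) \<and> 0 \<le> y" by blast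
      qed
    qed
    then show ?thesis by simp
  qed
  have cu: "continuous_on A u" for A
    using du DERIV_isCont continuous_at_imp_continuous_on by blast
  \<comment> \<open>the two parts of the energy have the same integral\<close>
  have "2 * u 0 = integral {-1..1} (\<lambda>z::real. u 0)" by simp
  also have "\<dots> \<le> integral {-1..1} u"
    by (rule integral_le) (auto intro!: integrable_continuous_real cu u_min)
  also have "\<dots> = integral {-1..1} (\<lambda>z. (?q z)\<^sup>2) + integral {-1..1} (\<lambda>z. (1 - z\<^sup>2) * (?q1 z)\<^sup>2 / L)"
    unfolding u_def
    by (rule Henstock_Kurzweil_Integration.integral_add)
       (use L in \<open>auto intro!: integrable_continuous_real continuous_intros\<close>)
  also have "\<dots> = rodrigues_inner 0 l l + rodrigues_inner 1 l l / L"
    unfolding rodrigues_inner_def by (simp add: power2_eq_square mult_ac)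
  also have "rodrigues_inner 1 l l = L * rodrigues_inner 0 l l"
    using rodrigues_inner_Suc[of 0 l l] by (simp add: L_def mult_ac)
  finally have "u 0 \<le> rodrigues_inner 0 l l" using L by simp
  also have "rodrigues_inner 0 l l = 2 * (2 ^ l * fact l)\<^sup>2 / (2 * real l + 1)"
    using rodrigues_inner_norm[of 0 l] by simp
  finally have "(1 - z\<^sup>2) * u z \<le> 2 * (2 ^ l * fact l)\<^sup>2 / (2 * real l + 1)"
    using v_max[of z] by linarith
  moreover have "(1 - z\<^sup>2) * (?q z)\<^sup>2 \<le> (1 - z\<^sup>2) * u z"
  proof -
    have "z\<^sup>2 \<le> 1" using assms by (simp add: abs_square_le_1)
    then show ?thesis unfolding u_def using L by (intro mult_left_mono) auto
  qed
  ultimately show ?thesis by linarith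
qed

section \<open>Spherical harmonics in Cartesian coordinates\<close>

definition planar :: "real^3 \<Rightarrow> complex" where
  "planar x = Complex (x $ 1) (x $ 2)"

text \<open>A polynomial in the Cartesian coordinates that agrees on the sphere with the spherical harmonic of
  order \<open>m \<ge> 0\<close>, up to the normalising constant \<open>harm_const\<close>.\<close>
definition raw_harm :: "nat \<Rightarrow> nat \<Rightarrow> real^3 \<Rightarrow> complex" where
  "raw_harm l m x = planar x ^ m * of_real (poly (rodrigues l (l + m)) (x $ 3))"

definition harm_const :: "nat \<Rightarrow> nat \<Rightarrow> real" where
  "harm_const l m = sqrt ((2 * real l + 1) * fact (l - m) / (4 * pi * fact (l + m))) * ((-1) ^ m / (2 ^ l * fact l))"

lemma S2_iff: "x \<in> S2 \<longleftrightarrow> (x $ 1)\<^sup>2 + (x $ 2)\<^sup>2 + (x $ 3)\<^sup>2 = 1"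
  by (simp add: norm_eq_sqrt_inner inner_vec_def sum_3 power2_eq_square)

lemma S2_third: "x \<in> S2 \<Longrightarrow> \<bar>x $ 3\<bar> \<le> 1"
  using component_le_norm_cart[of x 3] by simp

lemma cos_colat: "x \<in> S2 \<Longrightarrow> cos (colat x) = x $ 3"
  using S2_third[of x] by (simp add: colat_def cos_arccos_abs)

lemma norm_planar: "x \<in> S2 \<Longrightarrow> norm (planar x) = sqrt (1 - (x $ 3)\<^sup>2)"
proof -
  assume "x \<in> S2"
  then have "(x $ 1)\<^sup>2 + (x $ 2)\<^sup>2 = 1 - (x $ 3)\<^sup>2" unfolding S2_iff by linarith
  then show ?thesis unfolding planar_def by (simp add: cmod_def)
qed

lemma planar_polar: "x \<in> S2 \<Longrightarrow> planar x = of_real (sqrt (1 - (x $ 3)\<^sup>2)) * exp (\<i> * of_real (longit x))"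
  using Arg2pi[of "planar x"] unfolding is_Arg_def longit_def planar_def[symmetric] by (simp only: norm_planar)

lemma sph_nth [simp]:
  "sph \<theta> \<phi> $ 1 = sin \<theta> * cos \<phi>" "sph \<theta> \<phi> $ 2 = sin \<theta> * sin \<phi>" "sph \<theta> \<phi> $ 3 = cos \<theta>"
  by (simp_all add: sph_def)

lemma sph_in_S2: "sph \<theta> \<phi> \<in> S2"
proof -
  have "(sin \<theta> * cos \<phi>)\<^sup>2 + (sin \<theta> * sin \<phi>)\<^sup>2 = (sin \<theta>)\<^sup>2 * ((cos \<phi>)\<^sup>2 + (sin \<phi>)\<^sup>2)"
    by (simp only: power_mult_distrib distrib_left)
  then show ?thesis unfolding S2_iff by simp
qed

lemma planar_sph: "planar (sph \<theta> \<phi>) = of_real (sin \<theta>) * exp (\<i> * of_real \<phi>)"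
  by (simp add: planar_def complex_eq_iff Re_exp Im_exp)

lemma vec3_eq_iff: "x = y \<longleftrightarrow> x $ 1 = y $ 1 \<and> x $ 2 = y $ 2 \<and> x $ 3 = y $ 3" for x y :: "'a^3"
  by (simp add: vec_eq_iff forall_3)

lemma sin_colat: "x \<in> S2 \<Longrightarrow> sin (colat x) = sqrt (1 - (x $ 3)\<^sup>2)"
  using S2_third[of x] unfolding colat_def by (simp add: sin_arccos_abs)

lemma sph_colat_longit: "x \<in> S2 \<Longrightarrow> sph (colat x) (longit x) = x"
proof -
  assume x: "x \<in> S2"
  have "planar (sph (colat x) (longit x)) = planar x"
    using planar_polar[OF x] x by (simp add: planar_sph sin_colat)
  then show ?thesis using cos_colat[OF x] by (simp add: vec3_eq_iff planar_def)
qed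

lemma sph_harm_eq_raw_harm:
  assumes "x \<in> S2" "m \<le> l"
  shows "sph_harm l (int m) x = of_real (harm_const l m) * raw_harm l m x"
proof -
  have n1: "nat (int l + int m) = l + m" "nat (int l - int m) = l - m" by auto
  have e: "exp (\<i> * of_int (int m) * complex_of_real (longit x)) = exp (\<i> * complex_of_real (longit x)) ^ m"
    by (subst exp_of_nat_mult[symmetric]) (simp add: mult_ac)
  show ?thesis
    unfolding sph_harm_def assoc_legendre_def n1 e iterated_deriv_rodrigues cos_colat[OF assms(1)]
      raw_harm_def harm_const_def planar_polar[OF assms(1)]
    by (simp add: power_mult_distrib)
qed

lemma harm_const_square: "m \<le> l \<Longrightarrow> (harm_const l m)\<^sup>2 =
   (2 * real l + 1) / (4 * pi * (2 ^ l * fact l)\<^sup>2) * (fact (l - m) / fact (l + m))"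
proof -
  have "((-1 :: real) ^ m)\<^sup>2 = 1" by (cases "even m") auto
  then show ?thesis unfolding harm_const_def power_mult_distrib power_divide by simp
qed

text \<open>This is \<open>rodrigues_symmetry\<close> off the poles; at the poles both sides are \<open>0\<close> unless \<open>m = 0\<close>.\<close>
lemma sph_harm_neg:
  assumes x: "x \<in> S2" and "m \<le> l"
  shows "sph_harm l (- int m) x = (-1) ^ m * cnj (sph_harm l (int m) x)"
proof (cases "m = 0")
  case True
  have "sph_harm l 0 x = cnj (sph_harm l 0 x)"
    unfolding sph_harm_def by simp
  with True show ?thesis by simp
next
  case m: False
  define s where "s = sqrt (1 - (x $ 3)\<^sup>2)"
  have z2: "(x $ 3)\<^sup>2 \<le> 1" using S2_third[OF x] by (simp add: abs_square_le_1)
  then have s2: "s\<^sup>2 = 1 - (x $ 3)\<^sup>2" by (simp add: s_def)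
  have n1: "nat (int l + int m) = l + m" "nat (int l - int m) = l - m"
     "nat (int l + - int m) = l - m" "nat (int l - - int m) = l + m" by auto
  have e: "exp (\<i> * of_int (- int m) * complex_of_real (longit x))
      = cnj (exp (\<i> * of_int (int m) * complex_of_real (longit x)))"
    by (simp add: exp_cnj)
  have A: "sqrt ((2 * real l + 1) * fact (l + m) / (4 * pi * fact (l - m))) *
      ((- 1) powi - int m / (2 ^ l * fact l) * s powi - int m * poly (rodrigues l (l - m)) (x $ 3))
     = (-1) ^ m * (sqrt ((2 * real l + 1) * fact (l - m) / (4 * pi * fact (l + m))) *
      ((- 1) powi int m / (2 ^ l * fact l) * s powi int m * poly (rodrigues l (l + m)) (x $ 3)))"
  proof (cases "s = 0")
    case True
    then show ?thesis using m by (simp add: power_int_0_left_if)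
  next
    case False
    have sym: "poly (rodrigues l (l - m)) (x $ 3) = fact (l - m) / fact (l + m) * ((-1) ^ m * (s ^ m * s ^ m)) * poly (rodrigues l (l + m)) (x $ 3)"
    proof -
      have "(-1) ^ m * (s ^ m * s ^ m) = ((x $ 3)\<^sup>2 - 1) ^ m"
      proof -
        have "(-1) ^ m * (s ^ m * s ^ m) = (- 1 * (s * s)) ^ m" by (simp only: power_mult_distrib)
        also have "- 1 * (s * s) = (x $ 3)\<^sup>2 - 1" using s2 by (simp add: power2_eq_square)
        finally show ?thesis .
      qed
      then show ?thesis unfolding rodrigues_symmetry[OF assms(2)] by simp
    qed
    have sq: "sqrt (k * F / (4 * pi * G)) * (G / F) = sqrt (k * G / (4 * pi * F))"
      if "F > 0" "G > 0" "k \<ge> 0" for F G k :: real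
    proof -
      have "sqrt (k * F / (4 * pi * G)) * (G / F) = sqrt (k * F / (4 * pi * G) * (G / F)\<^sup>2)"
        unfolding real_sqrt_mult[of _ "(G / F)\<^sup>2"] using that by simp
      also have "k * F / (4 * pi * G) * (G / F)\<^sup>2 = k * G / (4 * pi * F)"
        using that by (simp add: field_simps power2_eq_square)
      finally show ?thesis .
    qed
    have sq': "sqrt ((2 * real l + 1) * fact (l - m) / (4 * pi * fact (l + m)))
      = sqrt ((2 * real l + 1) * fact (l + m) / (4 * pi * fact (l - m))) * (fact (l - m) / fact (l + m))"
      by (rule sq[symmetric]) auto
    have inv1: "inverse ((-1::real) ^ m) = (-1) ^ m"
      by (cases "even m") auto
    show ?thesis
      unfolding sym sq' power_int_minus power_int_of_nat inv1
      using False by (simp add: field_simps)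
  qed
  have "sph_harm l (- int m) x = of_real (sqrt ((2 * real l + 1) * fact (l + m) / (4 * pi * fact (l - m))) *
      ((- 1) powi - int m / (2 ^ l * fact l) * s powi - int m * poly (rodrigues l (l - m)) (x $ 3)))
      * cnj (exp (\<i> * of_int (int m) * complex_of_real (longit x)))"
    unfolding sph_harm_def assoc_legendre_def n1 e iterated_deriv_rodrigues cos_colat[OF x] s_def ..
  also have "\<dots> = (-1) ^ m * cnj (sph_harm l (int m) x)"
    unfolding A unfolding sph_harm_def assoc_legendre_def n1 iterated_deriv_rodrigues cos_colat[OF x] s_def
    by (simp add: mult.assoc)
  finally show ?thesis .
qed

lemma Re_of_real_mult: "Re (of_real c * z) = c * Re z"
  by simp

section \<open>The addition theorem\<close>

lemma sum_symmetric_int: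
  fixes f :: "int \<Rightarrow> 'b::comm_monoid_add"
  shows "(\<Sum>m = - int l..int l. f m) = f 0 + (\<Sum>k<l. f (int (Suc k)) + f (- int (Suc k)))"
proof (induction l)
  case (Suc l)
  have "{- int (Suc l)..int (Suc l)} = insert (int (Suc l)) (insert (- int (Suc l)) {- int l..int l})"
    by auto
  then show ?case using Suc by (simp add: add_ac)
qed simp

definition harm_weight :: "nat \<Rightarrow> nat \<Rightarrow> real" where
  "harm_weight l m = fact (l - m) / fact (l + m)"

text \<open>The reproducing kernel of degree \<open>l\<close> up to a constant, with the orders \<open>m\<close> and \<open>- m\<close> taken together:
  in this form it is a real polynomial.\<close>
definition harm_kernel :: "nat \<Rightarrow> real^3 \<Rightarrow> real^3 \<Rightarrow> real" where
  "harm_kernel l x y = harm_weight l 0 * Re (raw_harm l 0 x) * Re (raw_harm l 0 y)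
     + 2 * (\<Sum>k<l. harm_weight l (Suc k) * Re (raw_harm l (Suc k) x * cnj (raw_harm l (Suc k) y)))"

lemma sph_harm_kernel_eq:
  assumes x: "x \<in> S2" and y: "y \<in> S2"
  shows "(\<Sum>m = - int l..int l. sph_harm l m x * cnj (sph_harm l m y))
    = of_real ((2 * real l + 1) / (4 * pi * (2 ^ l * fact l)\<^sup>2) * harm_kernel l x y)"
proof -
  define C where "C = (2 * real l + 1) / (4 * pi * (2 ^ l * fact l)\<^sup>2)"
  have c2: "complex_of_real (harm_const l m) * complex_of_real (harm_const l m) = of_real (C * harm_weight l m)" if "m \<le> l" for m
    using harm_const_square[OF that] unfolding C_def by (simp only: harm_weight_def power2_eq_square[of "harm_const l m"] of_real_mult[symmetric])
  have pos: "sph_harm l (int m) x * cnj (sph_harm l (int m) y) = of_real (C * harm_weight l m) * (raw_harm l m x * cnj (raw_harm l m y))"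
    if "m \<le> l" for m
    unfolding sph_harm_eq_raw_harm[OF x that] sph_harm_eq_raw_harm[OF y that] c2[OF that, symmetric] by (simp add: mult_ac)
  have neg: "sph_harm l (- int m) x * cnj (sph_harm l (- int m) y) = cnj (sph_harm l (int m) x * cnj (sph_harm l (int m) y))"
    if "m \<le> l" for m
    unfolding sph_harm_neg[OF x that] sph_harm_neg[OF y that]
    by (simp add: mult_ac power_mult_distrib[symmetric])
  have h0: "raw_harm l 0 x = of_real (Re (raw_harm l 0 x))" for x by (simp add: raw_harm_def)
  have "(\<Sum>m = - int l..int l. sph_harm l m x * cnj (sph_harm l m y))
     = of_real (C * harm_weight l 0) * (raw_harm l 0 x * cnj (raw_harm l 0 y))
      + (\<Sum>k<l. of_real (2 * (C * harm_weight l (Suc k) * Re (raw_harm l (Suc k) x * cnj (raw_harm l (Suc k) y)))))"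
    unfolding sum_symmetric_int
  proof (intro arg_cong2[of _ _ _ _ "(+)"] sum.cong refl)
    show "sph_harm l 0 x * cnj (sph_harm l 0 y) = of_real (C * harm_weight l 0) * (raw_harm l 0 x * cnj (raw_harm l 0 y))"
      using pos[of 0] by simp
    fix k assume "k \<in> {..<l}"
    then have k: "Suc k \<le> l" by simp
    show "sph_harm l (int (Suc k)) x * cnj (sph_harm l (int (Suc k)) y) +
         sph_harm l (- int (Suc k)) x * cnj (sph_harm l (- int (Suc k)) y) =
         complex_of_real (2 * (C * harm_weight l (Suc k) * Re (raw_harm l (Suc k) x * cnj (raw_harm l (Suc k) y))))"
    proof -
      have "sph_harm l (int (Suc k)) x * cnj (sph_harm l (int (Suc k)) y) +
         sph_harm l (- int (Suc k)) x * cnj (sph_harm l (- int (Suc k)) y)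
         = of_real (2 * Re (of_real (C * harm_weight l (Suc k)) * (raw_harm l (Suc k) x * cnj (raw_harm l (Suc k) y))))"
        unfolding neg[OF k] pos[OF k] by (rule complex_add_cnj)
      also have "Re (of_real (C * harm_weight l (Suc k)) * (raw_harm l (Suc k) x * cnj (raw_harm l (Suc k) y)))
         = C * harm_weight l (Suc k) * Re (raw_harm l (Suc k) x * cnj (raw_harm l (Suc k) y))"
        by (rule Re_of_real_mult)
      finally show ?thesis .
    qed
  qed
  also have "\<dots> = of_real (C * harm_kernel l x y)"
    unfolding harm_kernel_def by (subst (1 2) h0) (simp add: sum_distrib_left algebra_simps)
  finally show ?thesis unfolding C_def .
qed

definition rot3 :: "real \<Rightarrow> real^3 \<Rightarrow> real^3" where
  "rot3 a x = vector [cos a * x $ 1 - sin a * x $ 2, sin a * x $ 1 + cos a * x $ 2, x $ 3]"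

definition rot2 :: "real \<Rightarrow> real^3 \<Rightarrow> real^3" where
  "rot2 a x = vector [cos a * x $ 1 + sin a * x $ 3, x $ 2, cos a * x $ 3 - sin a * x $ 1]"

lemma rot_nth [simp]:
  "rot3 a x $ 1 = cos a * x $ 1 - sin a * x $ 2" "rot3 a x $ 2 = sin a * x $ 1 + cos a * x $ 2"
  "rot3 a x $ 3 = x $ 3"
  "rot2 a x $ 1 = cos a * x $ 1 + sin a * x $ 3" "rot2 a x $ 2 = x $ 2"
  "rot2 a x $ 3 = cos a * x $ 3 - sin a * x $ 1"
  by (simp_all add: rot3_def rot2_def)

lemma rotation_square:
  fixes c s u v :: real
  shows "(c * u - s * v)\<^sup>2 + (s * u + c * v)\<^sup>2 = (s\<^sup>2 + c\<^sup>2) * (u\<^sup>2 + v\<^sup>2)"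
  by (simp add: power2_eq_square algebra_simps)

lemma rot3_S2: "x \<in> S2 \<Longrightarrow> rot3 a x \<in> S2"
  using rotation_square[of "cos a" "x $ 1" "sin a" "x $ 2"] unfolding S2_iff by simp

lemma rot2_S2: "x \<in> S2 \<Longrightarrow> rot2 a x \<in> S2"
  using rotation_square[of "cos a" "x $ 3" "sin a" "x $ 1"] unfolding S2_iff rot_nth by (simp add: add.commute)

lemma planar_rot3: "planar (rot3 a x) = exp (\<i> * of_real a) * planar x"
  by (simp add: planar_def complex_eq_iff Re_exp Im_exp)

lemma raw_harm_rot3: "raw_harm l m (rot3 a x) = exp (\<i> * of_real a) ^ m * raw_harm l m x"
  by (simp add: raw_harm_def planar_rot3 power_mult_distrib)

lemma harm_kernel_rot3: "harm_kernel l (rot3 a x) (rot3 a y) = harm_kernel l x y"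
proof -
  have "raw_harm l m (rot3 a x) * cnj (raw_harm l m (rot3 a y)) = raw_harm l m x * cnj (raw_harm l m y)" for m
  proof -
    have "exp (\<i> * of_real a) * cnj (exp (\<i> * of_real a)) = 1"
      unfolding exp_cnj mult_exp_exp by simp
    then have "exp (\<i> * of_real a) ^ m * cnj (exp (\<i> * of_real a)) ^ m = 1"
      by (simp add: power_mult_distrib[symmetric])
    then have "(exp (\<i> * of_real a) ^ m * cnj (exp (\<i> * of_real a)) ^ m) * (raw_harm l m x * cnj (raw_harm l m y)) = raw_harm l m x * cnj (raw_harm l m y)"
      by simp
    then show ?thesis
      unfolding raw_harm_rot3 complex_cnj_mult complex_cnj_power by (simp only: mult_ac)
  qed
  moreover have "raw_harm l 0 (rot3 a x) = raw_harm l 0 x" for x by (simp add: raw_harm_rot3)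
  ultimately show ?thesis unfolding harm_kernel_def by simp
qed

text \<open>Because of this the ladder of orders ends at \<open>m = l\<close>, and the telescoping sum in
  \<open>harm_kernel_rot2\<close> has no boundary term there.\<close>
lemma raw_harm_beyond: "l < m \<Longrightarrow> raw_harm l m x = 0"
proof -
  assume "l < m"
  obtain j where "l + m = Suc j + 2 * l" using \<open>l < m\<close> by (auto dest!: less_imp_Suc_add)
  then have "rodrigues l (l + m) = (pderiv ^^ Suc j) (rodrigues l (2 * l))"
    by (simp only: rodrigues_def funpow_add o_def)
  also have "\<dots> = (pderiv ^^ j) 0" unfolding rodrigues_top funpow_Suc_right o_def by simp
  also have "\<dots> = 0" by (induction j) auto
  finally show ?thesis by (simp add: raw_harm_def)
qed

lemma planar_rot2_derivative:
  "((\<lambda>a. planar (rot2 a x)) has_vector_derivative of_real (rot2 a x $ 3)) (at a)"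
proof -
  have "planar (rot2 a x) = of_real (cos a * x $ 1 + sin a * x $ 3) + \<i> * of_real (x $ 2)" for a
    by (simp add: planar_def complex_eq_iff)
  moreover have "((\<lambda>a. of_real (cos a * x $ 1 + sin a * x $ 3) + \<i> * complex_of_real (x $ 2)) has_vector_derivative
     of_real (rot2 a x $ 3)) (at a)"
    by (rule derivative_eq_intros refl | simp)+
  ultimately show ?thesis by simp
qed

lemma rodrigues_rot2_derivative:
  "((\<lambda>a. poly (rodrigues l n) (rot2 a x $ 3)) has_real_derivative
     - (poly (rodrigues l (Suc n)) (rot2 a x $ 3) * Re (planar (rot2 a x)))) (at a)"
  by (rule derivative_eq_intros refl | simp add: planar_def algebra_simps)+

lemma raw_harm_rot2_derivative_0:
  "((\<lambda>a. raw_harm l 0 (rot2 a x)) has_vector_derivative - of_real (Re (raw_harm l 1 (rot2 a x)))) (at a)"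
proof -
  have "((\<lambda>a. complex_of_real (poly (rodrigues l l) (rot2 a x $ 3))) has_vector_derivative
     of_real (- (poly (rodrigues l (Suc l)) (rot2 a x $ 3) * Re (planar (rot2 a x))))) (at a)"
    by (rule has_vector_derivative_of_real) (rule rodrigues_rot2_derivative)
  then show ?thesis by (simp add: raw_harm_def mult.commute del: rot_nth)
qed

text \<open>The infinitesimal rotation about the second axis is half the difference of a lowering and a raising
  operator; \<open>rodrigues_lowering\<close> identifies the lowered function.\<close>
lemma raw_harm_rot2_derivative_Suc:
  assumes "x \<in> S2" "k \<le> l"
  shows "((\<lambda>a. raw_harm l (Suc k) (rot2 a x)) has_vector_derivative
     (of_real ((real l + real k + 1) * (real l - real k)) * raw_harm l k (rot2 a x) - raw_harm l (k + 2) (rot2 a x)) / 2) (at a)"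
proof -
  define X where "X = planar (rot2 a x)"
  define z where "z = rot2 a x $ 3"
  let ?D = "\<lambda>n. complex_of_real (poly (rodrigues l n) z)"
  have power: "((\<lambda>a. planar (rot2 a x) ^ Suc k) has_vector_derivative of_real z * (of_nat (Suc k) * X ^ k)) (at a)"
    using field_vector_diff_chain_at[OF planar_rot2_derivative, of "\<lambda>w. w ^ Suc k" "of_nat (Suc k) * X ^ k" a x]
      DERIV_power[OF DERIV_ident, where n = "Suc k" and x = X and s = UNIV] by (simp add: o_def X_def z_def mult_ac del: power_Suc of_nat_Suc rot_nth)
  have legendre: "((\<lambda>a. complex_of_real (poly (rodrigues l (l + Suc k)) (rot2 a x $ 3))) has_vector_derivative
     of_real (- (poly (rodrigues l (Suc (l + Suc k))) z * Re X))) (at a)"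
    unfolding X_def z_def by (rule has_vector_derivative_of_real) (rule rodrigues_rot2_derivative)
  have D: "((\<lambda>a. raw_harm l (Suc k) (rot2 a x)) has_vector_derivative
     (X ^ Suc k * of_real (- (poly (rodrigues l (Suc (l + Suc k))) z * Re X))
      + of_real z * (of_nat (Suc k) * X ^ k) * ?D (l + Suc k))) (at a)"
    using has_vector_derivative_mult[OF power legendre] unfolding raw_harm_def X_def z_def .
  have "X * cnj X = of_real (1 - z\<^sup>2)"
  proof -
    have "rot2 a x \<in> S2" using rot2_S2[OF assms(1)] .
    from norm_planar[OF this] S2_third[OF this] have "(norm X)\<^sup>2 = 1 - z\<^sup>2"
      by (simp add: X_def z_def abs_square_le_1)
    then show ?thesis by (simp only: complex_norm_square[symmetric])
  qed
  then have XRe: "2 * X * of_real (Re X) = X\<^sup>2 + of_real (1 - z\<^sup>2)"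
  proof -
    have "2 * X * of_real (Re X) = X * (X + cnj X)" unfolding complex_add_cnj by simp
    then show ?thesis using \<open>X * cnj X = of_real (1 - z\<^sup>2)\<close> by (simp only: distrib_left power2_eq_square)
  qed
  have low: "of_real ((real l + real k + 1) * (real l - real k)) * ?D (l + k)
     = of_real (z\<^sup>2 - 1) * ?D (l + k + 2) + 2 * (of_nat k + 1) * of_real z * ?D (l + k + 1)"
    using arg_cong[OF rodrigues_lowering[OF assms(2), of z, symmetric], of complex_of_real] by simp
  have "(X ^ Suc k * of_real (- (poly (rodrigues l (Suc (l + Suc k))) z * Re X))
      + of_real z * (of_nat (Suc k) * X ^ k) * ?D (l + Suc k))
     = X ^ k * (- ((2 * X * of_real (Re X)) * ?D (l + k + 2)) + 2 * (of_nat k + 1) * of_real z * ?D (l + k + 1)) / 2"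
    by (simp add: field_simps)
  also have "\<dots> = X ^ k * (of_real ((real l + real k + 1) * (real l - real k)) * ?D (l + k) - X\<^sup>2 * ?D (l + k + 2)) / 2"
    unfolding XRe low by (simp add: algebra_simps)
  also have "\<dots> = (of_real ((real l + real k + 1) * (real l - real k)) * raw_harm l k (rot2 a x) - raw_harm l (k + 2) (rot2 a x)) / 2"
    unfolding raw_harm_def X_def z_def by (simp add: algebra_simps power_add power2_eq_square)
  finally show ?thesis using D by (simp only:)
qed

lemma has_vector_derivative_Re_mult_cnj:
  assumes "(f has_vector_derivative f') (at a)" "(g has_vector_derivative g') (at a)"
  shows "((\<lambda>a. Re (f a * cnj (g a))) has_real_derivative Re (f' * cnj (g a) + f a * cnj g')) (at a)"
proof -
  have "((\<lambda>a. cnj (g a)) has_vector_derivative cnj g') (at a)"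
    using assms(2) by (rule bounded_linear.has_vector_derivative[OF bounded_linear_cnj])
  from has_vector_derivative_mult[OF assms(1) this]
  have "((\<lambda>a. Re (f a * cnj (g a))) has_vector_derivative Re (f a * cnj g' + f' * cnj (g a))) (at a)"
    by (rule bounded_linear.has_vector_derivative[OF bounded_linear_Re])
  then show ?thesis by (simp add: has_real_derivative_iff_has_vector_derivative add.commute)
qed

lemma harm_weight_Suc: "k < l \<Longrightarrow> harm_weight l (Suc k) * ((real l + real k + 1) * (real l - real k)) = harm_weight l k"
proof -
  assume k: "k < l"
  have sub: "l - k = Suc (l - Suc k)" using k by simp
  have 1: "fact (l - k) = (real l - real k) * fact (l - Suc k)" unfolding sub fact_Suc using k by simp
  have 2: "(fact (l + Suc k) :: real) = (real l + real k + 1) * fact (l + k)" by (simp add: algebra_simps)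
  have "real l + real k + 1 \<noteq> 0" by linarith
  then have "A / (B * C) * (B * D) = D * A / C" if "B = real l + real k + 1" for A B C D :: real
    using that by simp
  from this[OF refl] show ?thesis unfolding harm_weight_def 1 2 .
qed

text \<open>With the weights \<open>harm_weight\<close> the infinitesimal rotation is skew-symmetric in the basis of the
  harmonics of degree \<open>l\<close>. The derivative of the kernel along a simultaneous rotation of both
  arguments is therefore a telescoping sum that vanishes.\<close>
lemma harm_kernel_rot2:
  assumes x: "x \<in> S2" and y: "y \<in> S2"
  shows "harm_kernel l (rot2 a x) (rot2 a y) = harm_kernel l x y"
proof -
  have "((\<lambda>a. harm_kernel l (rot2 a x) (rot2 a y)) has_real_derivative 0) (at a)" for a
  proof -
    let ?A = "\<lambda>m. raw_harm l m (rot2 a x)" and ?B = "\<lambda>m. raw_harm l m (rot2 a y)"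
    let ?b = "\<lambda>k. (real l + real k + 1) * (real l - real k)"
    define T where "T k = Re (?A k * cnj (?B (Suc k)) + ?A (Suc k) * cnj (?B k))" for k
    have h0: "Re (raw_harm l 0 u) * Re (raw_harm l 0 v) = Re (raw_harm l 0 u * cnj (raw_harm l 0 v))" for u v
      by (simp add: raw_harm_def)
    have im0: "Im (raw_harm l 0 u) = 0" for u by (simp add: raw_harm_def)
    have "((\<lambda>a. harm_kernel l (rot2 a x) (rot2 a y)) has_real_derivative
       harm_weight l 0 * Re (- of_real (Re (?A 1)) * cnj (?B 0) + ?A 0 * cnj (- of_real (Re (?B 1))))
       + 2 * (\<Sum>k<l. harm_weight l (Suc k) * Re ((of_real (?b k) * ?A k - ?A (k + 2)) / 2 * cnj (?B (Suc k))
            + ?A (Suc k) * cnj ((of_real (?b k) * ?B k - ?B (k + 2)) / 2)))) (at a)"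
      unfolding harm_kernel_def mult.assoc h0
      by (intro DERIV_add DERIV_cmult DERIV_sum has_vector_derivative_Re_mult_cnj raw_harm_rot2_derivative_0
          raw_harm_rot2_derivative_Suc x y) auto
    also have "2 * (\<Sum>k<l. harm_weight l (Suc k) * Re ((of_real (?b k) * ?A k - ?A (k + 2)) / 2 * cnj (?B (Suc k))
            + ?A (Suc k) * cnj ((of_real (?b k) * ?B k - ?B (k + 2)) / 2)))
       = (\<Sum>k<l. harm_weight l k * T k - harm_weight l (Suc k) * T (Suc k))"
      unfolding sum_distrib_left
    proof (intro sum.cong refl)
      fix k assume "k \<in> {..<l}"
      then have k: "harm_weight l k = harm_weight l (Suc k) * ?b k" using harm_weight_Suc[of k l] by simp
      show "2 * (harm_weight l (Suc k) * Re ((of_real (?b k) * ?A k - ?A (k + 2)) / 2 * cnj (?B (Suc k))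
            + ?A (Suc k) * cnj ((of_real (?b k) * ?B k - ?B (k + 2)) / 2)))
           = harm_weight l k * T k - harm_weight l (Suc k) * T (Suc k)"
        unfolding k T_def by (simp add: field_simps)
    qed
    also have "\<dots> = harm_weight l 0 * T 0 - harm_weight l l * T l" by (rule sum_lessThan_telescope')
    also have "T l = 0" by (simp add: T_def raw_harm_beyond)
    also have "harm_weight l 0 * Re (- of_real (Re (?A 1)) * cnj (?B 0) + ?A 0 * cnj (- of_real (Re (?B 1))))
       + (harm_weight l 0 * T 0 - harm_weight l l * 0) = 0"
      unfolding T_def by (simp add: im0 algebra_simps)
    finally show ?thesis .
  qed
  then have "harm_kernel l (rot2 a x) (rot2 a y) = harm_kernel l (rot2 0 x) (rot2 0 y)"
    using DERIV_isconst_all[of "\<lambda>a. harm_kernel l (rot2 a x) (rot2 a y)" a 0] by blast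
  moreover have "rot2 0 x = x" for x by (simp add: vec3_eq_iff)
  ultimately show ?thesis by simp
qed

text \<open>Rotations about the third and the second axis carry \<open>y\<close> to the north pole, where only the harmonic
  of order \<open>0\<close> is nonzero; the third coordinate of the rotated \<open>x\<close> is \<open>x \<bullet> y\<close>.\<close>
lemma harm_kernel_eq_legendre:
  assumes x: "x \<in> S2" and y: "y \<in> S2"
  shows "harm_kernel l x y = 2 ^ l * fact l * poly (rodrigues l l) (x \<bullet> y)"
proof -
  define \<theta> where "\<theta> = colat y"
  define \<phi> where "\<phi> = longit y"
  define x' where "x' = rot2 (- \<theta>) (rot3 (- \<phi>) x)"
  define y' where "y' = rot2 (- \<theta>) (rot3 (- \<phi>) y)"
  have "harm_kernel l x y = harm_kernel l x' y'"
    unfolding x'_def y'_def harm_kernel_rot2[OF rot3_S2[OF x] rot3_S2[OF y]] harm_kernel_rot3 ..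
  have y_eq: "y = sph \<theta> \<phi>" using sph_colat_longit[OF y] by (simp add: \<theta>_def \<phi>_def)
  have "cos \<phi> * (sin \<theta> * cos \<phi>) + sin \<phi> * (sin \<theta> * sin \<phi>) = sin \<theta> * ((sin \<phi>)\<^sup>2 + (cos \<phi>)\<^sup>2)"
    unfolding power2_eq_square by (simp only: distrib_left mult_ac add_ac)
  then have r3y: "rot3 (- \<phi>) y = sph \<theta> 0"
    unfolding y_eq vec3_eq_iff by simp
  then have y': "y' $ 1 = 0" "y' $ 2 = 0" "y' $ 3 = 1"
    unfolding y'_def using sin_cos_squared_add[of \<theta>] by (simp_all add: power2_eq_square algebra_simps)
  have planar: "planar y' = 0" by (simp add: planar_def y' complex_eq_iff)
  have x3: "x' $ 3 = x \<bullet> y"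
    unfolding x'_def y_eq by (simp add: inner_vec_def sum_3 algebra_simps)
  have "raw_harm l (Suc k) y' = 0" for k by (simp add: raw_harm_def planar)
  then have "harm_kernel l x' y' = harm_weight l 0 * Re (raw_harm l 0 x') * Re (raw_harm l 0 y')"
    unfolding harm_kernel_def by simp
  then have "harm_kernel l x' y' = poly (rodrigues l l) (x \<bullet> y) * poly (rodrigues l l) 1"
    by (simp add: harm_weight_def raw_harm_def x3 y')
  then show ?thesis using \<open>harm_kernel l x y = harm_kernel l x' y'\<close> by (simp add: legendre_at_1)
qed

lemma addition_theorem:
  assumes x: "x \<in> S2" and y: "y \<in> S2"
  shows "(\<Sum>m = - int l..int l. sph_harm l m x * cnj (sph_harm l m y))
    = of_real ((2 * real l + 1) / (4 * pi) * (poly (rodrigues l l) (x \<bullet> y) / (2 ^ l * fact l)))"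
  unfolding sph_harm_kernel_eq[OF assms] harm_kernel_eq_legendre[OF assms] by (simp add: power2_eq_square)

lemma sum_sph_harm_square:
  assumes x: "x \<in> S2"
  shows "(\<Sum>m = - int l..int l. (norm (sph_harm l m x))\<^sup>2) = (2 * real l + 1) / (4 * pi)"
proof -
  have "x \<bullet> x = 1" using x by (simp add: dot_square_norm)
  then have "complex_of_real (\<Sum>m = - int l..int l. (norm (sph_harm l m x))\<^sup>2) = of_real ((2 * real l + 1) / (4 * pi))"
    using addition_theorem[OF x x, of l] by (simp add: complex_norm_square legendre_at_1 del: of_real_power)
  then show ?thesis by (simp only: of_real_eq_iff)
qed

lemma sph_harm_rot3:
  assumes x: "x \<in> S2" and m: "m \<in> {- int l..int l}"
  shows "sph_harm l m (rot3 a x) = exp (\<i> * of_int m * of_real a) * sph_harm l m x"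
proof -
  have pos: "sph_harm l (int k) (rot3 a x) = exp (\<i> * of_int (int k) * of_real a) * sph_harm l (int k) x" if "k \<le> l" for k
    unfolding sph_harm_eq_raw_harm[OF x that] sph_harm_eq_raw_harm[OF rot3_S2[OF x] that] raw_harm_rot3
    by (subst exp_of_nat_mult[symmetric]) (simp add: mult_ac)
  show ?thesis
  proof (cases "m \<ge> 0")
    case True
    then show ?thesis using pos[of "nat m"] m by simp
  next
    case False
    then obtain k where k: "m = - int k" "k \<le> l" using m by (intro that[of "nat (- m)"]) auto
    show ?thesis unfolding k(1) sph_harm_neg[OF x k(2)] sph_harm_neg[OF rot3_S2[OF x] k(2)] pos[OF k(2)]
      by (simp add: exp_cnj mult_ac)
  qed
qed

section \<open>Spherical harmonics as eigenfunctions of the generator\<close>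

lemma real_polynomial_function_gradient:
  fixes f :: "real^3 \<Rightarrow> real"
  assumes "real_polynomial_function f"
  shows "\<exists>G. (\<forall>x. GDERIV f x :> G x) \<and> (\<forall>i. real_polynomial_function (\<lambda>x. G x $ i))"
  using assms
proof induction
  case (linear f)
  have "GDERIV f x :> adjoint f 1" for x
  proof -
    have "(\<lambda>h. h \<bullet> adjoint f 1) = f"
      using adjoint_works[OF bounded_linear.linear[OF linear]] by (auto simp: fun_eq_iff)
    then show ?thesis
      unfolding gderiv_def using bounded_linear_imp_has_derivative[OF linear] by simp
  qed
  then show ?case by (intro exI[of _ "\<lambda>_. adjoint f 1"]) auto
next
  case (const c)
  then show ?case by (intro exI[of _ "\<lambda>_. 0"]) (auto simp: GDERIV_const)
next
  case (add f g)
  then obtain F G where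
    "\<forall>x. GDERIV f x :> F x" "\<forall>i. real_polynomial_function (\<lambda>x. F x $ i)"
    "\<forall>x. GDERIV g x :> G x" "\<forall>i. real_polynomial_function (\<lambda>x. G x $ i)" by blast
  then show ?case by (intro exI[of _ "\<lambda>x. F x + G x"]) (auto intro!: GDERIV_add real_polynomial_function.intros(3))
next
  case (mult f g)
  then obtain F G where
    "\<forall>x. GDERIV f x :> F x" "\<forall>i. real_polynomial_function (\<lambda>x. F x $ i)"
    "\<forall>x. GDERIV g x :> G x" "\<forall>i. real_polynomial_function (\<lambda>x. G x $ i)" by blast
  then show ?case using mult(1,2)
    by (intro exI[of _ "\<lambda>x. f x *\<^sub>R G x + g x *\<^sub>R F x"])
       (auto intro!: GDERIV_mult real_polynomial_function.intros(3) real_polynomial_function.intros(4))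
qed

lemma real_polynomial_function_Ck:
  fixes f :: "real^3 \<Rightarrow> real"
  shows "real_polynomial_function f \<Longrightarrow> Ck_on k U f"
proof (induction k arbitrary: f)
  case 0
  then show ?case
    by (simp add: continuous_at_imp_continuous_on continuous_real_polymonial_function)
next
  case (Suc k)
  obtain G where "\<forall>x. GDERIV f x :> G x" "\<forall>i. real_polynomial_function (\<lambda>x. G x $ i)"
    using real_polynomial_function_gradient[OF Suc.prems] by blast
  then show ?case using Suc.IH by (auto intro!: exI[of _ G])
qed

definition complex_polynomial :: "(real^3 \<Rightarrow> complex) \<Rightarrow> bool" where
  "complex_polynomial f \<longleftrightarrow> real_polynomial_function (\<lambda>x. Re (f x)) \<and> real_polynomial_function (\<lambda>x. Im (f x))"

lemma complex_polynomial_const: "complex_polynomial (\<lambda>x. c)"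
  by (auto simp: complex_polynomial_def)

lemma complex_polynomial_of_real: "real_polynomial_function f \<Longrightarrow> complex_polynomial (\<lambda>x. of_real (f x))"
  by (auto simp: complex_polynomial_def)

lemma complex_polynomial_mult: "complex_polynomial f \<Longrightarrow> complex_polynomial g \<Longrightarrow> complex_polynomial (\<lambda>x. f x * g x)"
  by (auto simp: complex_polynomial_def)

lemma complex_polynomial_cnj: "complex_polynomial f \<Longrightarrow> complex_polynomial (\<lambda>x. cnj (f x))"
  by (auto simp: complex_polynomial_def)

lemma complex_polynomial_power: "complex_polynomial f \<Longrightarrow> complex_polynomial (\<lambda>x. f x ^ n)"
  by (induction n) (auto intro: complex_polynomial_const complex_polynomial_mult)

lemma real_polynomial_function_nth: "real_polynomial_function (\<lambda>x::real^3. x $ i)"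
  by (rule real_polynomial_function.intros(1)) (rule bounded_linear_vec_nth)

lemma real_polynomial_function_poly:
  "real_polynomial_function f \<Longrightarrow> real_polynomial_function (\<lambda>x. poly p (f x))"
  by (induction p) (auto intro!: real_polynomial_function.intros(2-4))

lemma complex_polynomial_raw_harm: "complex_polynomial (raw_harm l m)"
proof -
  have "complex_polynomial planar" unfolding complex_polynomial_def planar_def by (auto intro: real_polynomial_function_nth)
  moreover have "complex_polynomial (\<lambda>x. of_real (poly (rodrigues l (l + m)) (x $ 3)))"
    by (intro complex_polynomial_of_real real_polynomial_function_poly real_polynomial_function_nth)
  ultimately show ?thesis unfolding raw_harm_def[abs_def] by (intro complex_polynomial_mult complex_polynomial_power)
qed

lemma sph_harm_complex_polynomial:
  assumes "m \<in> {- int l..int l}"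
  obtains F where "complex_polynomial F" "\<And>x. x \<in> S2 \<Longrightarrow> sph_harm l m x = F x"
proof (cases "m \<ge> 0")
  case True
  then have m: "m = int (nat m)" "nat m \<le> l" using assms by auto
  show ?thesis
  proof (rule that)
    show "complex_polynomial (\<lambda>x. of_real (harm_const l (nat m)) * raw_harm l (nat m) x)"
      by (intro complex_polynomial_mult complex_polynomial_const complex_polynomial_raw_harm)
    show "sph_harm l m x = of_real (harm_const l (nat m)) * raw_harm l (nat m) x" if "x \<in> S2" for x
      using sph_harm_eq_raw_harm[OF that m(2)] m(1) by simp
  qed
next
  case False
  then have m: "m = - int (nat (- m))" "nat (- m) \<le> l" using assms by auto
  show ?thesis
  proof (rule that)
    show "complex_polynomial (\<lambda>x. (-1) ^ nat (- m) * cnj (of_real (harm_const l (nat (- m))) * raw_harm l (nat (- m)) x))"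
      by (intro complex_polynomial_mult complex_polynomial_const complex_polynomial_raw_harm complex_polynomial_cnj)
    show "sph_harm l m x = (-1) ^ nat (- m) * cnj (of_real (harm_const l (nat (- m))) * raw_harm l (nat (- m)) x)"
      if "x \<in> S2" for x
      using sph_harm_neg[OF that m(2)] sph_harm_eq_raw_harm[OF that m(2)] m(1) by simp
  qed
qed

lemma continuous_on_sph_harm:
  assumes "m \<in> {- int l..int l}"
  shows "continuous_on S2 (sph_harm l m)"
proof -
  obtain F where F: "complex_polynomial F" "\<And>x. x \<in> S2 \<Longrightarrow> sph_harm l m x = F x"
    using sph_harm_complex_polynomial[OF assms] by blast
  have "continuous_on S2 (\<lambda>x. Complex (Re (F x)) (Im (F x)))"
    using F(1) unfolding complex_polynomial_def
    by (intro continuous_on_Complex continuous_at_imp_continuous_on ballI continuous_real_polymonial_function) auto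
  then have "continuous_on S2 F" by (simp add: complex_surj)
  then show ?thesis by (rule continuous_on_eq) (use F(2) in simp)
qed

lemma smooth_sph_harm:
  assumes "m \<in> {- int l..int l}"
  shows "smooth_S2 (\<lambda>x. Re (c * sph_harm l m x))"
proof -
  obtain F where F: "complex_polynomial F" "\<And>x. x \<in> S2 \<Longrightarrow> sph_harm l m x = F x"
    using sph_harm_complex_polynomial[OF assms] by blast
  have "real_polynomial_function (\<lambda>x. Re (c * F x))"
    using complex_polynomial_mult[OF complex_polynomial_const F(1)] by (simp add: complex_polynomial_def)
  then show ?thesis
    unfolding smooth_S2_def
    using F(2) real_polynomial_function_Ck by (intro exI[of _ UNIV] exI[of _ "\<lambda>x. Re (c * F x)"]) auto
qed

text \<open>The dependence of the spherical harmonics of order \<open>k\<close> and \<open>- k\<close> on the colatitude, up to sign.\<close>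
definition polar :: "nat \<Rightarrow> nat \<Rightarrow> real \<Rightarrow> real" where
  "polar l k \<theta> = harm_const l k * (sin \<theta> ^ k * poly (rodrigues l (l + k)) (cos \<theta>))"

lemma sph_harm_sph:
  assumes "m \<in> {- int l..int l}"
  obtains k s where "k \<le> l" "\<bar>m\<bar> = int k" "s \<in> {-1, 1}"
    "\<And>\<theta> \<phi>. sph_harm l m (sph \<theta> \<phi>) = of_real (s * polar l k \<theta>) * exp (\<i> * of_int m * of_real \<phi>)"
proof -
  define k where "k = nat \<bar>m\<bar>"
  have k: "k \<le> l" "\<bar>m\<bar> = int k" using assms by (auto simp: k_def)
  have pos: "sph_harm l (int k) (sph \<theta> \<phi>) = of_real (polar l k \<theta>) * exp (\<i> * of_nat k * of_real \<phi>)" for \<theta> \<phi>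
  proof -
    have "exp (\<i> * of_real \<phi>) ^ k = exp (\<i> * of_nat k * of_real \<phi>)"
      by (subst exp_of_nat_mult[symmetric]) (simp add: mult_ac)
    then show ?thesis
      unfolding sph_harm_eq_raw_harm[OF sph_in_S2 k(1)] polar_def raw_harm_def planar_sph
      by (simp add: power_mult_distrib)
  qed
  show ?thesis
  proof (cases "m \<ge> 0")
    case True
    then have "m = int k" using k by simp
    show ?thesis by (rule that[OF k, of 1]) (use pos \<open>m = int k\<close> in auto)
  next
    case False
    then have m: "m = - int k" using k by simp
    have "(-1) ^ k \<in> {-1, 1 :: real}" by (cases "even k") auto
    moreover have "sph_harm l m (sph \<theta> \<phi>) = of_real ((-1) ^ k * polar l k \<theta>) * exp (\<i> * of_int m * of_real \<phi>)" for \<theta> \<phi>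
      unfolding m sph_harm_neg[OF sph_in_S2 k(1)] pos by (simp add: exp_cnj)
    ultimately show ?thesis by (rule that[OF k])
  qed
qed

definition dpolar :: "nat \<Rightarrow> nat \<Rightarrow> real \<Rightarrow> real" where
  "dpolar l k \<theta> = harm_const l k * (real k * sin \<theta> ^ (k - 1) * cos \<theta> * poly (rodrigues l (l + k)) (cos \<theta>)
      - sin \<theta> ^ Suc k * poly (rodrigues l (Suc (l + k))) (cos \<theta>))"

lemma polar_derivative: "(polar l k has_real_derivative dpolar l k \<theta>) (at \<theta>)"
  unfolding polar_def[abs_def] dpolar_def
  by (rule derivative_eq_intros refl | simp add: algebra_simps)+

text \<open>The associated Legendre equation in the variable \<open>\<theta>\<close>, which \<open>rodrigues_lowering\<close> becomes after the
  substitution \<open>z = cos \<theta>\<close>.\<close>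
lemma polar_legendre_equation:
  assumes "k \<le> l" "sin \<theta> \<noteq> 0"
  shows "((\<lambda>\<theta>. sin \<theta> * dpolar l k \<theta>) has_real_derivative
     sin \<theta> * ((real k)\<^sup>2 / (sin \<theta>)\<^sup>2 - real (l * (l + 1))) * polar l k \<theta>) (at \<theta>)"
proof -
  let ?D = "\<lambda>j. poly (rodrigues l (l + j)) (cos \<theta>)"
  have "sin \<theta> * dpolar l k \<theta> = harm_const l k * (real k * (sin \<theta> ^ k * (cos \<theta> * poly (rodrigues l (l + k)) (cos \<theta>)))
      - sin \<theta> ^ (k + 2) * poly (rodrigues l (Suc (l + k))) (cos \<theta>))" for \<theta>
    unfolding dpolar_def by (cases k) (simp_all add: algebra_simps)
  moreover have "((\<lambda>\<theta>. harm_const l k * (real k * (sin \<theta> ^ k * (cos \<theta> * poly (rodrigues l (l + k)) (cos \<theta>)))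
      - sin \<theta> ^ (k + 2) * poly (rodrigues l (Suc (l + k))) (cos \<theta>))) has_real_derivative
      harm_const l k * (real k * (real k * sin \<theta> ^ (k - 1) * cos \<theta> * (cos \<theta> * ?D k)
          + sin \<theta> ^ k * (- sin \<theta> * ?D k - sin \<theta> * cos \<theta> * ?D (k + 1)))
      - (real (k + 2) * sin \<theta> ^ (k + 1) * cos \<theta> * ?D (k + 1) - sin \<theta> ^ (k + 3) * ?D (k + 2)))) (at \<theta>)"
    by (rule derivative_eq_intros refl | simp add: algebra_simps power_add eval_nat_numeral)+
  ultimately have D: "((\<lambda>\<theta>. sin \<theta> * dpolar l k \<theta>) has_real_derivative
      harm_const l k * (real k * (real k * sin \<theta> ^ (k - 1) * cos \<theta> * (cos \<theta> * ?D k)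
          + sin \<theta> ^ k * (- sin \<theta> * ?D k - sin \<theta> * cos \<theta> * ?D (k + 1)))
      - (real (k + 2) * sin \<theta> ^ (k + 1) * cos \<theta> * ?D (k + 1) - sin \<theta> ^ (k + 3) * ?D (k + 2)))) (at \<theta>)"
    (is "(_ has_real_derivative ?R) _")
    by simp
  define s c where "s = sin \<theta>" and "c = cos \<theta>"
  have c2: "c\<^sup>2 = 1 - s\<^sup>2" unfolding s_def c_def by (rule cos_squared_eq)
  have kk: "real k * s ^ (k - 1) * s = real k * s ^ k" by (cases k) auto
  have low: "s\<^sup>2 * ?D (k + 2) = 2 * (real k + 1) * c * ?D (k + 1) - (real l + real k + 1) * (real l - real k) * ?D k"
  proof -
    have "c\<^sup>2 - 1 = - s\<^sup>2" using c2 by simp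
    then show ?thesis
      using rodrigues_lowering[OF assms(1), of c] unfolding c_def[symmetric] by (simp add: add.assoc)
  qed
  have "s * ?R = harm_const l k * (real k * ((real k * s ^ (k - 1) * s) * c\<^sup>2 * ?D k
          + s ^ k * (- (s\<^sup>2 * ?D k) - s\<^sup>2 * c * ?D (k + 1)))
      - (real (k + 2) * s ^ k * s\<^sup>2 * c * ?D (k + 1) - s ^ k * s\<^sup>2 * (s\<^sup>2 * ?D (k + 2))))"
    unfolding s_def[symmetric] c_def[symmetric]
    by (simp add: power2_eq_square eval_nat_numeral algebra_simps)
  also have "\<dots> = ((real k)\<^sup>2 - s\<^sup>2 * real (l * (l + 1))) * (harm_const l k * (s ^ k * ?D k))"
    unfolding kk low c2 by (simp add: power2_eq_square algebra_simps)
  also have "\<dots> = s * (s * ((real k)\<^sup>2 / s\<^sup>2 - real (l * (l + 1))) * polar l k \<theta>)"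
    using assms(2) unfolding polar_def s_def[symmetric] c_def[symmetric]
    by (simp add: power2_eq_square field_simps)
  finally have "?R = sin \<theta> * ((real k)\<^sup>2 / (sin \<theta>)\<^sup>2 - real (l * (l + 1))) * polar l k \<theta>"
    using assms(2) unfolding s_def by (metis mult_left_cancel)
  with D show ?thesis by (simp only:)
qed

text \<open>A real part \<open>Re (c * sph_harm l m x)\<close>, with arbitrary complex \<open>c\<close>, covers the real and the imaginary
  part of the harmonic together; in the chart it is a product of a function of \<open>\<theta>\<close> and a function
  \<open>w\<close> of \<open>\<phi>\<close>.\<close>
lemma sph_harm_laplace_coord:
  assumes "m \<in> {- int l..int l}" "sin \<theta> \<noteq> 0"
  shows "laplace_coord (\<lambda>x. Re (c * sph_harm l m x)) \<theta> \<phi>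
     = - real (l * (l + 1)) * Re (c * sph_harm l m (sph \<theta> \<phi>))"
proof -
  obtain k s where k: "k \<le> l" "\<bar>m\<bar> = int k"
    and Y: "\<And>\<theta> \<phi>. sph_harm l m (sph \<theta> \<phi>) = of_real (s * polar l k \<theta>) * exp (\<i> * of_int m * of_real \<phi>)"
    using sph_harm_sph[OF assms(1)] by metis
  have m2: "(real_of_int m)\<^sup>2 = (real k)\<^sup>2"
    using k(2) by (metis abs_of_nat of_int_abs of_int_of_nat_eq power2_abs)
  define w where "w j \<phi> = Re (c * (\<i> * of_int m) ^ j * exp (\<i> * of_int m * of_real \<phi>))" for j and \<phi> :: real
  have f: "Re (c * sph_harm l m (sph \<theta> \<phi>)) = s * polar l k \<theta> * w 0 \<phi>" for \<theta> \<phi>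
  proof -
    have "c * sph_harm l m (sph \<theta> \<phi>) = of_real (s * polar l k \<theta>) * (c * exp (\<i> * of_int m * of_real \<phi>))"
      unfolding Y by (simp only: mult_ac)
    then show ?thesis by (simp only: Re_of_real_mult w_def power_0 mult_1_right)
  qed
  have dw: "(w j has_real_derivative w (Suc j) \<phi>) (at \<phi>)" for j \<phi>
  proof -
    have "((\<lambda>z. c * (\<i> * of_int m) ^ j * exp (\<i> * of_int m * z)) has_field_derivative
       c * (\<i> * of_int m) ^ Suc j * exp (\<i> * of_int m * of_real \<phi>)) (at (of_real \<phi>))"
      by (rule derivative_eq_intros refl | simp)+
    from has_vector_derivative_real_field[OF this]
    have "((\<lambda>\<phi>. c * (\<i> * of_int m) ^ j * exp (\<i> * of_int m * of_real \<phi>)) has_vector_derivative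
       c * (\<i> * of_int m) ^ Suc j * exp (\<i> * of_int m * of_real \<phi>)) (at \<phi>)" .
    then have "((\<lambda>\<phi>. Re (c * (\<i> * of_int m) ^ j * exp (\<i> * of_int m * of_real \<phi>))) has_vector_derivative
       Re (c * (\<i> * of_int m) ^ Suc j * exp (\<i> * of_int m * of_real \<phi>))) (at \<phi>)"
      by (rule bounded_linear.has_vector_derivative[OF bounded_linear_Re])
    then show ?thesis unfolding w_def[abs_def] has_real_derivative_iff_has_vector_derivative .
  qed
  have w2: "w 2 \<phi> = - ((real k)\<^sup>2 * w 0 \<phi>)" for \<phi>
  proof -
    have "(\<i> * of_int m)\<^sup>2 = of_real (- (real_of_int m)\<^sup>2)" by (simp add: power_mult_distrib)
    then have "c * (\<i> * of_int m)\<^sup>2 * exp (\<i> * of_int m * of_real \<phi>)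
      = of_real (- (real_of_int m)\<^sup>2) * (c * (\<i> * of_int m) ^ 0 * exp (\<i> * of_int m * of_real \<phi>))"
      by (simp add: mult_ac)
    then show ?thesis unfolding w_def m2 by (simp only: Re_of_real_mult)
  qed
  have d1: "deriv (\<lambda>\<theta>. s * polar l k \<theta> * w 0 \<phi>) = (\<lambda>\<theta>. s * w 0 \<phi> * dpolar l k \<theta>)"
    by (rule ext, rule DERIV_imp_deriv) (auto intro!: derivative_eq_intros polar_derivative)
  have d2: "deriv (\<lambda>\<theta>'. sin \<theta>' * (s * w 0 \<phi> * dpolar l k \<theta>')) \<theta>
     = s * w 0 \<phi> * (sin \<theta> * ((real k)\<^sup>2 / (sin \<theta>)\<^sup>2 - real (l * (l + 1))) * polar l k \<theta>)"
  proof (rule DERIV_imp_deriv)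
    have "(\<lambda>\<theta>'. sin \<theta>' * (s * w 0 \<phi> * dpolar l k \<theta>')) = (\<lambda>\<theta>'. (s * w 0 \<phi>) * (sin \<theta>' * dpolar l k \<theta>'))"
      by (simp add: fun_eq_iff)
    then show "((\<lambda>\<theta>'. sin \<theta>' * (s * w 0 \<phi> * dpolar l k \<theta>')) has_real_derivative
      s * w 0 \<phi> * (sin \<theta> * ((real k)\<^sup>2 / (sin \<theta>)\<^sup>2 - real (l * (l + 1))) * polar l k \<theta>)) (at \<theta>)"
      using DERIV_cmult[OF polar_legendre_equation[OF k(1) assms(2)], of "s * w 0 \<phi>"] by simp
  qed
  have d3: "deriv (\<lambda>\<phi>. s * polar l k \<theta> * w j \<phi>) = (\<lambda>\<phi>. s * polar l k \<theta> * w (Suc j) \<phi>)" for j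
    by (rule ext, rule DERIV_imp_deriv, rule DERIV_cmult, rule dw)
  show ?thesis
    unfolding laplace_coord_def f d1 d2 d3 numeral_2_eq_2[symmetric] w2
    using assms(2) by (simp add: field_simps power2_eq_square)
qed

lemma S2_pole_unique:
  assumes "x \<in> S2" "z \<in> S2" "\<bar>x $ 3\<bar> = 1" "z $ 3 = x $ 3"
  shows "z = x"
proof -
  have "(x $ 3)\<^sup>2 = 1" using assms(3) by (metis one_power2 power2_abs)
  then have "(x $ 1)\<^sup>2 + (x $ 2)\<^sup>2 = 0" "(z $ 1)\<^sup>2 + (z $ 2)\<^sup>2 = 0"
    using assms(1,2,4) unfolding S2_iff by auto
  then show ?thesis using assms(4) unfolding vec3_eq_iff by (simp add: sum_power2_eq_zero_iff)
qed

text \<open>At a pole the value is the limit of the eigenvalue times the function, which is continuous.\<close>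
lemma sph_harm_laplace_beltrami:
  assumes m: "m \<in> {- int l..int l}" and x: "x \<in> S2"
  shows "laplace_beltrami (\<lambda>x. Re (c * sph_harm l m x)) x = - real (l * (l + 1)) * Re (c * sph_harm l m x)"
proof -
  let ?f = "\<lambda>x. Re (c * sph_harm l m x)"
  have reg: "laplace_coord ?f (colat z) (longit z) = - real (l * (l + 1)) * ?f z"
    if "z \<in> S2" "sin (colat z) \<noteq> 0" for z
    using sph_harm_laplace_coord[OF m that(2), of c "longit z"] sph_colat_longit[OF that(1)] by simp
  show ?thesis
  proof (cases "sin (colat x) = 0")
    case False
    then show ?thesis using reg[OF x] by (simp add: laplace_beltrami_def)
  next
    case True
    then have "(x $ 3)\<^sup>2 = 1" unfolding sin_colat[OF x] by simp
    then have pole: "\<bar>x $ 3\<bar> = 1" by (auto simp: power2_eq_1_iff)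
    have "((\<lambda>z. - real (l * (l + 1)) * ?f z) \<longlongrightarrow> - real (l * (l + 1)) * ?f x) (at x within S2)"
      using continuous_on_sph_harm[OF m] x
      by (intro tendsto_intros) (auto simp: continuous_on_def)
    moreover have "eventually (\<lambda>z. - real (l * (l + 1)) * ?f z = laplace_coord ?f (colat z) (longit z)) (at x within S2)"
    proof -
      have "((\<lambda>z. z $ 3 * x $ 3) \<longlongrightarrow> x $ 3 * x $ 3) (at x within S2)"
        by (intro tendsto_intros)
      then have "eventually (\<lambda>z. z $ 3 * x $ 3 > 0) (at x within S2)"
        by (rule order_tendstoD) (use \<open>(x $ 3)\<^sup>2 = 1\<close> in \<open>simp add: power2_eq_square\<close>)
      moreover have "eventually (\<lambda>z. z \<in> S2 \<and> z \<noteq> x) (at x within S2)"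
        by (auto simp: eventually_at_filter)
      ultimately show ?thesis
      proof eventually_elim
        case (elim z)
        then have z: "z \<in> S2" by simp
        have "sin (colat z) \<noteq> 0"
        proof
          assume "sin (colat z) = 0"
          then have "(z $ 3)\<^sup>2 = 1" unfolding sin_colat[OF z] by simp
          then have "z $ 3 = x $ 3" using elim \<open>(x $ 3)\<^sup>2 = 1\<close> by (auto simp: power2_eq_1_iff)
          then show False using S2_pole_unique[OF x z pole] elim by simp
        qed
        then show ?case using reg[OF z] by simp
      qed
    qed
    ultimately have "((\<lambda>z. laplace_coord ?f (colat z) (longit z)) \<longlongrightarrow> - real (l * (l + 1)) * ?f x) (at x within S2)"
      by (rule Lim_transform_eventually)
    moreover have "at x within S2 \<noteq> bot"
    proof -
      \<comment> \<open>the limit defining the value at the pole is unique as the sphere has no isolated points\<close>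
      have "x islimpt S2"
      proof (rule connected_imp_perfect)
        show "connected S2" by (rule connected_sphere) simp
        show "x \<in> S2" by fact
        have "- x \<noteq> x"
        proof
          assume "- x = x"
          then have "2 *\<^sub>R x = 0" by (metis scaleR_2 add.left_inverse)
          then show False using x by simp
        qed
        moreover have "- x \<in> S2" using x by simp
        ultimately show "S2 \<noteq> {a}" for a using x by (metis singletonD)
      qed
      then show ?thesis by (simp add: trivial_limit_within)
    qed
    ultimately have "Lim (at x within S2) (\<lambda>z. laplace_coord ?f (colat z) (longit z)) = - real (l * (l + 1)) * ?f x"
      by (intro tendsto_Lim) auto
    then show ?thesis using True by (simp add: laplace_beltrami_def)
  qed
qed

lemma sph_harm_rot_field:
  assumes m: "m \<in> {- int l..int l}" and x: "x \<in> S2"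
  shows "rot_field \<mu> (\<lambda>x. Re (c * sph_harm l m x)) x = Re (c * (\<i> * of_real \<mu> * of_int m) * sph_harm l m x)"
proof -
  obtain k s where k: "k \<le> l" "\<bar>m\<bar> = int k"
    and Y: "\<And>\<theta> \<phi>. sph_harm l m (sph \<theta> \<phi>) = of_real (s * polar l k \<theta>) * exp (\<i> * of_int m * of_real \<phi>)"
    using sph_harm_sph[OF m] by metis
  define u where "u = c * of_real (s * polar l k (colat x))"
  have "((\<lambda>z. u * exp (\<i> * of_int m * z)) has_field_derivative
       u * (\<i> * of_int m) * exp (\<i> * of_int m * of_real (longit x))) (at (of_real (longit x)))"
    by (rule derivative_eq_intros refl | simp)+
  from has_vector_derivative_real_field[OF this]
  have "((\<lambda>\<phi>. Re (u * exp (\<i> * of_int m * of_real \<phi>))) has_vector_derivative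
       Re (u * (\<i> * of_int m) * exp (\<i> * of_int m * of_real (longit x)))) (at (longit x))"
    by (rule bounded_linear.has_vector_derivative[OF bounded_linear_Re])
  then have D: "deriv (\<lambda>\<phi>. Re (u * exp (\<i> * of_int m * of_real \<phi>))) (longit x)
     = Re (u * (\<i> * of_int m) * exp (\<i> * of_int m * of_real (longit x)))"
    unfolding has_real_derivative_iff_has_vector_derivative[symmetric] by (rule DERIV_imp_deriv)
  have f: "c * sph_harm l m (sph (colat x) \<phi>) = u * exp (\<i> * of_int m * of_real \<phi>)" for \<phi>
    unfolding Y u_def by (simp only: mult_ac)
  have "rot_field \<mu> (\<lambda>x. Re (c * sph_harm l m x)) x
     = \<mu> * Re (u * (\<i> * of_int m) * exp (\<i> * of_int m * of_real (longit x)))"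
    unfolding rot_field_def f D ..
  also have "\<dots> = Re (of_real \<mu> * (\<i> * of_int m) * (u * exp (\<i> * of_int m * of_real (longit x))))"
    unfolding Re_of_real_mult[symmetric] by (simp only: mult_ac)
  also have "\<dots> = Re (c * (\<i> * of_real \<mu> * of_int m) * sph_harm l m x)"
    unfolding f[symmetric] sph_colat_longit[OF x] by (simp only: mult_ac)
  finally show ?thesis .
qed

definition eigenvalue :: "real \<Rightarrow> nat \<Rightarrow> int \<Rightarrow> complex" where
  "eigenvalue \<mu> l m = \<i> * of_real \<mu> * of_int m - of_nat (l * (l + 1))"

lemma sph_harm_eigenfunction:
  assumes m: "m \<in> {- int l..int l}" and x: "x \<in> S2"
  shows "G_op \<mu> (\<lambda>x. Re (c * sph_harm l m x)) x = Re (c * (eigenvalue \<mu> l m * sph_harm l m x))"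
proof -
  have "of_nat (l * (l + 1)) = complex_of_real (real (l * (l + 1)))" by simp
  then have "c * (eigenvalue \<mu> l m * sph_harm l m x) = c * (\<i> * of_real \<mu> * of_int m) * sph_harm l m x
     - of_real (real (l * (l + 1))) * (c * sph_harm l m x)"
    unfolding eigenvalue_def by (simp only: algebra_simps)
  then have "Re (c * (eigenvalue \<mu> l m * sph_harm l m x)) = Re (c * (\<i> * of_real \<mu> * of_int m) * sph_harm l m x)
     - real (l * (l + 1)) * Re (c * sph_harm l m x)"
    by (simp only: minus_complex.sel Re_of_real_mult)
  then show ?thesis
    unfolding G_op_def sph_harm_laplace_beltrami[OF assms] sph_harm_rot_field[OF assms] by linarith
qed

section \<open>Density of the spherical harmonics\<close>

text \<open>Functions that agree on the sphere with a finite linear combination of spherical harmonics; their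
  values off the sphere are arbitrary.\<close>
inductive harm_span :: "(real^3 \<Rightarrow> complex) \<Rightarrow> bool" where
  harm: "m \<in> {- int l..int l} \<Longrightarrow> harm_span (\<lambda>x. c * sph_harm l m x)"
| sum: "harm_span f \<Longrightarrow> harm_span g \<Longrightarrow> harm_span (\<lambda>x. f x + g x)"
| on_sphere: "harm_span f \<Longrightarrow> (\<And>x. x \<in> S2 \<Longrightarrow> g x = f x) \<Longrightarrow> harm_span g"

lemma harm_span_zero: "harm_span (\<lambda>x. 0)"
  using harm_span.harm[of 0 0 0] by simp

lemma harm_span_scale: "harm_span f \<Longrightarrow> harm_span (\<lambda>x. a * f x)"
proof (induction rule: harm_span.induct)
  case (harm m l c)
  then show ?case using harm_span.harm[OF harm, of "a * c"] by (simp add: mult.assoc)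
next
  case (sum f g)
  then show ?case using harm_span.sum[OF sum.IH] by (simp add: distrib_left)
next
  case (on_sphere f g)
  show ?case by (rule harm_span.on_sphere[OF on_sphere.IH]) (simp add: on_sphere.hyps)
qed

lemma harm_const_nonzero: "harm_const l m \<noteq> 0"
  by (simp add: harm_const_def)

lemma harm_span_raw_harm:
  assumes "m \<le> l"
  shows "harm_span (raw_harm l m)"
proof (rule harm_span.on_sphere[OF harm_span.harm])
  show "int m \<in> {- int l..int l}" using assms by auto
  show "raw_harm l m x = inverse (of_real (harm_const l m)) * sph_harm l (int m) x" if "x \<in> S2" for x
    unfolding sph_harm_eq_raw_harm[OF that assms] using harm_const_nonzero[of l m] by simp
qed

text \<open>For fixed order \<open>m\<close> the polynomials \<open>rodrigues l (l + m)\<close> with \<open>l \<ge> m\<close> have every degree exactly once, so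
  the leading term of \<open>p\<close> can be removed by one of them.\<close>
lemma harm_span_monomial:
  "harm_span (\<lambda>x. planar x ^ m * of_real (poly p (x $ 3)))"
proof (induction "degree p" arbitrary: p rule: less_induct)
  case less
  show ?case
  proof (cases "p = 0")
    case True
    then show ?thesis using harm_span_zero by simp
  next
    case False
    \<comment> \<open>the degree \<open>l\<close> for which \<open>rodrigues l (l + m)\<close> has the degree of \<open>p\<close>\<close>
    define l where "l = m + degree p"
    define q where "q = rodrigues l (l + m)"
    have dq: "degree q = degree p" by (simp add: q_def degree_rodrigues l_def)
    have "q \<noteq> 0"
    proof
      assume "q = 0"
      have "(pderiv ^^ (l - m)) q = rodrigues l (2 * l)"
      proof -
        have "2 * l = (l - m) + (l + m)" by (simp add: l_def)
        then show ?thesis unfolding q_def rodrigues_def by (simp only: funpow_add o_def)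
      qed
      moreover have "(pderiv ^^ j) (0 :: real poly) = 0" for j by (induction j) auto
      ultimately show False using \<open>q = 0\<close> rodrigues_top[of l] by simp
    qed
    define a where "a = lead_coeff p / lead_coeff q"
    define r where "r = p - smult a q"
    have p: "p = smult a q + r" by (simp add: r_def)
    have "coeff r (degree p) = 0"
      using \<open>q \<noteq> 0\<close> by (simp add: r_def a_def dq[symmetric])
    moreover have "degree r \<le> degree p"
      unfolding r_def using dq by (intro degree_diff_le) (auto intro: order_trans[OF degree_smult_le])
    ultimately have "degree r < degree p \<or> r = 0"
      by (cases "degree r = degree p") (use leading_coeff_0_iff[of r] in auto)
    then have r: "harm_span (\<lambda>x. planar x ^ m * of_real (poly r (x $ 3)))"
      using less harm_span_zero by auto
    have "harm_span (\<lambda>x. of_real a * raw_harm l m x + planar x ^ m * of_real (poly r (x $ 3)))"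
      by (intro harm_span.sum harm_span_scale harm_span_raw_harm r) (simp add: l_def)
    moreover have "of_real a * raw_harm l m x + planar x ^ m * of_real (poly r (x $ 3)) = planar x ^ m * of_real (poly p (x $ 3))" for x
      unfolding raw_harm_def q_def[symmetric] by (subst p) (simp add: algebra_simps)
    ultimately show ?thesis by simp
  qed
qed

lemma harm_span_cnj: "harm_span f \<Longrightarrow> harm_span (\<lambda>x. cnj (f x))"
proof (induction rule: harm_span.induct)
  case (harm m l c)
  define k where "k = nat \<bar>m\<bar>"
  have k: "k \<le> l" using harm by (auto simp: k_def)
  have m: "- m \<in> {- int l..int l}" using harm by auto
  have Y: "cnj (c * sph_harm l m x) = cnj c * (-1) ^ k * sph_harm l (- m) x" if x: "x \<in> S2" for x
  proof (cases "m \<ge> 0")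
    case True
    then have "m = int k" by (simp add: k_def)
    then show ?thesis using sph_harm_neg[OF x k]
      by simp
  next
    case False
    then have "m = - int k" by (simp add: k_def)
    then show ?thesis using sph_harm_neg[OF x k] by (simp add: mult_ac)
  qed
  show ?case by (rule harm_span.on_sphere[OF harm_span.harm[OF m] Y])
next
  case (sum f g)
  then show ?case using harm_span.sum[OF sum.IH] by simp
next
  case (on_sphere f g)
  show ?case by (rule harm_span.on_sphere[OF on_sphere.IH]) (simp add: on_sphere.hyps)
qed

lemma planar_cnj: "x \<in> S2 \<Longrightarrow> planar x * cnj (planar x) = of_real (1 - (x $ 3)\<^sup>2)"
proof -
  assume x: "x \<in> S2"
  have "(norm (planar x))\<^sup>2 = 1 - (x $ 3)\<^sup>2"
    using norm_planar[OF x] S2_third[OF x] by (simp add: abs_square_le_1)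
  then show ?thesis by (simp only: complex_norm_square[symmetric])
qed

text \<open>Harmonics of negative order are conjugates of those of positive order, so multiplication by \<open>g\<close> on
  them is the conjugate of multiplication by \<open>cnj g\<close>.\<close>
lemma harm_span_mult_of_nonneg:
  assumes g: "\<And>l m. m \<le> l \<Longrightarrow> harm_span (\<lambda>x. g x * raw_harm l m x)"
    and g': "\<And>l m. m \<le> l \<Longrightarrow> harm_span (\<lambda>x. cnj (g x) * raw_harm l m x)"
    and f: "harm_span f"
  shows "harm_span (\<lambda>x. g x * f x)"
  using f
proof (induction rule: harm_span.induct)
  case (harm m l c)
  define k where "k = nat \<bar>m\<bar>"
  have k: "k \<le> l" using harm by (auto simp: k_def)
  show ?case
  proof (cases "m \<ge> 0")
    case True
    then have m: "m = int k" by (simp add: k_def)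
    show ?thesis
    proof (rule harm_span.on_sphere[OF harm_span_scale[OF g[OF k]]])
      show "g x * (c * sph_harm l m x) = (c * of_real (harm_const l k)) * (g x * raw_harm l k x)" if "x \<in> S2" for x
        unfolding m sph_harm_eq_raw_harm[OF that k] by (simp add: mult_ac)
    qed
  next
    case False
    then have m: "m = - int k" by (simp add: k_def)
    show ?thesis
    proof (rule harm_span.on_sphere[OF harm_span_scale[OF harm_span_cnj[OF g'[OF k]]]])
      show "g x * (c * sph_harm l m x) = (c * (-1) ^ k * of_real (harm_const l k)) * cnj (cnj (g x) * raw_harm l k x)"
        if "x \<in> S2" for x
        unfolding m sph_harm_neg[OF that k] sph_harm_eq_raw_harm[OF that k] by (simp add: mult_ac)
    qed
  qed
next
  case (sum f h)
  then show ?case using harm_span.sum[OF sum.IH] by (simp add: distrib_left)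
next
  case (on_sphere f h)
  show ?case by (rule harm_span.on_sphere[OF on_sphere.IH]) (simp add: on_sphere.hyps)
qed

lemma harm_span_mult_third:
  assumes "harm_span f"
  shows "harm_span (\<lambda>x. of_real (x $ 3) * f x)"
proof -
  have "harm_span (\<lambda>x. of_real (x $ 3) * raw_harm l m x)" for l m
    using harm_span_monomial[of m "[:0, 1:] * rodrigues l (l + m)"] by (simp add: raw_harm_def mult_ac)
  then show ?thesis
    using harm_span_mult_of_nonneg[OF _ _ assms, of "\<lambda>x. of_real (x $ 3)"] by simp
qed

lemma harm_span_planar_raw_harm: "harm_span (\<lambda>x. planar x * raw_harm l m x)"
  using harm_span_monomial[of "Suc m" "rodrigues l (l + m)"] by (simp add: raw_harm_def mult_ac)

lemma harm_span_cnj_planar_raw_harm: "harm_span (\<lambda>x. cnj (planar x) * raw_harm l m x)"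
proof (cases m)
  case 0
  show ?thesis
    using harm_span_cnj[OF harm_span_monomial[of 1 "rodrigues l l"]] by (simp add: raw_harm_def 0)
next
  case (Suc k)
  show ?thesis
  proof (rule harm_span.on_sphere[OF harm_span_monomial[of k "[:1, 0, -1:] * rodrigues l (l + m)"]])
    fix x :: "real^3" assume "x \<in> S2"
    have "cnj (planar x) * raw_harm l m x = (planar x * cnj (planar x)) * (planar x ^ k * of_real (poly (rodrigues l (l + m)) (x $ 3)))"
      unfolding raw_harm_def Suc by (simp add: mult_ac)
    also have "\<dots> = planar x ^ k * of_real (poly ([:1, 0, -1:] * rodrigues l (l + m)) (x $ 3))"
      unfolding planar_cnj[OF \<open>x \<in> S2\<close>] by (simp add: power2_eq_square algebra_simps)
    finally show "cnj (planar x) * raw_harm l m x = planar x ^ k * of_real (poly ([:1, 0, -1:] * rodrigues l (l + m)) (x $ 3))" .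
  qed
qed

text \<open>Every linear form is a combination of \<open>planar\<close>, its conjugate and the third coordinate, and the span
  is closed under multiplication by each of these.\<close>
lemma harm_span_mult_polynomial:
  assumes "real_polynomial_function q" "harm_span f"
  shows "harm_span (\<lambda>x. of_real (q x) * f x)"
  using assms
proof (induction arbitrary: f)
  case (linear q)
  let ?e = "\<lambda>i. q (axis i 1)"
  have q: "q x = x $ 1 * ?e 1 + x $ 2 * ?e 2 + x $ 3 * ?e 3" for x
  proof -
    have "x = (\<Sum>i\<in>UNIV. x $ i *\<^sub>R axis i 1)"
      by (simp add: vec_eq_iff axis_def if_distrib cong: if_cong)
    moreover have "q (\<Sum>i\<in>UNIV. x $ i *\<^sub>R axis i 1) = (\<Sum>i\<in>UNIV. x $ i * ?e i)"
      using bounded_linear.linear[OF linear(1)] by (simp add: linear_sum linear_scale)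
    ultimately have "q x = (\<Sum>i\<in>UNIV. x $ i * ?e i)" by (simp only:)
    then show ?thesis by (simp add: sum_3)
  qed
  have 1: "harm_span (\<lambda>x. planar x * f x)"
    using harm_span_mult_of_nonneg[OF harm_span_planar_raw_harm harm_span_cnj_planar_raw_harm linear(2)] .
  have 2: "harm_span (\<lambda>x. cnj (planar x) * f x)"
    by (rule harm_span_mult_of_nonneg[OF harm_span_cnj_planar_raw_harm _ linear(2)]) (simp add: harm_span_planar_raw_harm)
  have "harm_span (\<lambda>x. (of_real (?e 1) / 2 - \<i> * of_real (?e 2) / 2) * (planar x * f x)
      + ((of_real (?e 1) / 2 + \<i> * of_real (?e 2) / 2) * (cnj (planar x) * f x)
        + of_real (?e 3) * (of_real (x $ 3) * f x)))"
    by (intro harm_span.sum harm_span_scale 1 2 harm_span_mult_third linear)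
  moreover have "(of_real (?e 1) / 2 - \<i> * of_real (?e 2) / 2) * (planar x * f x)
      + ((of_real (?e 1) / 2 + \<i> * of_real (?e 2) / 2) * (cnj (planar x) * f x)
        + of_real (?e 3) * (of_real (x $ 3) * f x)) = of_real (q x) * f x" for x
    by (subst q) (simp add: planar_def complex_eq_iff field_simps)
  ultimately show ?case by simp
next
  case (const c)
  then show ?case by (intro harm_span_scale)
next
  case (add p q)
  have "harm_span (\<lambda>x. of_real (p x) * f x + of_real (q x) * f x)"
    by (intro harm_span.sum add)
  then show ?case by (simp add: distrib_right)
next
  case (mult p q)
  have "harm_span (\<lambda>x. of_real (p x) * (of_real (q x) * f x))"
    by (intro mult)
  then show ?case by (simp add: mult.assoc)
qed

lemma harm_span_dense:
  fixes f :: "real^3 \<Rightarrow> real"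
  assumes "continuous_on S2 f" "0 < e"
  obtains g where "harm_span (\<lambda>x. of_real (g x))" "\<And>x. x \<in> S2 \<Longrightarrow> \<bar>f x - g x\<bar> < e"
proof -
  obtain g where g: "real_polynomial_function g" "\<And>x. x \<in> S2 \<Longrightarrow> \<bar>f x - g x\<bar> < e"
    using Stone_Weierstrass_real_polynomial_function[OF compact_sphere assms] by blast
  have "harm_span (\<lambda>x. 1)"
    using harm_span_monomial[of 0 1] by simp
  then have "harm_span (\<lambda>x. of_real (g x))"
    using harm_span_mult_polynomial[OF g(1), of "\<lambda>x. 1"] by simp
  then show ?thesis using g that by blast
qed

section \<open>The surface measure and orthonormality\<close>

definition sph_rect :: "(real \<times> real) set" where
  "sph_rect = {0..pi} \<times> {0..<2*pi}"

lemma surf_eq: "surf = distr (density (restrict_space lborel sph_rect) (\<lambda>p. ennreal (sin (fst p))))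
     S2_borel (\<lambda>p. sph (fst p) (snd p))"
  unfolding surf_def sph_rect_def by (simp add: case_prod_beta')

lemma sets_sph_rect [measurable]: "sph_rect \<in> sets borel"
proof -
  have "sph_rect \<in> sets (borel \<Otimes>\<^sub>M borel)"
    unfolding sph_rect_def by (intro pair_measureI) auto
  then show ?thesis by (simp only: borel_prod)
qed

lemma sets_surf [simp, measurable_cong]: "sets surf = sets S2_borel"
  by (simp add: surf_def)

lemma space_surf [simp]: "space surf = S2"
  by (simp add: surf_def space_restrict_space)

lemma continuous_on_sph: "continuous_on A (\<lambda>p. sph (fst p) (snd p))"
proof -
  have "(\<lambda>p. sph (fst p) (snd p)) = (\<lambda>p. (sin (fst p) * cos (snd p)) *\<^sub>R axis 1 1
     + (sin (fst p) * sin (snd p)) *\<^sub>R axis 2 1 + cos (fst p) *\<^sub>R axis 3 1)"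
    by (simp add: fun_eq_iff vec3_eq_iff axis_def)
  then show ?thesis by (simp only:) (intro continuous_intros)
qed

lemma sph_borel [measurable]: "(\<lambda>p. sph (fst p) (snd p)) \<in> borel \<rightarrow>\<^sub>M S2_borel"
  by (rule measurable_restrict_space2) (use sph_in_S2 continuous_on_sph in \<open>auto intro!: borel_measurable_continuous_onI\<close>)

lemma sph_measurable_rect:
  "(\<lambda>p. sph (fst p) (snd p)) \<in> density (restrict_space lborel sph_rect) (\<lambda>p. ennreal (sin (fst p))) \<rightarrow>\<^sub>M S2_borel"
  unfolding measurable_density_eq1
  by (rule measurable_restrict_space1) (simp add: sph_borel)

lemma sin_nonneg_rect: "AE p in restrict_space lborel sph_rect. 0 \<le> sin (fst p)"
  by (subst AE_restrict_space_iff, simp add: sets_sph_rect) (auto simp: sph_rect_def sin_ge_zero)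

lemma sin_fst_measurable [measurable]: "(\<lambda>p. sin (fst p)) \<in> borel_measurable (borel :: (real \<times> real) measure)"
  by (intro borel_measurable_continuous_onI continuous_intros)

lemma sin_measurable_rect [measurable]: "(\<lambda>p. sin (fst p)) \<in> borel_measurable (restrict_space lborel sph_rect)"
  by (rule measurable_restrict_space1) simp

lemma finite_measure_surf: "finite_measure surf"
proof
  have "bounded sph_rect"
    unfolding sph_rect_def by (intro bounded_Times) auto
  let ?N = "density (restrict_space lborel sph_rect) (\<lambda>p. ennreal (sin (fst p)))"
  have "emeasure surf (space surf) = emeasure ?N ((\<lambda>p. sph (fst p) (snd p)) -` space S2_borel \<inter> space ?N)"
    unfolding surf_eq space_distr by (rule emeasure_distr[OF sph_measurable_rect sets.top])
  also have "(\<lambda>p. sph (fst p) (snd p)) -` space S2_borel \<inter> space ?N = space ?N"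
    using measurable_space[OF sph_measurable_rect] by blast
  also have "emeasure ?N (space ?N) = (\<integral>\<^sup>+p. ennreal (sin (fst p)) \<partial>restrict_space lborel sph_rect)"
    unfolding space_density
    by (subst emeasure_density[OF _ sets.top]) (auto simp: measurable_ennreal intro!: nn_integral_cong)
  also have "\<dots> \<le> (\<integral>\<^sup>+p. 1 \<partial>restrict_space lborel sph_rect)"
    by (intro nn_integral_mono) (simp add: ennreal_le_1)
  also have "\<dots> = emeasure lborel sph_rect"
    by (simp add: nn_integral_const emeasure_restrict_space space_restrict_space)
  also have "\<dots> < \<infinity>" using \<open>bounded sph_rect\<close> by (rule emeasure_bounded_finite)
  finally show "emeasure surf (space surf) \<noteq> \<infinity>" by simp
qed

interpretation surf: finite_measure surf by (rule finite_measure_surf)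

lemma integrable_surf_iff:
  fixes f :: "real^3 \<Rightarrow> 'b::{banach, second_countable_topology}"
  assumes [measurable]: "f \<in> borel_measurable S2_borel"
  shows "integrable surf f \<longleftrightarrow>
    integrable lborel (\<lambda>p. indicator sph_rect p *\<^sub>R (sin (fst p) *\<^sub>R f (sph (fst p) (snd p))))"
proof -
  have m: "(\<lambda>p. f (sph (fst p) (snd p))) \<in> borel_measurable (restrict_space lborel sph_rect)"
    by (rule measurable_restrict_space1) simp
  show ?thesis
    unfolding surf_eq
    by (simp add: integrable_distr_eq[OF sph_measurable_rect] integrable_density[OF m sin_measurable_rect sin_nonneg_rect]
        integrable_restrict_space)
qed

lemma integral_surf:
  fixes f :: "real^3 \<Rightarrow> 'b::{banach, second_countable_topology}"
  assumes [measurable]: "f \<in> borel_measurable S2_borel"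
  shows "integral\<^sup>L surf f =
    integral\<^sup>L lborel (\<lambda>p. indicator sph_rect p *\<^sub>R (sin (fst p) *\<^sub>R f (sph (fst p) (snd p))))"
proof -
  have m: "(\<lambda>p. f (sph (fst p) (snd p))) \<in> borel_measurable (restrict_space lborel sph_rect)"
    by (rule measurable_restrict_space1) simp
  show ?thesis
    unfolding surf_eq
    by (simp add: integral_distr[OF sph_measurable_rect] integral_density[OF m sin_measurable_rect sin_nonneg_rect]
        integral_restrict_space)
qed

lemma AE_surf_latitude: "AE y in surf. y $ 3 \<noteq> c"
proof -
  have "emeasure (lborel \<Otimes>\<^sub>M lborel) ({arccos c} \<times> (UNIV :: real set)) = 0"
    by (subst lborel.emeasure_pair_measure_Times) auto
  then have "emeasure lborel ({arccos c} \<times> (UNIV :: real set)) = 0"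
    by (simp add: lborel_prod)
  then have "AE p in lborel. p \<notin> {arccos c} \<times> (UNIV :: real set)"
    by (intro AE_not_in null_setsI) (auto simp: borel_prod[symmetric])
  then have "AE p in restrict_space lborel sph_rect. cos (fst p) \<noteq> c"
    by (subst AE_restrict_space_iff, simp add: sets_sph_rect, elim eventually_mono)
       (auto simp: sph_rect_def arccos_cos)
  then have "AE p in density (restrict_space lborel sph_rect) (\<lambda>p. ennreal (sin (fst p))). sph (fst p) (snd p) $ 3 \<noteq> c"
    by (subst AE_density) (auto elim!: eventually_mono)
  then show ?thesis
    unfolding surf_eq by (subst AE_distr_iff[OF sph_measurable_rect])
      (auto simp: borel_measurable_nth sets_restrict_space_iff intro!: measurable_restrict_space1)
qed

lemma continuous_S2_measurable:
  "continuous_on S2 f \<Longrightarrow> f \<in> borel_measurable S2_borel"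
  by (rule borel_measurable_continuous_on_restrict)

lemma continuous_S2_integrable:
  fixes f :: "real^3 \<Rightarrow> 'b::{banach, second_countable_topology}"
  assumes "continuous_on S2 f"
  shows "integrable surf f"
proof -
  have "bounded (f ` S2)"
    using compact_continuous_image[OF assms compact_sphere] by (rule compact_imp_bounded)
  then obtain B where "\<And>x. x \<in> S2 \<Longrightarrow> norm (f x) \<le> B" unfolding bounded_iff by blast
  then show ?thesis
    by (intro surf.integrable_const_bound[of _ B]) (use continuous_S2_measurable[OF assms] in \<open>auto cong: measurable_cong_sets\<close>)
qed

lemma integral_surf_separated:
  fixes f :: "real^3 \<Rightarrow> complex"
  assumes f: "continuous_on S2 f"
    and sep: "\<And>\<theta> \<phi>. f (sph \<theta> \<phi>) = of_real (u \<theta>) * v \<phi>"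
  shows "integral\<^sup>L surf f = of_real (LINT \<theta>:{0..pi}|lborel. sin \<theta> * u \<theta>) * (LINT \<phi>:{0..<2*pi}|lborel. v \<phi>)"
proof -
  let ?g = "\<lambda>p. indicator sph_rect p *\<^sub>R (sin (fst p) *\<^sub>R f (sph (fst p) (snd p)))"
  have int: "integrable (lborel \<Otimes>\<^sub>M lborel) ?g"
    using continuous_S2_integrable[OF f] integrable_surf_iff[OF continuous_S2_measurable[OF f]]
    by (simp add: lborel_prod)
  have "integral\<^sup>L surf f = integral\<^sup>L (lborel \<Otimes>\<^sub>M lborel) ?g"
    by (simp add: integral_surf[OF continuous_S2_measurable[OF f]] lborel_prod)
  also have "\<dots> = (\<integral>\<theta>. \<integral>\<phi>. ?g (\<theta>, \<phi>) \<partial>lborel \<partial>lborel)"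
    by (rule lborel_pair.integral_fst'[OF int, symmetric])
  also have "\<dots> = (\<integral>\<theta>. \<integral>\<phi>. of_real (indicator {0..pi} \<theta> *\<^sub>R (sin \<theta> * u \<theta>)) * (indicator {0..<2*pi} \<phi> *\<^sub>R v \<phi>) \<partial>lborel \<partial>lborel)"
    by (intro Bochner_Integration.integral_cong refl)
       (auto simp: sph_rect_def sep indicator_def scaleR_conv_of_real)
  also have "\<dots> = of_real (LINT \<theta>:{0..pi}|lborel. sin \<theta> * u \<theta>) * (LINT \<phi>:{0..<2*pi}|lborel. v \<phi>)"
    unfolding set_lebesgue_integral_def
    by (simp only: integral_mult_right_zero integral_mult_left_zero integral_complex_of_real)
  finally show ?thesis .
qed

lemma integral_circle_character:
  "(LINT \<phi>:{0..<2*pi}|lborel. exp (\<i> * of_int n * complex_of_real \<phi>)) = (if n = 0 then of_real (2 * pi) else 0)"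
proof -
  let ?e = "\<lambda>\<phi>. exp (\<i> * of_int n * complex_of_real \<phi>)"
  have "(LINT \<phi>:{0..<2*pi}|lborel. ?e \<phi>) = (LINT \<phi>:{0..2*pi}|lborel. ?e \<phi>)"
  proof -
    have "AE \<phi> in lborel. \<phi> \<noteq> 2 * pi" by (rule AE_lborel_singleton)
    then show ?thesis
      unfolding set_lebesgue_integral_def
      by (intro integral_cong_AE) (auto simp: indicator_def elim!: eventually_mono)
  qed
  also have "\<dots> = integral {0..2*pi} ?e"
    by (rule set_borel_integral_eq_integral)
       (auto simp: set_integrable_def intro!: borel_integrable_compact continuous_intros)
  also have "\<dots> = (if n = 0 then of_real (2 * pi) else 0)"
  proof (cases "n = 0")
    case True
    then show ?thesis by (simp add: scaleR_conv_of_real)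
  next
    case False
    have "(?e has_integral (exp (\<i> * of_int n * of_real (2 * pi)) / (\<i> * of_int n) - exp (\<i> * of_int n * of_real 0) / (\<i> * of_int n))) {0..2*pi}"
    proof (rule fundamental_theorem_of_calculus)
      fix x :: real
      have "((\<lambda>z. exp (\<i> * of_int n * z) / (\<i> * of_int n)) has_field_derivative exp (\<i> * of_int n * of_real x)) (at (of_real x))"
        by (rule derivative_eq_intros refl | simp add: False)+
      from has_vector_derivative_real_field[OF this]
      show "((\<lambda>\<phi>. exp (\<i> * of_int n * of_real \<phi>) / (\<i> * of_int n)) has_vector_derivative ?e x) (at x within {0..2*pi})"
        by (rule has_vector_derivative_at_within)
    qed simp
    moreover have "exp (\<i> * of_int n * of_real (2 * pi)) = 1"
      using exp_integer_2pi[of "of_int n"] by (simp add: mult_ac)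
    ultimately show ?thesis using False by (simp add: integral_unique)
  qed
  finally show ?thesis .
qed

lemma integral_latitude:
  fixes g :: "real \<Rightarrow> real"
  assumes "continuous_on {-1..1} g"
  shows "(LINT \<theta>:{0..pi}|lborel. sin \<theta> * g (cos \<theta>)) = integral {-1..1} g"
proof -
  have "((\<lambda>\<theta>. sin \<theta> *\<^sub>R g (- (- cos \<theta>))) has_integral (integral {- cos 0..- cos pi} (\<lambda>z. g (- z)))) {0..pi}"
  proof (rule has_integral_substitution[where c = "-1" and d = 1])
    show "continuous_on {-1..1} (\<lambda>z. g (- z))"
      by (rule continuous_on_compose2[OF assms]) (auto intro!: continuous_intros)
    show "((\<lambda>\<theta>. - cos \<theta>) has_real_derivative sin x) (at x within {0..pi})" for x
      by (rule derivative_eq_intros refl | simp)+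
  qed auto
  then have "((\<lambda>\<theta>. sin \<theta> * g (cos \<theta>)) has_integral (integral {-1..1} g)) {0..pi}"
    using Henstock_Kurzweil_Integration.integral_reflect_real[of 1 "-1" g]
    by (simp only: minus_minus cos_zero cos_pi real_scaleR_def)
  moreover have "set_integrable lborel {0..pi} (\<lambda>\<theta>. sin \<theta> * g (cos \<theta>))"
    unfolding set_integrable_def
    by (intro borel_integrable_compact continuous_intros continuous_on_compose2[OF assms]) auto
  ultimately show ?thesis
    using set_borel_integral_eq_integral(2) integral_unique by metis
qed

lemma polar_inner:
  assumes "k \<le> l" "k \<le> l'"
  shows "(LINT \<theta>:{0..pi}|lborel. sin \<theta> * (polar l k \<theta> * polar l' k \<theta>)) = (if l = l' then 1 / (2 * pi) else 0)"
proof -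
  let ?g = "\<lambda>z. (1 - z\<^sup>2) ^ k * poly (rodrigues l (l + k)) z * poly (rodrigues l' (l' + k)) z"
  have eq: "sin \<theta> * (polar l k \<theta> * polar l' k \<theta>) = harm_const l k * harm_const l' k * (sin \<theta> * ?g (cos \<theta>))" for \<theta>
  proof -
    have "1 - (cos \<theta>)\<^sup>2 = sin \<theta> * sin \<theta>" using sin_cos_squared_add[of \<theta>] by (simp add: power2_eq_square algebra_simps)
    then show ?thesis unfolding polar_def by (simp add: power_mult_distrib)
  qed
  have "(LINT \<theta>:{0..pi}|lborel. sin \<theta> * (polar l k \<theta> * polar l' k \<theta>)) = harm_const l k * harm_const l' k * integral {-1..1} ?g"
    unfolding eq by (subst set_integral_mult_right, subst integral_latitude) (auto intro!: continuous_intros)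
  also have "integral {-1..1} ?g = rodrigues_inner k l l'" by (simp add: rodrigues_inner_def)
  also have "harm_const l k * harm_const l' k * rodrigues_inner k l l' = (if l = l' then 1 / (2 * pi) else 0)"
  proof (cases "l = l'")
    case True
    have "harm_const l k * harm_const l k * rodrigues_inner k l l = (harm_const l k)\<^sup>2 * rodrigues_inner k l l" by (simp add: power2_eq_square)
    also have "\<dots> = 1 / (2 * pi)"
      unfolding harm_const_square[OF assms(1)] rodrigues_inner_norm[OF assms(1)]
    proof -
      have "X / (4 * pi * C) * (p / q) * (q / p * (2 * C / X)) = 1 / (2 * pi)"
        if "X > 0" "C > 0" "p > 0" "q > 0" for X C p q :: real
        using that by (simp add: field_simps)
      then show "(2 * real l + 1) / (4 * pi * (2 ^ l * fact l)\<^sup>2) * (fact (l - k) / fact (l + k)) *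
        (fact (l + k) / fact (l - k) * (2 * (2 ^ l * fact l)\<^sup>2 / (2 * real l + 1))) = 1 / (2 * pi)"
        by simp
    qed
    finally show ?thesis using True by simp
  qed (use rodrigues_inner_orthogonal[OF assms] in simp)
  finally show ?thesis .
qed

text \<open>Different orders are separated by the integral over the longitude; for equal orders the integral over
  the colatitude is \<open>rodrigues_inner\<close>.\<close>
lemma sph_harm_orthonormal:
  assumes m: "m \<in> {- int l..int l}" and m': "m' \<in> {- int l'..int l'}"
  shows "(\<integral>y. sph_harm l m y * cnj (sph_harm l' m' y) \<partial>surf) = (if l = l' \<and> m = m' then 1 else 0)"
proof -
  obtain k s where k: "k \<le> l" "\<bar>m\<bar> = int k" "s \<in> {-1, 1}"
    and Y: "\<And>\<theta> \<phi>. sph_harm l m (sph \<theta> \<phi>) = of_real (s * polar l k \<theta>) * exp (\<i> * of_int m * of_real \<phi>)"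
    using sph_harm_sph[OF m] by metis
  obtain k' s' where k': "k' \<le> l'" "\<bar>m'\<bar> = int k'" "s' \<in> {-1, 1}"
    and Y': "\<And>\<theta> \<phi>. sph_harm l' m' (sph \<theta> \<phi>) = of_real (s' * polar l' k' \<theta>) * exp (\<i> * of_int m' * of_real \<phi>)"
    and same: "l = l' \<and> m = m' \<Longrightarrow> s' = s"
  proof (cases "l = l' \<and> m = m'")
    case True
    then show thesis using that[of k s] k Y by blast
  next
    case False
    then show thesis using sph_harm_sph[OF m'] that by metis
  qed
  have "continuous_on S2 (\<lambda>y. sph_harm l m y * cnj (sph_harm l' m' y))"
    by (intro continuous_intros continuous_on_sph_harm assms)
  moreover have "sph_harm l m (sph \<theta> \<phi>) * cnj (sph_harm l' m' (sph \<theta> \<phi>))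
      = of_real (s * s' * (polar l k \<theta> * polar l' k' \<theta>)) * exp (\<i> * of_int (m - m') * of_real \<phi>)" for \<theta> \<phi>
  proof -
    have "exp (\<i> * of_int m * complex_of_real \<phi>) * cnj (exp (\<i> * of_int m' * of_real \<phi>))
      = exp (\<i> * of_int (m - m') * of_real \<phi>)"
      unfolding exp_cnj mult_exp_exp by (simp add: algebra_simps)
    then show ?thesis unfolding Y Y' by (simp add: mult_ac)
  qed
  ultimately have I: "(\<integral>y. sph_harm l m y * cnj (sph_harm l' m' y) \<partial>surf)
      = of_real (LINT \<theta>:{0..pi}|lborel. sin \<theta> * (s * s' * (polar l k \<theta> * polar l' k' \<theta>)))
        * (LINT \<phi>:{0..<2*pi}|lborel. exp (\<i> * of_int (m - m') * of_real \<phi>))"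
    by (rule integral_surf_separated)
  show ?thesis
  proof (cases "m = m'")
    case True
    then have "k' = k" using k k' by simp
    have "(LINT \<theta>:{0..pi}|lborel. sin \<theta> * (s * s' * (polar l k \<theta> * polar l' k' \<theta>)))
      = s * s' * (LINT \<theta>:{0..pi}|lborel. sin \<theta> * (polar l k \<theta> * polar l' k \<theta>))"
      unfolding \<open>k' = k\<close> set_integral_mult_right[symmetric] by (simp add: mult_ac)
    also have "\<dots> = s * s' * (if l = l' then 1 / (2 * pi) else 0)"
      using polar_inner k k' \<open>k' = k\<close> by simp
    finally show ?thesis
      unfolding I integral_circle_character using True same k(3) by auto
  next
    case False
    then show ?thesis unfolding I integral_circle_character by simp
  qed
qed

section \<open>Subordinators with unbounded Laplace exponent\<close>

context infinite_levy_measure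
begin

lemma space_nu: "space \<nu> = {0<..}"
  using sets_eq_imp_space_eq[OF sets_eq] by (simp add: space_restrict_space)

lemma borel_nu: "f \<in> borel_measurable borel \<Longrightarrow> f \<in> borel_measurable \<nu>"
  for f :: "real \<Rightarrow> 'b::topological_space"
  unfolding measurable_cong_sets[OF sets_eq refl] by (rule measurable_restrict_space1)

lemma integrable_laplace_integrand: "integrable \<nu> (\<lambda>t. 1 - exp (- real n * t))"
proof (rule Bochner_Integration.integrable_bound)
  have "integrable \<nu> (\<lambda>t. min 1 t)"
    using integrability by (intro integrableI_nonneg borel_nu) (auto simp: space_nu)
  then show "integrable \<nu> (\<lambda>t. (real n + 1) * min 1 t)" by simp
  show "(\<lambda>t. 1 - exp (- real n * t)) \<in> borel_measurable \<nu>" by (rule borel_nu) measurable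
  show "AE t in \<nu>. norm (1 - exp (- real n * t)) \<le> norm ((real n + 1) * min 1 t)"
  proof (rule AE_I2)
    fix t assume "t \<in> space \<nu>"
    then have t: "t > 0" by (simp add: space_nu)
    then have nn: "0 \<le> 1 - exp (- real n * t)" by simp
    have "1 - exp (- real n * t) \<le> 1" by simp
    moreover have "1 - exp (- real n * t) \<le> real n * t"
      using exp_ge_add_one_self[of "- real n * t"] by simp
    moreover have "1 \<le> (real n + 1) * 1" "real n * t \<le> (real n + 1) * t" using t by (auto simp: algebra_simps)
    ultimately have "1 - exp (- real n * t) \<le> (real n + 1) * 1" "1 - exp (- real n * t) \<le> (real n + 1) * t"
      by linarith+
    then have "1 - exp (- real n * t) \<le> (real n + 1) * min 1 t"
      unfolding min_def by (simp split: if_splits)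
    moreover have "0 \<le> (real n + 1) * min 1 t" using t by simp
    ultimately show "norm (1 - exp (- real n * t)) \<le> norm ((real n + 1) * min 1 t)"
      using nn by (simp only: real_norm_def abs_of_nonneg)
  qed
qed

text \<open>By monotone convergence the exponent tends to the total mass of the Levy measure.\<close>
lemma laplace_exponent_unbounded: "\<exists>n. laplace_exponent \<nu> (real n) \<ge> B"
proof -
  have lim: "(\<lambda>n. \<integral>\<^sup>+t. ennreal (1 - exp (- real n * t)) \<partial>\<nu>) \<longlonglongrightarrow> (\<integral>\<^sup>+t. indicator {0<..} t \<partial>\<nu>)"
  proof (rule nn_integral_LIMSEQ)
    show "incseq (\<lambda>n t. ennreal (1 - exp (- real n * t)))"
    proof (rule incseq_SucI, rule le_funI)
      fix n t
      show "ennreal (1 - exp (- real n * t)) \<le> ennreal (1 - exp (- real (Suc n) * t))"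
      proof (cases "t \<ge> 0")
        case True
        then show ?thesis by (intro ennreal_leI) (simp add: algebra_simps)
      next
        case False
        then have "1 - exp (- real n * t) \<le> 0" by (simp add: mult_nonneg_nonpos)
        then show ?thesis by (simp add: ennreal_neg)
      qed
    qed
    show "(\<lambda>t. ennreal (1 - exp (- real n * t))) \<in> borel_measurable \<nu>" for n
      by (rule borel_nu) measurable
    show "(\<lambda>n. ennreal (1 - exp (- real n * t))) \<longlonglongrightarrow> indicator {0<..} t" for t
    proof (cases "t > 0")
      case True
      have "(\<lambda>n. exp (- t) ^ n) \<longlonglongrightarrow> 0" by (rule LIMSEQ_realpow_zero) (use True in auto)
      then have "(\<lambda>n. exp (- real n * t)) \<longlonglongrightarrow> 0" by (simp add: exp_of_nat_mult[symmetric])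
      from tendsto_diff[OF tendsto_const[of 1] this]
      have "(\<lambda>n. ennreal (1 - exp (- real n * t))) \<longlonglongrightarrow> ennreal (1 - 0)" by (rule tendsto_ennrealI)
      then show ?thesis using True by simp
    next
      case False
      then have "ennreal (1 - exp (- real n * t)) = 0" for n
        by (intro ennreal_neg) (simp add: mult_nonneg_nonpos)
      then show ?thesis using False by simp
    qed
  qed
  have "(\<integral>\<^sup>+t. indicator {0<..} t \<partial>\<nu>) = \<infinity>"
  proof -
    have "{0<..} \<in> sets \<nu>" using sets.top[of \<nu>] by (simp add: space_nu)
    then show ?thesis using infinite_mass by simp
  qed
  with lim have lim: "(\<lambda>n. \<integral>\<^sup>+t. ennreal (1 - exp (- real n * t)) \<partial>\<nu>) \<longlonglongrightarrow> \<infinity>" by simp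
  have "eventually (\<lambda>n. (\<integral>\<^sup>+t. ennreal (1 - exp (- real n * t)) \<partial>\<nu>) > ennreal B) sequentially"
    by (rule order_tendstoD[OF lim]) simp
  then obtain n where n: "(\<integral>\<^sup>+t. ennreal (1 - exp (- real n * t)) \<partial>\<nu>) > ennreal B"
    by (auto simp: eventually_sequentially)
  have "(\<integral>\<^sup>+t. ennreal (1 - exp (- real n * t)) \<partial>\<nu>) = ennreal (laplace_exponent \<nu> (real n))"
    unfolding laplace_exponent_def
    by (rule nn_integral_eq_integral[OF integrable_laplace_integrand]) (auto simp: space_nu)
  with n have "ennreal B < ennreal (laplace_exponent \<nu> (real n))" by simp
  then have "B \<le> laplace_exponent \<nu> (real n)"
    by (meson ennreal_leI not_le order_less_imp_le)
  then show ?thesis ..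
qed

end

locale unbounded_subordinator = subordinator +
  assumes unbounded: "\<exists>n. \<Phi> (real n) \<ge> B"
begin

lemma increasing': "\<omega> \<in> space M \<Longrightarrow> 0 \<le> s \<Longrightarrow> s \<le> t \<Longrightarrow> S s \<omega> \<le> S t \<omega>"
  using increasing[of \<omega>] by (auto simp: mono_on_def)

lemma nonneg: "\<omega> \<in> space M \<Longrightarrow> 0 \<le> t \<Longrightarrow> 0 \<le> S t \<omega>"
  using increasing'[of \<omega> 0 t] zero[of \<omega>] by simp

lemma S_events:
  assumes "0 \<le> s"
  shows "{\<omega> \<in> space M. S s \<omega> > c} \<in> events" "{\<omega> \<in> space M. S s \<omega> \<le> c} \<in> events"
  using rv[OF assms] by measurable

lemma integrable_exp_S:
  assumes "0 \<le> s" "0 \<le> r"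
  shows "integrable M (\<lambda>\<omega>. exp (- r * S s \<omega>))"
proof (rule integrable_const_bound[of _ 1])
  show "(\<lambda>\<omega>. exp (- r * S s \<omega>)) \<in> borel_measurable M" using rv[OF assms(1)] by measurable
  show "AE \<omega> in M. norm (exp (- r * S s \<omega>)) \<le> 1"
    using nonneg assms by (auto intro!: AE_I2)
qed

lemma prob_S_gt:
  assumes "0 \<le> s" "c > 0"
  shows "prob {\<omega> \<in> space M. S s \<omega> > c} \<le> s * (\<Phi> 1 / (1 - exp (- c)))"
proof -
  have pos: "1 - exp (- c) > 0" using assms by simp
  have int: "integrable M (\<lambda>\<omega>. (1 - exp (- 1 * S s \<omega>)) / (1 - exp (- c)))"
    using integrable_exp_S[OF assms(1), of 1] by simp
  have "prob {\<omega> \<in> space M. S s \<omega> > c} = expectation (indicator {\<omega> \<in> space M. S s \<omega> > c})"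
    using S_events[OF assms(1)] by simp
  also have "\<dots> \<le> expectation (\<lambda>\<omega>. (1 - exp (- 1 * S s \<omega>)) / (1 - exp (- c)))"
  proof (rule integral_mono[OF _ int])
    show "integrable M (indicator {\<omega> \<in> space M. S s \<omega> > c} :: _ \<Rightarrow> real)"
      by (intro integrable_real_indicator S_events assms) (simp add: emeasure_eq_measure)
    fix \<omega> assume w: "\<omega> \<in> space M"
    show "indicator {\<omega> \<in> space M. S s \<omega> > c} \<omega> \<le> (1 - exp (- 1 * S s \<omega>)) / (1 - exp (- c))"
      using pos nonneg[OF w assms(1)] by (auto simp: indicator_def le_divide_eq)
  qed
  also have "\<dots> = (1 - exp (- s * \<Phi> 1)) / (1 - exp (- c))"
    using laplace[OF assms(1), of 1] integrable_exp_S[OF assms(1), of 1] by (simp add: prob_space)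
  also have "\<dots> \<le> (s * \<Phi> 1) / (1 - exp (- c))"
    using pos exp_ge_add_one_self[of "- s * \<Phi> 1"] by (intro divide_right_mono) auto
  finally show ?thesis by simp
qed

lemma prob_S_le:
  assumes "0 \<le> s" "0 \<le> r"
  shows "prob {\<omega> \<in> space M. S s \<omega> \<le> c} \<le> exp (r * c) * exp (- s * \<Phi> r)"
proof -
  have "prob {\<omega> \<in> space M. S s \<omega> \<le> c} = expectation (indicator {\<omega> \<in> space M. S s \<omega> \<le> c})"
    using S_events[OF assms(1)] by simp
  also have "\<dots> \<le> expectation (\<lambda>\<omega>. exp (r * c) * exp (- r * S s \<omega>))"
  proof (rule integral_mono)
    show "integrable M (indicator {\<omega> \<in> space M. S s \<omega> \<le> c} :: _ \<Rightarrow> real)"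
      by (intro integrable_real_indicator S_events assms) (simp add: emeasure_eq_measure)
    show "integrable M (\<lambda>\<omega>. exp (r * c) * exp (- r * S s \<omega>))"
      using integrable_exp_S[OF assms] by simp
    fix \<omega> assume w: "\<omega> \<in> space M"
    show "indicator {\<omega> \<in> space M. S s \<omega> \<le> c} \<omega> \<le> exp (r * c) * exp (- r * S s \<omega>)"
      using assms(2) by (auto simp: indicator_def mult_exp_exp mult_left_mono)
  qed
  also have "\<dots> = exp (r * c) * exp (- s * \<Phi> r)"
    using laplace[OF assms] by simp
  finally show ?thesis .
qed

text \<open>An exponent that is positive somewhere makes the Laplace transform of \<open>S n\<close> decay geometrically in \<open>n\<close>.\<close>
lemma AE_exceeds: "AE \<omega> in M. \<exists>n. S (real n) \<omega> > c"
proof -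
  obtain r where r: "\<Phi> (real r) \<ge> 1" using unbounded by blast
  let ?N = "{\<omega> \<in> space M. \<forall>n. S (real n) \<omega> \<le> c}"
  have N: "?N \<in> events" using rv by measurable
  have "prob ?N \<le> exp (real r * c) * exp (- 1) ^ n" for n
  proof -
    have "prob ?N \<le> prob {\<omega> \<in> space M. S (real n) \<omega> \<le> c}"
      by (rule finite_measure_mono) (use S_events in auto)
    also have "\<dots> \<le> exp (real r * c) * exp (- real n * \<Phi> (real r))" by (rule prob_S_le) auto
    also have "\<dots> \<le> exp (real r * c) * exp (- real n)"
      using r mult_left_mono[OF r, of "real n"] by simp
    finally show ?thesis by (simp add: exp_of_nat_mult[symmetric])
  qed
  then have bd: "\<exists>N. \<forall>n\<ge>N. prob ?N \<le> exp (real r * c) * exp (- 1) ^ n" by blast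
  have "(\<lambda>n. exp (real r * c) * exp (- 1) ^ n) \<longlonglongrightarrow> exp (real r * c) * 0"
    by (intro tendsto_mult tendsto_const LIMSEQ_realpow_zero) auto
  from LIMSEQ_le_const[OF this bd] have "prob ?N \<le> exp (real r * c) * 0" .
  then have "prob ?N = 0" by (simp add: measure_le_0_iff)
  then have "AE \<omega> in M. \<omega> \<notin> ?N" using N by (intro AE_not_in) (simp add: null_sets_def emeasure_eq_measure)
  then show ?thesis by (rule AE_mp) (auto intro!: AE_I2 simp: not_le)
qed

text \<open>The probability of \<open>S s \<le> 0\<close> is at most \<open>exp (- s * \<Phi> r)\<close> for all \<open>r\<close>, and the exponent is unbounded.\<close>
lemma AE_S_pos: "AE \<omega> in M. \<forall>s>0. S s \<omega> > 0"
proof -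
  have "AE \<omega> in M. S (inverse (real (Suc k))) \<omega> > 0" for k
  proof -
    let ?s = "inverse (real (Suc k))"
    let ?N = "{\<omega> \<in> space M. S ?s \<omega> \<le> 0}"
    have N: "?N \<in> events" by (rule S_events) simp
    have "prob ?N \<le> exp (- 1) ^ n" for n
    proof -
      obtain r where r: "\<Phi> (real r) \<ge> real n * real (Suc k)" using unbounded by blast
      have "prob ?N \<le> exp (real r * 0) * exp (- ?s * \<Phi> (real r))" by (rule prob_S_le) auto
      also have "\<dots> \<le> exp (- real n)"
      proof -
        have eq: "?s * (real n * real (Suc k)) = real n" by simp
        have "real n \<le> ?s * \<Phi> (real r)" using mult_left_mono[OF r, of ?s] unfolding eq by (simp del: of_nat_Suc)
        then show ?thesis by simp
      qed
      finally show ?thesis by (simp add: exp_of_nat_mult[symmetric])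
    qed
    then have bd: "\<exists>N. \<forall>n\<ge>N. prob ?N \<le> exp (- 1) ^ n" by blast
    have "(\<lambda>n. exp (- 1 :: real) ^ n) \<longlonglongrightarrow> 0" by (intro LIMSEQ_realpow_zero) auto
    from LIMSEQ_le_const[OF this bd] have "prob ?N \<le> 0" .
    then have "prob ?N = 0" by (simp add: measure_le_0_iff)
    then have "AE \<omega> in M. \<omega> \<notin> ?N" using N by (intro AE_not_in) (simp add: null_sets_def emeasure_eq_measure)
    then show ?thesis by (rule AE_mp) (auto intro!: AE_I2 simp: not_le)
  qed
  then have "AE \<omega> in M. \<forall>k. S (inverse (real (Suc k))) \<omega> > 0" by (simp add: AE_all_countable)
  then show ?thesis
  proof (rule AE_mp, intro AE_I2 impI allI)
    fix \<omega> and s :: real assume w: "\<omega> \<in> space M" "\<forall>k. S (inverse (real (Suc k))) \<omega> > 0" and s: "s > 0"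
    obtain k where "inverse (real (Suc k)) < s" using reals_Archimedean[OF s] by blast
    then show "S s \<omega> > 0" using increasing'[OF w(1), of "inverse (real (Suc k))" s] w(2)
      by (meson inverse_nonnegative_iff_nonnegative less_imp_le less_le_trans of_nat_0_le_iff)
  qed
qed

lemma exceeds_iff_nat:
  assumes "\<omega> \<in> space M"
  shows "(\<exists>s>0. S s \<omega> > t) \<longleftrightarrow> (\<exists>n. S (real (Suc n)) \<omega> > t)"
proof
  assume "\<exists>s>0. S s \<omega> > t"
  then obtain s where s: "s > 0" "S s \<omega> > t" by blast
  obtain n where "s \<le> real n" using real_arch_simple by blast
  then have "S s \<omega> \<le> S (real (Suc n)) \<omega>" using s by (intro increasing'[OF assms]) auto
  then show "\<exists>n. S (real (Suc n)) \<omega> > t" using s by (auto intro: less_le_trans)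
next
  assume "\<exists>n. S (real (Suc n)) \<omega> > t"
  then obtain n where "S (real (Suc n)) \<omega> > t" by blast
  then show "\<exists>s>0. S s \<omega> > t" by (intro exI[of _ "real (Suc n)"]) simp
qed

lemma inv_sub_nonneg: "0 \<le> inv_sub S t \<omega>"
  unfolding inv_sub_def by (auto intro!: cInf_greatest)

text \<open>The last alternative is the exceptional case in which the level is never passed and \<open>inv_sub\<close> is \<open>0\<close>
  by convention. Rational times suffice by monotonicity, which makes the event measurable.\<close>
lemma inv_sub_less_iff:
  assumes w: "\<omega> \<in> space M"
  shows "inv_sub S t \<omega> < s \<longleftrightarrow>
    0 < s \<and> ((\<exists>q\<in>\<rat>. 0 < q \<and> q < s \<and> S q \<omega> > t) \<or> (\<forall>n. S (real (Suc n)) \<omega> \<le> t))"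
proof (cases "\<exists>s>0. S s \<omega> > t")
  case True
  let ?A = "{s. s > 0 \<and> S s \<omega> > t}"
  have ne: "?A \<noteq> {}" using True by auto
  have bdd: "bdd_below ?A" by (rule bdd_belowI[of _ 0]) auto
  have L: "inv_sub S t \<omega> = Inf ?A" using True by (simp add: inv_sub_def)
  have "(\<exists>u\<in>?A. u < s) \<longleftrightarrow> 0 < s \<and> (\<exists>q\<in>\<rat>. 0 < q \<and> q < s \<and> S q \<omega> > t)"
  proof
    assume "\<exists>u\<in>?A. u < s"
    then obtain u where u: "u > 0" "S u \<omega> > t" "u < s" by blast
    then obtain q where q: "q \<in> \<rat>" "u < q" "q < s" using Rats_dense_in_real by blast
    then have "S q \<omega> > t" using increasing'[OF w, of u q] u by simp
    moreover have "0 < q" "0 < s" using q u by auto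
    ultimately show "0 < s \<and> (\<exists>q\<in>\<rat>. 0 < q \<and> q < s \<and> S q \<omega> > t)" using q by blast
  qed auto
  moreover have "\<not> (\<forall>n. S (real (Suc n)) \<omega> \<le> t)" using True unfolding exceeds_iff_nat[OF w] by (meson not_le)
  ultimately show ?thesis unfolding L cInf_less_iff[OF ne bdd] by blast
next
  case False
  then have "\<forall>n. S (real (Suc n)) \<omega> \<le> t" using exceeds_iff_nat[OF w] by (auto simp: not_less)
  moreover have "inv_sub S t \<omega> = 0" unfolding inv_sub_def by (rule if_not_P[OF False])
  ultimately show ?thesis by simp
qed

text \<open>For an arbitrary sub-sigma-algebra, since independence needs measurability with respect to the one
  that the subordinator generates.\<close>
lemma inv_sub_measurable:
  assumes N: "space N = space M" "\<And>q. 0 \<le> q \<Longrightarrow> S q \<in> borel_measurable N"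
  shows "inv_sub S t \<in> borel_measurable N"
proof (rule borel_measurableI_less)
  fix s
  have "{\<omega> \<in> space N. inv_sub S t \<omega> < s} = (if 0 < s then
     (\<Union>q\<in>{q\<in>\<rat>. 0 < q \<and> q < s}. {\<omega> \<in> space N. S q \<omega> > t}) \<union> {\<omega> \<in> space N. \<forall>n. S (real (Suc n)) \<omega> \<le> t} else {})"
    using inv_sub_less_iff N(1) by auto
  moreover have "countable {q::real. q \<in> \<rat> \<and> 0 < q \<and> q < s}"
    by (rule countable_subset[OF _ countable_rat]) auto
  moreover have "{\<omega> \<in> space N. S q \<omega> > c} \<in> sets N" "{\<omega> \<in> space N. S q \<omega> \<le> c} \<in> sets N" if "0 \<le> q" for q c
    using N(2)[OF that] by measurable
  ultimately show "{\<omega> \<in> space N. inv_sub S t \<omega> < s} \<in> sets N"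
    by (auto intro!: sets.countable_UN'' sets.Un sets.sets_Collect_countable_All)
qed

lemma inv_sub_rv: "inv_sub S t \<in> borel_measurable M"
  by (rule inv_sub_measurable) (auto intro: rv)

lemma prob_inv_sub_less:
  assumes "t > 0" "s \<ge> 0"
  shows "prob {\<omega> \<in> space M. inv_sub S t \<omega> < s} \<le> s * (\<Phi> 1 / (1 - exp (- t)))"
proof -
  have "prob {\<omega> \<in> space M. inv_sub S t \<omega> < s} \<le> prob {\<omega> \<in> space M. S s \<omega> > t}"
  proof (rule finite_measure_mono_AE)
    show "{\<omega> \<in> space M. S s \<omega> > t} \<in> events" by (rule S_events) fact
    show "AE \<omega> in M. \<omega> \<in> {\<omega> \<in> space M. inv_sub S t \<omega> < s} \<longrightarrow> \<omega> \<in> {\<omega> \<in> space M. S s \<omega> > t}"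
      using AE_exceeds[of t]
    proof (rule AE_mp, intro AE_I2 impI)
      fix \<omega> assume w: "\<omega> \<in> space M" and ex: "\<exists>n. S (real n) \<omega> > t"
        and "\<omega> \<in> {\<omega> \<in> space M. inv_sub S t \<omega> < s}"
      then have lt: "inv_sub S t \<omega> < s" by simp
      obtain n where n: "S (real n) \<omega> > t" using ex by blast
      then have "n \<noteq> 0" using zero[OF w] assms(1) by (cases n) auto
      then obtain k where "n = Suc k" by (cases n) auto
      then have "\<not> (\<forall>n. S (real (Suc n)) \<omega> \<le> t)" using n by (auto simp: not_le)
      then obtain q where "0 < q" "q < s" "S q \<omega> > t" using lt inv_sub_less_iff[OF w] by blast
      then show "\<omega> \<in> {\<omega> \<in> space M. S s \<omega> > t}" using w increasing'[OF w, of q s] by simp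
    qed
  qed
  also have "\<dots> \<le> s * (\<Phi> 1 / (1 - exp (- t)))" by (rule prob_S_gt) (use assms in auto)
  finally show ?thesis .
qed

lemma exp_inv_sub_integrable:
  assumes "0 \<le> r"
  shows "integrable M (\<lambda>\<omega>. exp (- r * inv_sub S t \<omega>))"
proof (rule integrable_const_bound[of _ 1])
  show "(\<lambda>\<omega>. exp (- r * inv_sub S t \<omega>)) \<in> borel_measurable M" using inv_sub_rv by measurable
  show "AE \<omega> in M. norm (exp (- r * inv_sub S t \<omega>)) \<le> 1"
    using inv_sub_nonneg assms by auto
qed

text \<open>Splitting according to the integer part \<open>k\<close> of \<open>r * L\<close> bounds the expectation by the sum of
  \<open>exp (- k)\<close> times the probability of \<open>L < (k + 1) / r\<close>, which is at most linear in \<open>(k + 1) / r\<close>.\<close>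
lemma laplace_inv_sub_decay:
  assumes t: "t > 0"
  obtains C where "C \<ge> 0" "\<And>r. r > 0 \<Longrightarrow> expectation (\<lambda>\<omega>. exp (- r * inv_sub S t \<omega>)) \<le> C / r"
proof -
  define K where "K = \<Phi> 1 / (1 - exp (- t))"
  define A where "A = (\<Sum>k. real (Suc k) * exp (- 1) ^ k)"
  have "norm (exp (- 1 :: real)) < 1" by simp
  from geometric_deriv_sums[OF this] have sm: "summable (\<lambda>k. real (Suc k) * exp (- 1) ^ k)"
    by (simp add: sums_iff)
  have A: "A \<ge> 0" unfolding A_def by (rule suminf_nonneg[OF sm]) auto
  have K: "K \<ge> 0"
    using order_trans[OF measure_nonneg prob_inv_sub_less[OF t, of 1]] by (simp add: K_def)
  have bound: "expectation (\<lambda>\<omega>. exp (- r * inv_sub S t \<omega>)) \<le> A * K / r" if r: "r > 0" for r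
  proof -
    let ?E = "\<lambda>k. {\<omega> \<in> space M. inv_sub S t \<omega> < real (Suc k) / r}"
    have E: "?E k \<in> events" for k using inv_sub_rv by measurable
    have "ennreal (expectation (\<lambda>\<omega>. exp (- r * inv_sub S t \<omega>))) = (\<integral>\<^sup>+\<omega>. ennreal (exp (- r * inv_sub S t \<omega>)) \<partial>M)"
      by (rule nn_integral_eq_integral[symmetric]) (use exp_inv_sub_integrable r in auto)
    also have "\<dots> \<le> (\<integral>\<^sup>+\<omega>. (\<Sum>k. ennreal (exp (- 1) ^ k) * indicator (?E k) \<omega>) \<partial>M)"
    proof (rule nn_integral_mono)
      fix \<omega> assume w: "\<omega> \<in> space M"
      define k where "k = nat \<lfloor>r * inv_sub S t \<omega>\<rfloor>"
      have nn: "0 \<le> r * inv_sub S t \<omega>" using r inv_sub_nonneg[of t \<omega>] by simp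
      have k: "real k \<le> r * inv_sub S t \<omega>" "r * inv_sub S t \<omega> < real (Suc k)"
        using nn by (auto simp: k_def) linarith+
      have "ennreal (exp (- r * inv_sub S t \<omega>)) \<le> ennreal (exp (- 1) ^ k)"
        using k by (intro ennreal_leI) (simp add: exp_of_nat_mult[symmetric])
      also have "\<dots> = ennreal (exp (- 1) ^ k) * indicator (?E k) \<omega>"
        using k r w by (simp add: less_divide_eq mult.commute)
      also have "\<dots> \<le> (\<Sum>k. ennreal (exp (- 1) ^ k) * indicator (?E k) \<omega>)"
      proof -
        have "f k \<le> suminf f" for f :: "nat \<Rightarrow> ennreal"
          using sum_le_suminf[OF summableI, of "{k}" f] by simp
        then show ?thesis .
      qed
      finally show "ennreal (exp (- r * inv_sub S t \<omega>)) \<le> (\<Sum>k. ennreal (exp (- 1) ^ k) * indicator (?E k) \<omega>)" .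
    qed
    also have "\<dots> = (\<Sum>k. ennreal (exp (- 1) ^ k) * emeasure M (?E k))"
      using E by (subst nn_integral_suminf) (auto simp: nn_integral_cmult_indicator)
    also have "\<dots> \<le> (\<Sum>k. ennreal (real (Suc k) * exp (- 1) ^ k * (K / r)))"
    proof (rule suminf_le)
      fix k
      have "exp (- 1) ^ k * prob (?E k) \<le> exp (- 1) ^ k * (real (Suc k) / r * K)"
        unfolding K_def using r by (intro mult_left_mono prob_inv_sub_less[OF t]) auto
      also have "\<dots> = real (Suc k) * exp (- 1) ^ k * (K / r)" by simp
      finally show "ennreal (exp (- 1) ^ k) * emeasure M (?E k) \<le> ennreal (real (Suc k) * exp (- 1) ^ k * (K / r))"
        unfolding emeasure_eq_measure ennreal_mult'[symmetric, OF measure_nonneg]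
        by (subst ennreal_mult''[symmetric]) (auto intro: ennreal_leI)
    qed auto
    also have "\<dots> = ennreal (A * (K / r))"
      unfolding A_def suminf_mult2[OF sm]
      by (rule suminf_ennreal2) (use K r sm in \<open>auto intro!: summable_mult2\<close>)
    finally show ?thesis using A K r by (simp add: ennreal_le_iff)
  qed
  show ?thesis by (rule that[of "A * K"]) (use A K bound in auto)
qed

lemma AE_inv_sub_tendsto_0: "AE \<omega> in M. ((\<lambda>t. inv_sub S t \<omega>) \<longlongrightarrow> 0) (at_right 0)"
  using AE_S_pos
proof (rule AE_mp, intro AE_I2 impI)
  fix \<omega> assume w: "\<omega> \<in> space M" and pos: "\<forall>s>0. S s \<omega> > 0"
  show "((\<lambda>t. inv_sub S t \<omega>) \<longlongrightarrow> 0) (at_right 0)"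
  proof (rule order_tendstoI)
    fix a :: real assume "a < 0"
    then show "\<forall>\<^sub>F t in at_right 0. a < inv_sub S t \<omega>"
      using inv_sub_nonneg[of _ \<omega>] by (auto intro!: always_eventually intro: less_le_trans)
  next
    fix a :: real assume a: "0 < a"
    then have p: "S (a / 2) \<omega> > 0" using pos by simp
    have "inv_sub S t \<omega> < a" if "t < S (a / 2) \<omega>" for t
    proof -
      have ex: "\<exists>s>0. S s \<omega> > t" using that a by (intro exI[of _ "a / 2"]) auto
      have "Inf {s. s > 0 \<and> S s \<omega> > t} \<le> a / 2"
        by (rule cInf_lower) (use that a in \<open>auto intro: bdd_belowI[of _ 0]\<close>)
      then show ?thesis using ex a by (simp add: inv_sub_def)
    qed
    then show "\<forall>\<^sub>F t in at_right 0. inv_sub S t \<omega> < a"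
      using eventually_at_right_real[OF p] by (auto elim!: eventually_mono)
  qed
qed

end

section \<open>The law of the inverse subordinator\<close>

text \<open>The Laplace transforms at the integers are the moments of \<open>exp (- X)\<close>, which has values in \<open>[0, 1]\<close>.
  They determine the expectations of polynomials, of continuous functions by the theorem of
  Weierstrass, and of the indicator functions of half-lines by monotone approximation.\<close>
lemma laplace_determines_tail:
  fixes X :: "'a \<Rightarrow> real" and Y :: "'b \<Rightarrow> real"
  assumes "prob_space M" "prob_space N"
    and X: "X \<in> borel_measurable M" "\<And>x. x \<in> space M \<Longrightarrow> 0 \<le> X x"
    and Y: "Y \<in> borel_measurable N" "\<And>y. y \<in> space N \<Longrightarrow> 0 \<le> Y y"
    and eq: "\<And>n. (\<integral>x. exp (- real n * X x) \<partial>M) = (\<integral>y. exp (- real n * Y y) \<partial>N)"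
  shows "measure M {x \<in> space M. X x > c} = measure N {y \<in> space N. Y y > c}"
proof -
  interpret M: prob_space M by fact
  interpret N: prob_space N by fact
  define U where "U x = exp (- X x)" for x
  define V where "V y = exp (- Y y)" for y
  have U [measurable]: "U \<in> borel_measurable M" unfolding U_def using X(1) by measurable
  have V [measurable]: "V \<in> borel_measurable N" unfolding V_def using Y(1) by measurable
  have U01: "U x \<in> {0..1}" if "x \<in> space M" for x using X(2)[OF that] by (simp add: U_def)
  have V01: "V y \<in> {0..1}" if "y \<in> space N" for y using Y(2)[OF that] by (simp add: V_def)
  have intU: "integrable M (\<lambda>x. f (U x))" if f: "continuous_on UNIV f" for f :: "real \<Rightarrow> real"
  proof -
    have "bounded (f ` {0..1})"
      using compact_continuous_image[OF continuous_on_subset[OF f] compact_Icc, of 0 1] by (simp add: compact_imp_bounded)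
    then obtain B where "\<forall>x\<in>f ` {0..1}. norm x \<le> B" unfolding bounded_iff by blast
    then show ?thesis
      using borel_measurable_continuous_onI[OF f] U01 by (intro M.integrable_const_bound[of _ B]) (auto intro!: AE_I2)
  qed
  have intV: "integrable N (\<lambda>x. f (V x))" if f: "continuous_on UNIV f" for f :: "real \<Rightarrow> real"
  proof -
    have "bounded (f ` {0..1})"
      using compact_continuous_image[OF continuous_on_subset[OF f] compact_Icc, of 0 1] by (simp add: compact_imp_bounded)
    then obtain B where "\<forall>x\<in>f ` {0..1}. norm x \<le> B" unfolding bounded_iff by blast
    then show ?thesis
      using borel_measurable_continuous_onI[OF f] V01 by (intro N.integrable_const_bound[of _ B]) (auto intro!: AE_I2)
  qed
  have poly: "(\<integral>x. p (U x) \<partial>M) = (\<integral>y. p (V y) \<partial>N)" if p': "real_polynomial_function p" for p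
  proof -
    obtain a n where p: "p = (\<lambda>x. \<Sum>i\<le>n::nat. a i * x ^ i)"
      using p' unfolding real_polynomial_function_iff_sum by blast
    have UV: "U x ^ i = exp (- real i * X x)" "V y ^ i = exp (- real i * Y y)" for i x y
      by (simp_all add: U_def V_def exp_of_nat_mult[symmetric])
    have "(\<integral>x. p (U x) \<partial>M) = (\<Sum>i\<le>n. a i * (\<integral>x. U x ^ i \<partial>M))"
      unfolding p by (subst Bochner_Integration.integral_sum) (auto intro!: intU integrable_mult_right continuous_intros)
    also have "\<dots> = (\<Sum>i\<le>n. a i * (\<integral>y. V y ^ i \<partial>N))" unfolding UV eq ..
    also have "\<dots> = (\<integral>y. p (V y) \<partial>N)"
      unfolding p by (subst Bochner_Integration.integral_sum) (auto intro!: intV integrable_mult_right continuous_intros)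
    finally show ?thesis .
  qed
  have cont: "(\<integral>x. f (U x) \<partial>M) = (\<integral>y. f (V y) \<partial>N)" if f: "continuous_on UNIV f" for f :: "real \<Rightarrow> real"
  proof -
    have "\<bar>(\<integral>x. f (U x) \<partial>M) - (\<integral>y. f (V y) \<partial>N)\<bar> \<le> 0 + e" if "e > 0" for e
    proof -
      have "e / 2 > 0" using that by simp
      then obtain p where p: "real_polynomial_function p" "\<And>x. x \<in> {0..1} \<Longrightarrow> \<bar>f x - p x\<bar> < e / 2"
        using Stone_Weierstrass_real_polynomial_function[OF compact_Icc[of 0 1] continuous_on_subset[OF f]] by blast
      have cp: "continuous_on UNIV p"
        using p(1) by (simp add: continuous_at_imp_continuous_on continuous_real_polymonial_function)
      have "\<bar>(\<integral>x. f (U x) \<partial>M) - (\<integral>x. p (U x) \<partial>M)\<bar> = \<bar>\<integral>x. f (U x) - p (U x) \<partial>M\<bar>"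
        using intU f cp by simp
      also have "\<dots> \<le> (\<integral>x. \<bar>f (U x) - p (U x)\<bar> \<partial>M)" by (rule integral_abs_bound)
      also have "\<dots> \<le> (\<integral>x. e / 2 \<partial>M)"
        using p(2) U01 by (intro integral_mono intU continuous_intros f cp) (auto intro: less_imp_le)
      finally have 1: "\<bar>(\<integral>x. f (U x) \<partial>M) - (\<integral>x. p (U x) \<partial>M)\<bar> \<le> e / 2" by (simp add: M.prob_space)
      have "\<bar>(\<integral>x. f (V x) \<partial>N) - (\<integral>x. p (V x) \<partial>N)\<bar> = \<bar>\<integral>x. f (V x) - p (V x) \<partial>N\<bar>"
        using intV f cp by simp
      also have "\<dots> \<le> (\<integral>x. \<bar>f (V x) - p (V x)\<bar> \<partial>N)" by (rule integral_abs_bound)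
      also have "\<dots> \<le> (\<integral>x. e / 2 \<partial>N)"
        using p(2) V01 by (intro integral_mono intV continuous_intros f cp) (auto intro: less_imp_le)
      finally have 2: "\<bar>(\<integral>x. f (V x) \<partial>N) - (\<integral>x. p (V x) \<partial>N)\<bar> \<le> e / 2" by (simp add: N.prob_space)
      show ?thesis using 1 2 poly[OF p(1)] by linarith
    qed
    then have "\<bar>(\<integral>x. f (U x) \<partial>M) - (\<integral>y. f (V y) \<partial>N)\<bar> \<le> 0" by (rule field_le_epsilon)
    then show ?thesis by simp
  qed
  \<comment> \<open>\<open>X > c\<close> means \<open>exp (- X) < a\<close>; the continuous functions \<open>f k\<close> increase to this indicator\<close>
  define a where "a = exp (- c)"
  define f where "f k u = min 1 (real k * max 0 (a - u))" for k and u :: real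
  have cf: "continuous_on UNIV (f k)" for k unfolding f_def by (intro continuous_intros)
  have flim: "(\<lambda>k. f k u) \<longlonglongrightarrow> indicator {..<a} u" for u
  proof (cases "u < a")
    case True
    then obtain K where "1 < real K * (a - u)" using reals_Archimedean3[of "a - u"] by auto
    then have K: "f k u = 1" if "k \<ge> K" for k
    proof -
      have "real K * (a - u) \<le> real k * (a - u)" using that True by (intro mult_right_mono) auto
      then have "1 \<le> real k * (a - u)" using \<open>1 < real K * (a - u)\<close> by linarith
      then show ?thesis using True by (simp add: f_def)
    qed
    then have "(\<lambda>k. f k u) \<longlonglongrightarrow> 1" by (intro tendsto_eventually) (auto simp: eventually_sequentially)
    then show ?thesis using True by simp
  qed (simp add: f_def)
  have f1: "norm (f k u) \<le> 1" for k u by (auto simp: f_def)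
  have limU: "(\<lambda>k. \<integral>x. f k (U x) \<partial>M) \<longlonglongrightarrow> (\<integral>x. indicat_real {..<a} (U x) \<partial>M)"
    by (rule integral_dominated_convergence[where w="\<lambda>_. 1"])
       (use flim f1 borel_measurable_continuous_onI[OF cf] in \<open>auto intro!: measurable_compose[OF U]\<close>)
  have limV: "(\<lambda>k. \<integral>x. f k (V x) \<partial>N) \<longlonglongrightarrow> (\<integral>x. indicat_real {..<a} (V x) \<partial>N)"
    by (rule integral_dominated_convergence[where w="\<lambda>_. 1"])
       (use flim f1 borel_measurable_continuous_onI[OF cf] in \<open>auto intro!: measurable_compose[OF V]\<close>)
  have "(\<integral>x. indicat_real {..<a} (U x) \<partial>M) = (\<integral>x. indicat_real {..<a} (V x) \<partial>N)"
    using limU limV unfolding cont[OF cf] by (rule LIMSEQ_unique)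
  moreover have "(\<integral>x. indicat_real {..<a} (U x) \<partial>M) = measure M {x \<in> space M. X x > c}"
  proof -
    have "(\<integral>x. indicat_real {..<a} (U x) \<partial>M) = (\<integral>x. indicator {x \<in> space M. X x > c} x \<partial>M)"
      by (intro Bochner_Integration.integral_cong) (auto simp: U_def a_def indicator_def)
    also have "\<dots> = measure M {x \<in> space M. X x > c}" using X(1) by simp
    finally show ?thesis .
  qed
  moreover have "(\<integral>x. indicat_real {..<a} (V x) \<partial>N) = measure N {x \<in> space N. Y x > c}"
  proof -
    have "(\<integral>x. indicat_real {..<a} (V x) \<partial>N) = (\<integral>x. indicator {x \<in> space N. Y x > c} x \<partial>N)"
      by (intro Bochner_Integration.integral_cong) (auto simp: V_def a_def indicator_def)
    also have "\<dots> = measure N {x \<in> space N. Y x > c}" using Y(1) by simp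
    finally show ?thesis .
  qed
  ultimately show ?thesis by simp
qed

text \<open>The event \<open>inv_sub S t < s\<close> is, up to a null set, the increasing union of the events \<open>S q > t\<close> along
  times \<open>q\<close> that increase to \<open>s\<close>; so its probability depends on the one-dimensional laws only.\<close>
lemma (in unbounded_subordinator) prob_inv_sub_less_lim:
  assumes t: "t \<ge> 0" and s: "s > 0"
  shows "(\<lambda>n. prob {\<omega> \<in> space M. S (s * (1 - inverse (real (Suc n)))) \<omega> > t})
    \<longlonglongrightarrow> prob {\<omega> \<in> space M. inv_sub S t \<omega> < s}"
proof -
  define q where "q n = s * (1 - inverse (real (Suc n)))" for n
  have q0: "0 \<le> q n" and qs: "q n < s" for n using s by (auto simp: q_def field_simps)
  have qmono: "q m \<le> q n" if "m \<le> n" for m n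
    using that s unfolding q_def by (intro mult_left_mono diff_left_mono le_imp_inverse_le) auto
  have qlim: "q \<longlonglongrightarrow> s * (1 - 0)" unfolding q_def
    by (intro tendsto_intros LIMSEQ_inverse_real_of_nat)
  let ?A = "\<lambda>n. {\<omega> \<in> space M. S (q n) \<omega> > t}"
  have "incseq ?A"
    using increasing'[OF _ q0 qmono] by (force simp: incseq_def intro: less_le_trans)
  moreover have "range ?A \<subseteq> events" using S_events(1)[OF q0] by auto
  ultimately have "(\<lambda>n. prob (?A n)) \<longlonglongrightarrow> prob (\<Union>n. ?A n)"
    by (intro finite_Lim_measure_incseq)
  also have "prob (\<Union>n. ?A n) = prob {\<omega> \<in> space M. inv_sub S t \<omega> < s}"
  proof (rule finite_measure_eq_AE)
    show "(\<Union>n. ?A n) \<in> events" using S_events(1)[OF q0] by auto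
    show "{\<omega> \<in> space M. inv_sub S t \<omega> < s} \<in> events" using inv_sub_rv by measurable
    show "AE \<omega> in M. \<omega> \<in> (\<Union>n. ?A n) \<longleftrightarrow> \<omega> \<in> {\<omega> \<in> space M. inv_sub S t \<omega> < s}"
      using AE_exceeds[of t]
    proof (rule AE_mp, intro AE_I2 impI)
      fix \<omega> assume w: "\<omega> \<in> space M" and ex: "\<exists>n. S (real n) \<omega> > t"
      obtain n where n: "S (real n) \<omega> > t" using ex by blast
      then have "n \<noteq> 0" using zero[OF w] t by (cases n) auto
      then obtain k where "n = Suc k" by (cases n) auto
      then have noall: "\<not> (\<forall>n. S (real (Suc n)) \<omega> \<le> t)" using n by (auto simp: not_le)
      have ex': "\<exists>s>0. S s \<omega> > t" using n \<open>n \<noteq> 0\<close> by (intro exI[of _ "real n"]) auto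
      show "\<omega> \<in> (\<Union>n. ?A n) \<longleftrightarrow> \<omega> \<in> {\<omega> \<in> space M. inv_sub S t \<omega> < s}"
      proof
        assume "\<omega> \<in> (\<Union>n. ?A n)"
        then obtain n where qn: "S (q n) \<omega> > t" by blast
        then have "q n > 0" using zero[OF w] t q0[of n] by (cases "q n = 0") auto
        then have "Inf {s. s > 0 \<and> S s \<omega> > t} \<le> q n"
          using qn by (intro cInf_lower) (auto intro: bdd_belowI[of _ 0])
        then show "\<omega> \<in> {\<omega> \<in> space M. inv_sub S t \<omega> < s}"
          using ex' w qs[of n] by (simp add: inv_sub_def)
      next
        assume "\<omega> \<in> {\<omega> \<in> space M. inv_sub S t \<omega> < s}"
        then obtain r where r: "0 < r" "r < s" "S r \<omega> > t" using inv_sub_less_iff[OF w] noall by blast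
        have "eventually (\<lambda>n. q n > r) sequentially" using order_tendstoD(1)[OF qlim, of r] r by simp
        then obtain n where "q n > r" by (auto simp: eventually_sequentially)
        then have "S (q n) \<omega> > t" using increasing'[OF w, of r "q n"] r by simp
        then show "\<omega> \<in> (\<Union>n. ?A n)" using w by blast
      qed
    qed
  qed
  finally show ?thesis unfolding q_def .
qed

text \<open>Stated for the negative of \<open>inv_sub\<close>, so that the known probabilities of \<open>inv_sub S t < s\<close> are those of
  upper half-lines.\<close>
lemma inv_sub_law_unique:
  assumes M: "unbounded_subordinator M S \<Phi>" and N: "unbounded_subordinator N S' \<Phi>" and t: "t \<ge> 0"
  shows "distr M borel (\<lambda>\<omega>. - inv_sub S t \<omega>) = distr N borel (\<lambda>\<omega>. - inv_sub S' t \<omega>)"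
proof -
  interpret M: unbounded_subordinator M S \<Phi> by fact
  interpret N: unbounded_subordinator N S' \<Phi> by fact
  have tail: "M.prob {\<omega> \<in> space M. S s \<omega> > c} = N.prob {\<omega> \<in> space N. S' s \<omega> > c}" if "s \<ge> 0" for s c
    by (rule laplace_determines_tail)
       (use that M.prob_space_axioms N.prob_space_axioms M.rv N.rv M.nonneg N.nonneg M.laplace[OF that] N.laplace[OF that] in auto)
  have less: "M.prob {\<omega> \<in> space M. inv_sub S t \<omega> < s} = N.prob {\<omega> \<in> space N. inv_sub S' t \<omega> < s}" for s
  proof (cases "s > 0")
    case True
    have "0 \<le> s * (1 - inverse (real (Suc n)))" for n using True by (auto simp: field_simps)
    then show ?thesis
      using M.prob_inv_sub_less_lim[OF t True] N.prob_inv_sub_less_lim[OF t True] tail LIMSEQ_unique by simp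
  next
    case False
    then have "\<not> inv_sub S t \<omega> < s" "\<not> inv_sub S' t \<omega>' < s" for \<omega> \<omega>'
      using M.inv_sub_nonneg[of t \<omega>] N.inv_sub_nonneg[of t \<omega>'] by linarith+
    then show ?thesis by simp
  qed
  have mM: "(\<lambda>\<omega>. - inv_sub S t \<omega>) \<in> borel_measurable M" using M.inv_sub_rv by measurable
  have mN: "(\<lambda>\<omega>. - inv_sub S' t \<omega>) \<in> borel_measurable N" using N.inv_sub_rv by measurable
  have eM: "emeasure (distr M borel (\<lambda>\<omega>. - inv_sub S t \<omega>)) {x<..} = M.prob {\<omega> \<in> space M. inv_sub S t \<omega> < - x}" for x
  proof -
    have "(\<lambda>\<omega>. - inv_sub S t \<omega>) -` {x<..} \<inter> space M = {\<omega> \<in> space M. inv_sub S t \<omega> < - x}" by auto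
    then show ?thesis by (simp add: emeasure_distr[OF mM] M.emeasure_eq_measure)
  qed
  have eN: "emeasure (distr N borel (\<lambda>\<omega>. - inv_sub S' t \<omega>)) {x<..} = N.prob {\<omega> \<in> space N. inv_sub S' t \<omega> < - x}" for x
  proof -
    have "(\<lambda>\<omega>. - inv_sub S' t \<omega>) -` {x<..} \<inter> space N = {\<omega> \<in> space N. inv_sub S' t \<omega> < - x}" by auto
    then show ?thesis by (simp add: emeasure_distr[OF mN] N.emeasure_eq_measure)
  qed
  show ?thesis
    by (rule measure_eqI_lessThan) (auto simp: eM eN less)
qed

lemma e_fun_unique:
  assumes M: "unbounded_subordinator M S \<Phi>" and N: "unbounded_subordinator N S' \<Phi>" and t: "t \<ge> 0"
  shows "e_fun M S t z = e_fun N S' t z"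
proof -
  interpret M: unbounded_subordinator M S \<Phi> by fact
  interpret N: unbounded_subordinator N S' \<Phi> by fact
  have "continuous_on UNIV (\<lambda>u::real. exp (- (z * complex_of_real u)))" by (intro continuous_intros)
  then have g: "(\<lambda>u::real. exp (- (z * complex_of_real u))) \<in> borel_measurable borel"
    by (rule borel_measurable_continuous_onI)
  have "e_fun M S t z = (\<integral>u. exp (- (z * complex_of_real u)) \<partial>distr M borel (\<lambda>\<omega>. - inv_sub S t \<omega>))"
    unfolding e_fun_def by (subst integral_distr[OF _ g]) (use M.inv_sub_rv in \<open>auto\<close>)
  also have "\<dots> = e_fun N S' t z"
    unfolding e_fun_def inv_sub_law_unique[OF assms]
    by (subst integral_distr[OF _ g]) (use N.inv_sub_rv in \<open>auto\<close>)
  finally show ?thesis .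
qed

section \<open>The diffusion acts diagonally on spherical harmonics\<close>

lemma continuous_S2_bounded:
  fixes f :: "real^3 \<Rightarrow> 'b::real_normed_vector"
  assumes "continuous_on S2 f"
  obtains B where "B \<ge> 0" "\<And>x. x \<in> S2 \<Longrightarrow> norm (f x) \<le> B"
proof -
  have "bounded (f ` S2)"
    using compact_continuous_image[OF assms compact_sphere] by (rule compact_imp_bounded)
  then obtain B where B: "\<And>x. x \<in> S2 \<Longrightarrow> norm (f x) \<le> B" unfolding bounded_iff by blast
  show ?thesis
  proof (rule that[of "max B 0"])
    show "norm (f x) \<le> max B 0" if "x \<in> S2" for x using B[OF that] by linarith
  qed simp
qed

lemma norm_exp_eigenvalue:
  assumes "0 \<le> t"
  shows "norm (exp (eigenvalue \<mu> l m * of_real t)) = exp (- real (l * (l + 1)) * t)"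
  by (simp add: eigenvalue_def)

lemma norm_exp_eigenvalue_le_1: "0 \<le> t \<Longrightarrow> norm (exp (eigenvalue \<mu> l m * of_real t)) \<le> 1"
proof -
  assume t: "0 \<le> t"
  then have "0 \<le> real (l * (l + 1)) * t" by (intro mult_nonneg_nonneg) auto
  then show ?thesis unfolding norm_exp_eigenvalue[OF t] by (simp only: exp_le_one_iff mult_minus_left neg_le_0_iff_le)
qed

lemma exp_linear_approximation:
  fixes z :: complex
  assumes "e > 0"
  shows "\<forall>\<^sub>F h in at_right 0. norm (exp (z * of_real h) - 1 - z * of_real h) \<le> e * h"
proof -
  have "((\<lambda>w. exp (z * w)) has_field_derivative z) (at 0)"
    by (rule derivative_eq_intros refl | simp)+
  then have "((\<lambda>w. (exp (z * w) - 1) / w) \<longlongrightarrow> z) (at 0)"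
    by (simp add: has_field_derivative_iff)
  moreover have "filterlim (\<lambda>h::real. complex_of_real h) (at 0) (at_right 0)"
    by (auto simp: filterlim_at eventually_at_filter intro!: tendsto_eq_intros)
  ultimately have "((\<lambda>h. (exp (z * of_real h) - 1) / of_real h) \<longlongrightarrow> z) (at_right (0::real))"
    by (rule filterlim_compose)
  then have "\<forall>\<^sub>F h in at_right (0::real). dist ((exp (z * of_real h) - 1) / of_real h) z < e"
    using assms by (rule tendstoD)
  moreover have "\<forall>\<^sub>F h in at_right (0::real). h > 0" by (rule eventually_at_right_less)
  ultimately show ?thesis
  proof eventually_elim
    case (elim h)
    have "norm (exp (z * of_real h) - 1 - z * of_real h) = norm (((exp (z * of_real h) - 1) / of_real h - z) * of_real h)"
    proof -
      have "A - z * k = (A / k - z) * k" if "k \<noteq> 0" for A k :: complex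
        using that by (simp add: left_diff_distrib)
      then show ?thesis using elim by simp
    qed
    also have "\<dots> = norm ((exp (z * of_real h) - 1) / of_real h - z) * h"
      using elim by (simp add: norm_mult)
    also have "\<dots> \<le> e * h" using elim by (intro mult_right_mono) (auto simp: dist_norm)
    finally show ?case .
  qed
qed

lemma Im_of_real_mult: "Im (of_real c * z) = c * Im z"
  by simp

context sphere_diffusion
begin

lemma W_in_S2: "x \<in> S2 \<Longrightarrow> 0 \<le> t \<Longrightarrow> \<omega> \<in> space (P x) \<Longrightarrow> W t \<omega> \<in> S2"
  using measurable_space[OF measurable, of x t \<omega>] by (simp add: space_restrict_space)

lemma continuous_W_measurable:
  fixes f :: "real^3 \<Rightarrow> 'b::topological_space"
  assumes "x \<in> S2" "0 \<le> t" "continuous_on S2 f"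
  shows "(\<lambda>\<omega>. f (W t \<omega>)) \<in> borel_measurable (P x)"
  by (rule measurable_compose[OF measurable[OF assms(1,2)]])
     (rule borel_measurable_continuous_on_restrict[OF assms(3)])

lemma continuous_W_integrable:
  fixes f :: "real^3 \<Rightarrow> 'b::{banach, second_countable_topology}"
  assumes "x \<in> S2" "0 \<le> t" "continuous_on S2 f"
  shows "integrable (P x) (\<lambda>\<omega>. f (W t \<omega>))"
proof -
  interpret prob_space "P x" by (rule prob) fact
  obtain B where B: "\<And>x. x \<in> S2 \<Longrightarrow> norm (f x) \<le> B" using continuous_S2_bounded[OF assms(3)] by metis
  show ?thesis
    by (rule integrable_const_bound[of _ B])
       (use B W_in_S2 assms continuous_W_measurable[OF assms] in \<open>auto intro!: AE_I2\<close>)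
qed

lemma history_subalgebra:
  assumes "x \<in> S2" "0 \<le> s"
  shows "subalgebra (P x) (history (P x) W s)"
proof -
  let ?G = "{W u -` A \<inter> space (P x) | u A. 0 \<le> u \<and> u \<le> s \<and> A \<in> sets S2_borel}"
  have G: "?G \<subseteq> sets (P x)"
    using measurable_sets[OF measurable[OF assms(1)]] by auto
  then have sub: "?G \<subseteq> Pow (space (P x))" using sets.space_closed by blast
  show ?thesis
    unfolding subalgebra_def history_def
    using sets.sigma_sets_subset[OF G] sub by (simp add: space_measure_of_conv sets_measure_of)
qed

lemma trans_op_semigroup:
  assumes "x \<in> S2" "0 \<le> s" "0 \<le> t" "continuous_on S2 f"
  shows "trans_op P W (s + t) f x = trans_op P W s (trans_op P W t f) x"
proof -
  interpret prob_space "P x" by (rule prob) fact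
  interpret finite_measure_subalgebra "P x" "history (P x) W s"
    by unfold_locales (rule history_subalgebra[OF assms(1,2)])
  have int: "integrable (P x) (\<lambda>\<omega>. f (W (s + t) \<omega>))"
    using assms by (intro continuous_W_integrable) auto
  have "trans_op P W (s + t) f x = (\<integral>\<omega>. real_cond_exp (P x) (history (P x) W s) (\<lambda>\<omega>'. f (W (s + t) \<omega>')) \<omega> \<partial>P x)"
    unfolding trans_op_def using real_cond_exp_int(2)[OF int] by simp
  also have "\<dots> = (\<integral>\<omega>. trans_op P W t f (W s \<omega>) \<partial>P x)"
  proof (rule integral_cong_AE)
    show "real_cond_exp (P x) (history (P x) W s) (\<lambda>\<omega>'. f (W (s + t) \<omega>')) \<in> borel_measurable (P x)"
      by (rule borel_measurable_cond_exp2)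
    show "(\<lambda>\<omega>. trans_op P W t f (W s \<omega>)) \<in> borel_measurable (P x)"
      using assms feller by (intro continuous_W_measurable) auto
    show "AE \<omega> in P x. real_cond_exp (P x) (history (P x) W s) (\<lambda>\<omega>'. f (W (s + t) \<omega>')) \<omega>
        = trans_op P W t f (W s \<omega>)"
      using assms by (rule markov)
  qed
  finally show ?thesis by (simp add: trans_op_def)
qed

definition ctrans :: "real \<Rightarrow> (real^3 \<Rightarrow> complex) \<Rightarrow> real^3 \<Rightarrow> complex" where
  "ctrans t f x = (\<integral>\<omega>. f (W t \<omega>) \<partial>P x)"

lemma ctrans_Re_Im:
  assumes "x \<in> S2" "0 \<le> t" "continuous_on S2 f"
  shows "ctrans t f x = Complex (trans_op P W t (\<lambda>x. Re (f x)) x) (trans_op P W t (\<lambda>x. Im (f x)) x)"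
  using continuous_W_integrable[OF assms] unfolding ctrans_def trans_op_def by (simp add: complex_eq_iff)

lemma continuous_ctrans:
  assumes "0 \<le> t" "continuous_on S2 f"
  shows "continuous_on S2 (ctrans t f)"
proof -
  have "continuous_on S2 (\<lambda>x. Complex (trans_op P W t (\<lambda>x. Re (f x)) x) (trans_op P W t (\<lambda>x. Im (f x)) x))"
    using assms by (intro continuous_on_Complex feller continuous_intros)
  then show ?thesis by (rule continuous_on_eq) (use ctrans_Re_Im assms in simp)
qed

lemma ctrans_semigroup:
  assumes "x \<in> S2" "0 \<le> s" "0 \<le> t" "continuous_on S2 f"
  shows "ctrans (s + t) f x = ctrans s (ctrans t f) x"
proof -
  have Re_cong: "trans_op P W s g x = trans_op P W s g' x" if "\<And>z. z \<in> S2 \<Longrightarrow> g z = g' z" for g g'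
    unfolding trans_op_def using that W_in_S2 assms by (intro Bochner_Integration.integral_cong) auto
  have c: "continuous_on S2 (\<lambda>x. Re (f x))" "continuous_on S2 (\<lambda>x. Im (f x))"
    using assms(4) by (auto intro!: continuous_intros)
  have "ctrans s (ctrans t f) x = Complex (trans_op P W s (\<lambda>x. Re (ctrans t f x)) x) (trans_op P W s (\<lambda>x. Im (ctrans t f x)) x)"
    using assms by (intro ctrans_Re_Im continuous_ctrans)
  also have "trans_op P W s (\<lambda>x. Re (ctrans t f x)) x = trans_op P W s (trans_op P W t (\<lambda>x. Re (f x))) x"
    by (rule Re_cong) (use ctrans_Re_Im assms in simp)
  also have "trans_op P W s (\<lambda>x. Im (ctrans t f x)) x = trans_op P W s (trans_op P W t (\<lambda>x. Im (f x))) x"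
    by (rule Re_cong) (use ctrans_Re_Im assms in simp)
  also have "Complex (trans_op P W s (trans_op P W t (\<lambda>x. Re (f x))) x) (trans_op P W s (trans_op P W t (\<lambda>x. Im (f x))) x)
      = ctrans (s + t) f x"
    using assms c by (subst ctrans_Re_Im) (auto simp: trans_op_semigroup)
  finally show ?thesis ..
qed

text \<open>The generator on the real and on the imaginary part shows that the semigroup at time \<open>h\<close> differs from
  multiplication by \<open>1 + eigenvalue * h\<close>, hence also from multiplication by the exponential, by an
  amount that is small compared with \<open>h\<close>, uniformly on the sphere.\<close>
lemma sph_harm_infinitesimal:
  assumes m: "m \<in> {- int l..int l}" and e: "e > 0"
  shows "\<forall>\<^sub>F h in at_right 0. \<forall>x\<in>S2.
    norm (ctrans h (sph_harm l m) x - exp (eigenvalue \<mu> l m * of_real h) * sph_harm l m x) \<le> e * h"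
proof -
  let ?Y = "sph_harm l m" and ?ev = "eigenvalue \<mu> l m"
  obtain B where B: "B \<ge> 0" "\<And>x. x \<in> S2 \<Longrightarrow> norm (?Y x) \<le> B"
    using continuous_S2_bounded[OF continuous_on_sph_harm[OF m]] by metis
  have ul: "\<forall>\<^sub>F h in at_right 0. \<forall>x\<in>S2.
      dist ((trans_op P W h (\<lambda>x. Re (c * ?Y x)) x - Re (c * ?Y x)) / h) (G_op \<mu> (\<lambda>x. Re (c * ?Y x)) x) < e / 4" for c
    using generator[OF smooth_sph_harm[OF m, of c]] e unfolding uniform_limit_iff
    by (auto dest!: spec[of _ "e / 4"])
  have "e / (2 * (B + 1)) > 0" using e B by simp
  then have "\<forall>\<^sub>F h in at_right 0. norm (exp (?ev * of_real h) - 1 - ?ev * of_real h) \<le> (e / (2 * (B + 1))) * h"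
    by (rule exp_linear_approximation)
  moreover note ul[of 1] ul[of "-\<i>"]
  moreover have "\<forall>\<^sub>F h in at_right (0::real). h > 0" by (rule eventually_at_right_less)
  ultimately show ?thesis
  proof eventually_elim
    case (elim h)
    show ?case
    proof
      fix x :: "real^3" assume x: "x \<in> S2"
      let ?d = "ctrans h ?Y x - ?Y x - of_real h * (?ev * ?Y x)"
      have E: "ctrans h ?Y x = Complex (trans_op P W h (\<lambda>x. Re (?Y x)) x) (trans_op P W h (\<lambda>x. Im (?Y x)) x)"
        using ctrans_Re_Im[OF x _ continuous_on_sph_harm[OF m]] elim by simp
      have scale: "\<bar>a - b - h * g\<bar> \<le> e / 4 * h" if "\<bar>(a - b) / h - g\<bar> < e / 4" for a b g
      proof -
        have "\<bar>a - b - h * g\<bar> = \<bar>(a - b) / h - g\<bar> * h" using elim by (simp add: abs_mult_pos' field_simps)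
        then show ?thesis using that elim by (simp add: mult_right_mono)
      qed
      have Re_i: "Re (- \<i> * w) = Im w" for w by simp
      have "\<bar>trans_op P W h (\<lambda>x. Re (?Y x)) x - Re (?Y x) - h * Re (?ev * ?Y x)\<bar> \<le> e / 4 * h"
      proof (rule scale)
        have "G_op \<mu> (\<lambda>x. Re (?Y x)) x = Re (?ev * ?Y x)"
          using sph_harm_eigenfunction[OF m x, of \<mu> 1] by (simp only: mult_1_left)
        then show "\<bar>(trans_op P W h (\<lambda>x. Re (?Y x)) x - Re (?Y x)) / h - Re (?ev * ?Y x)\<bar> < e / 4"
          using bspec[OF elim(2) x] by (simp only: dist_real_def mult_1_left)
      qed
      then have "\<bar>Re ?d\<bar> \<le> e / 4 * h" unfolding E minus_complex.sel Re_of_real_mult complex.sel .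
      have "\<bar>trans_op P W h (\<lambda>x. Im (?Y x)) x - Im (?Y x) - h * Im (?ev * ?Y x)\<bar> \<le> e / 4 * h"
      proof (rule scale)
        have "G_op \<mu> (\<lambda>x. Im (?Y x)) x = Im (?ev * ?Y x)"
          using sph_harm_eigenfunction[OF m x, of \<mu> "- \<i>"] by (simp only: Re_i)
        then show "\<bar>(trans_op P W h (\<lambda>x. Im (?Y x)) x - Im (?Y x)) / h - Im (?ev * ?Y x)\<bar> < e / 4"
          using bspec[OF elim(3) x] by (simp only: dist_real_def Re_i)
      qed
      then have "\<bar>Im ?d\<bar> \<le> e / 4 * h" unfolding E minus_complex.sel Im_of_real_mult complex.sel .
      with \<open>\<bar>Re ?d\<bar> \<le> e / 4 * h\<close> have d: "norm ?d \<le> e / 2 * h" using cmod_le[of ?d] by linarith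
      have "norm ((exp (?ev * of_real h) - 1 - ?ev * of_real h) * ?Y x) \<le> (e / (2 * (B + 1)) * h) * B"
        unfolding norm_mult using elim B x e by (intro mult_mono) auto
      also have "\<dots> \<le> e / 2 * h"
      proof -
        have "B / (B + 1) \<le> 1" using B by simp
        then have "(e / 2 * h) * (B / (B + 1)) \<le> (e / 2 * h) * 1" using e elim by (intro mult_left_mono) auto
        then show ?thesis by (simp add: field_simps)
      qed
      finally have r: "norm ((exp (?ev * of_real h) - 1 - ?ev * of_real h) * ?Y x) \<le> e / 2 * h" .
      have "ctrans h ?Y x - exp (?ev * of_real h) * ?Y x = ?d - (exp (?ev * of_real h) - 1 - ?ev * of_real h) * ?Y x"
        by (simp add: algebra_simps)
      then have "norm (ctrans h ?Y x - exp (?ev * of_real h) * ?Y x)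
          \<le> norm ?d + norm ((exp (?ev * of_real h) - 1 - ?ev * of_real h) * ?Y x)"
        by (simp only: norm_triangle_ineq4)
      then show "norm (ctrans h ?Y x - exp (?ev * of_real h) * ?Y x) \<le> e * h"
        using d r by linarith
    qed
  qed
qed

text \<open>Divide \<open>[0, t]\<close> into \<open>n\<close> steps of length \<open>h\<close>. The factors \<open>exp (eigenvalue * h)\<close> have modulus at most
  \<open>1\<close> and the semigroup consists of contractions, so the errors of the single steps, each small compared
  with \<open>h\<close>, just add up to something small compared with \<open>t\<close>.\<close>
lemma ctrans_sph_harm:
  assumes m: "m \<in> {- int l..int l}" and x: "x \<in> S2" and t: "0 \<le> t"
  shows "ctrans t (sph_harm l m) x = exp (eigenvalue \<mu> l m * of_real t) * sph_harm l m x"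
proof -
  let ?Y = "sph_harm l m" and ?ev = "eigenvalue \<mu> l m"
  have cY: "continuous_on S2 ?Y" by (rule continuous_on_sph_harm[OF m])
  \<comment> \<open>induction over the number of steps of length \<open>h\<close>\<close>
  have steps: "norm (ctrans (real k * h) ?Y x - exp (?ev * of_real (real k * h)) * ?Y x) \<le> real k * (e * h)"
    if h: "0 \<le> h" and e: "\<forall>x\<in>S2. norm (ctrans h ?Y x - exp (?ev * of_real h) * ?Y x) \<le> e * h" for h e k
  proof (induction k)
    case 0
    interpret prob_space "P x" by (rule prob) fact
    have "ctrans 0 ?Y x = (\<integral>\<omega>. ?Y x \<partial>P x)"
      unfolding ctrans_def using start[OF x] continuous_W_measurable[OF x _ cY, of 0]
      by (intro integral_cong_AE) (auto elim!: eventually_mono)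
    then show ?case by (simp add: prob_space)
  next
    case (Suc k)
    interpret prob_space "P x" by (rule prob) fact
    let ?s = "real k * h"
    have s: "0 \<le> ?s" using h by simp
    have "ctrans (?s + h) ?Y x - exp (?ev * of_real h) * ctrans ?s ?Y x
       = (\<integral>\<omega>. ctrans h ?Y (W ?s \<omega>) - exp (?ev * of_real h) * ?Y (W ?s \<omega>) \<partial>P x)"
      unfolding ctrans_semigroup[OF x s h cY]
      using continuous_W_integrable[OF x s continuous_ctrans[OF h cY]] continuous_W_integrable[OF x s cY]
      by (simp add: ctrans_def)
    also have "norm \<dots> \<le> (\<integral>\<omega>. e * h \<partial>P x)"
      by (rule order_trans[OF integral_norm_bound], rule integral_mono)
         (use e W_in_S2[OF x s] continuous_W_integrable[OF x s continuous_ctrans[OF h cY]] continuous_W_integrable[OF x s cY] in auto)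
    finally have 1: "norm (ctrans (?s + h) ?Y x - exp (?ev * of_real h) * ctrans ?s ?Y x) \<le> e * h"
      by (simp add: prob_space)
    have 2: "norm (exp (?ev * of_real h) * (ctrans ?s ?Y x - exp (?ev * of_real ?s) * ?Y x)) \<le> 1 * (real k * (e * h))"
      unfolding norm_mult using Suc.IH norm_exp_eigenvalue_le_1[OF h] by (intro mult_mono) auto
    have ex: "exp (?ev * of_real (?s + h)) = exp (?ev * of_real h) * exp (?ev * of_real ?s)"
      unfolding mult_exp_exp by (simp add: algebra_simps)
    have "ctrans (?s + h) ?Y x - exp (?ev * of_real (?s + h)) * ?Y x
       = (ctrans (?s + h) ?Y x - exp (?ev * of_real h) * ctrans ?s ?Y x)
         + exp (?ev * of_real h) * (ctrans ?s ?Y x - exp (?ev * of_real ?s) * ?Y x)"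
      unfolding ex by (simp add: algebra_simps)
    then have "norm (ctrans (?s + h) ?Y x - exp (?ev * of_real (?s + h)) * ?Y x) \<le> e * h + 1 * (real k * (e * h))"
      using norm_triangle_mono[OF 1 2] by (simp only:)
    moreover have "?s + h = real (Suc k) * h" by (simp add: algebra_simps)
    ultimately show ?case by (simp add: algebra_simps)
  qed
  have "norm (ctrans t ?Y x - exp (?ev * of_real t) * ?Y x) \<le> 0 + e" if "e > 0" for e
  proof -
    have e': "e / (t + 1) > 0" using that t by simp
    from sph_harm_infinitesimal[OF m e'] obtain d where d: "d > 0"
      "\<And>h. 0 < h \<Longrightarrow> h < d \<Longrightarrow> \<forall>x\<in>S2. norm (ctrans h ?Y x - exp (?ev * of_real h) * ?Y x) \<le> e / (t + 1) * h"
      unfolding eventually_at_right_field by auto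
    show ?thesis
    proof (cases "t = 0")
      case True
      then show ?thesis using steps[of 0 0 0] d(2)[of "d/2"] d(1) \<open>e > 0\<close> by (simp add: steps[of "d/2" "e / (t + 1)" 0, simplified])
    next
      case False
      then have tpos: "t > 0" using t by simp
      obtain n where n: "inverse (real (Suc n)) < d / t" using reals_Archimedean[of "d / t"] d tpos by auto
      define h where "h = t / real (Suc n)"
      have h: "0 < h" "h < d"
        using n tpos by (simp_all add: h_def field_simps)
      have nh: "real (Suc n) * h = t" by (simp add: h_def)
      have "norm (ctrans (real (Suc n) * h) ?Y x - exp (?ev * of_real (real (Suc n) * h)) * ?Y x) \<le> real (Suc n) * (e / (t + 1) * h)"
        by (rule steps[OF _ d(2)[OF h]]) (use h in simp)
      also have "real (Suc n) * (e / (t + 1) * h) = e / (t + 1) * t"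
        using nh by (simp add: mult.left_commute)
      also have "\<dots> \<le> e" using \<open>e > 0\<close> tpos by (simp add: field_simps)
      finally show ?thesis unfolding nh by simp
    qed
  qed
  then have "norm (ctrans t ?Y x - exp (?ev * of_real t) * ?Y x) \<le> 0" by (rule field_le_epsilon)
  then show ?thesis by simp
qed

end

section \<open>The time-changed process\<close>

locale time_changed_diffusion = sphere_diffusion +
  fixes S :: "real \<Rightarrow> 'a \<Rightarrow> real" and \<Phi> :: "real \<Rightarrow> real" and x :: "real^3"
  assumes x: "x \<in> S2"
    and subord: "unbounded_subordinator (P x) S \<Phi>"
    and indep: "indep_processes (P x) W S"
begin

sublocale unbounded_subordinator "P x" S \<Phi> by (rule subord)

abbreviation "L \<equiv> inv_sub S"

text \<open>The time change is discretised from below to finitely many values: multiples of \<open>1 / (n + 1)\<close>, cut off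
  at \<open>n + 1\<close>. Conditioning on the discretised time is then a finite sum.\<close>
definition grid :: "nat \<Rightarrow> real \<Rightarrow> 'a \<Rightarrow> nat" where
  "grid n t \<omega> = min (nat \<lfloor>real (Suc n) * L t \<omega>\<rfloor>) (Suc n * Suc n)"

definition approx_L :: "nat \<Rightarrow> real \<Rightarrow> 'a \<Rightarrow> real" where
  "approx_L n t \<omega> = real (grid n t \<omega>) / real (Suc n)"

lemma approx_L_nonneg: "0 \<le> approx_L n t \<omega>"
  by (simp add: approx_L_def)

lemma approx_L_tendsto: "(\<lambda>n. approx_L n t \<omega>) \<longlonglongrightarrow> L t \<omega>"
proof -
  have L0: "0 \<le> L t \<omega>" by (rule inv_sub_nonneg)
  obtain N where N: "L t \<omega> \<le> real N" using real_arch_simple by blast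
  have bound: "\<bar>approx_L n t \<omega> - L t \<omega>\<bar> \<le> inverse (real (Suc n))" if n: "n \<ge> N" for n
  proof -
    define y where "y = real (Suc n) * L t \<omega>"
    have y0: "0 \<le> y" using L0 by (simp add: y_def)
    have "L t \<omega> \<le> real (Suc n)" using N n by simp
    then have "y \<le> real (Suc n * Suc n)" unfolding y_def of_nat_mult by (intro mult_left_mono) auto
    then have "nat \<lfloor>y\<rfloor> \<le> Suc n * Suc n" by (metis floor_mono floor_of_nat nat_int nat_mono)
    then have g: "grid n t \<omega> = nat \<lfloor>y\<rfloor>" unfolding grid_def y_def[symmetric] by (rule min_absorb1)
    have fl: "real (nat \<lfloor>y\<rfloor>) \<le> y" "y \<le> real (nat \<lfloor>y\<rfloor>) + 1"
    proof -
      have "real (nat \<lfloor>y\<rfloor>) = of_int \<lfloor>y\<rfloor>" using y0 by simp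
      then show "real (nat \<lfloor>y\<rfloor>) \<le> y" "y \<le> real (nat \<lfloor>y\<rfloor>) + 1"
        using of_int_floor_le[of y] real_of_int_floor_add_one_gt[of y] by linarith+
    qed
    have "approx_L n t \<omega> - L t \<omega> = (real (nat \<lfloor>y\<rfloor>) - y) / real (Suc n)"
      unfolding approx_L_def g by (simp add: y_def diff_divide_distrib)
    then have "\<bar>approx_L n t \<omega> - L t \<omega>\<bar> = \<bar>real (nat \<lfloor>y\<rfloor>) - y\<bar> / real (Suc n)" by (simp add: abs_divide)
    also have "\<bar>real (nat \<lfloor>y\<rfloor>) - y\<bar> / real (Suc n) \<le> 1 / real (Suc n)"
    proof (rule divide_right_mono)
      show "\<bar>real (nat \<lfloor>y\<rfloor>) - y\<bar> \<le> 1" using fl by linarith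
    qed simp
    finally show ?thesis by (simp add: inverse_eq_divide)
  qed
  have "(\<lambda>n. approx_L n t \<omega> - L t \<omega>) \<longlonglongrightarrow> 0"
    by (rule Lim_null_comparison[OF _ LIMSEQ_inverse_real_of_nat])
       (use bound in \<open>auto simp: eventually_sequentially\<close>)
  then show ?thesis by (simp add: LIM_zero_iff)
qed

lemma W_approx_tendsto:
  assumes "\<omega> \<in> space (P x)"
  shows "(\<lambda>n. W (approx_L n t \<omega>) \<omega>) \<longlonglongrightarrow> W (L t \<omega>) \<omega>"
  by (rule continuous_on_tendsto_compose[OF continuous_paths[OF x assms] approx_L_tendsto])
     (auto simp: inv_sub_nonneg approx_L_nonneg)

definition sigma_S :: "'a measure" where
  "sigma_S = vimage_algebra (space (P x)) (\<lambda>\<omega>. \<lambda>t\<in>{0..}. S t \<omega>) (\<Pi>\<^sub>M t\<in>{0..}. borel)"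

definition sigma_W :: "'a measure" where
  "sigma_W = vimage_algebra (space (P x)) (\<lambda>\<omega>. \<lambda>t\<in>{0..}. W t \<omega>) (\<Pi>\<^sub>M t\<in>{0..}. S2_borel)"

lemma S_sigma_S: "0 \<le> t \<Longrightarrow> S t \<in> borel_measurable sigma_S"
proof -
  assume t: "0 \<le> t"
  have "(\<lambda>\<omega>. \<lambda>t\<in>{0..}. S t \<omega>) \<in> sigma_S \<rightarrow>\<^sub>M (\<Pi>\<^sub>M t\<in>{0..}. borel)"
    unfolding sigma_S_def by (rule measurable_vimage_algebra1) (auto simp: space_PiM)
  from measurable_compose[OF this measurable_component_singleton[of t]] t
  show ?thesis by simp
qed

lemma W_sigma_W: "0 \<le> t \<Longrightarrow> W t \<in> sigma_W \<rightarrow>\<^sub>M S2_borel"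
proof -
  assume t: "0 \<le> t"
  have "(\<lambda>\<omega>. \<lambda>t\<in>{0..}. W t \<omega>) \<in> sigma_W \<rightarrow>\<^sub>M (\<Pi>\<^sub>M t\<in>{0..}. S2_borel)"
    unfolding sigma_W_def
    by (rule measurable_vimage_algebra1) (use W_in_S2[OF x] in \<open>auto simp: space_PiM space_restrict_space\<close>)
  from measurable_compose[OF this measurable_component_singleton[of t]] t
  show ?thesis by simp
qed

lemma space_sigma [simp]: "space sigma_S = space (P x)" "space sigma_W = space (P x)"
  by (simp_all add: sigma_S_def sigma_W_def)

lemma indep_sigma: "indep_set (sets sigma_W) (sets sigma_S)"
  using indep unfolding indep_processes_def sigma_S_def sigma_W_def .

lemma grid_measurable:
  assumes "L t \<in> borel_measurable N"
  shows "grid n t \<in> N \<rightarrow>\<^sub>M count_space UNIV"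
  unfolding grid_def[abs_def] using assms by measurable

lemma L_sigma_S: "L t \<in> borel_measurable sigma_S"
  by (rule inv_sub_measurable) (auto intro: S_sigma_S)

lemma W_approx_measurable: "(\<lambda>\<omega>. W (approx_L n t \<omega>) \<omega>) \<in> P x \<rightarrow>\<^sub>M S2_borel"
  unfolding approx_L_def
  by (rule measurable_compose_countable[where f="\<lambda>k \<omega>. W (real k / real (Suc n)) \<omega>"])
     (auto intro!: measurable x grid_measurable inv_sub_rv)

lemma time_changed_eq: "time_changed W S t = (\<lambda>\<omega>. W (L t \<omega>) \<omega>)"
  by (simp add: fun_eq_iff time_changed_def)

text \<open>By continuity of the paths the time-changed process is a limit of processes at discretised times.\<close>
lemma time_changed_measurable: "time_changed W S t \<in> P x \<rightarrow>\<^sub>M S2_borel"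
proof (rule measurable_restrict_space2)
  show "time_changed W S t \<in> space (P x) \<rightarrow> S2"
    using W_in_S2[OF x] inv_sub_nonneg unfolding time_changed_eq by auto
  show "time_changed W S t \<in> borel_measurable (P x)"
  proof (rule borel_measurable_LIMSEQ_metric)
    show "(\<lambda>\<omega>. W (approx_L n t \<omega>) \<omega>) \<in> borel_measurable (P x)" for n
      using W_approx_measurable[of n t] by (simp add: measurable_restrict_space2_iff)
    show "(\<lambda>n. W (approx_L n t \<omega>) \<omega>) \<longlonglongrightarrow> time_changed W S t \<omega>" if "\<omega> \<in> space (P x)" for \<omega>
      unfolding time_changed_eq by (rule W_approx_tendsto[OF that])
  qed
qed

lemma indicator_integrable: "B \<in> events \<Longrightarrow> integrable (P x) (\<lambda>\<omega>. indicator B \<omega> :: complex)"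
  by (rule integrable_const_bound[of _ 1]) (auto simp: indicator_def)

lemma expectation_independent:
  fixes f :: "real^3 \<Rightarrow> complex"
  assumes f: "continuous_on S2 f" and u: "0 \<le> u" and B: "B \<in> sets sigma_S"
  shows "(\<integral>\<omega>. f (W u \<omega>) * indicator B \<omega> \<partial>P x) = (\<integral>\<omega>. f (W u \<omega>) \<partial>P x) * (\<integral>\<omega>. indicator B \<omega> \<partial>P x)"
proof -
  have BM: "B \<in> events" using indep_sigma B unfolding indep_sets2_eq by blast
  have fW: "(\<lambda>\<omega>. f (W u \<omega>)) \<in> borel_measurable sigma_W"
    by (rule measurable_compose[OF W_sigma_W[OF u]]) (rule borel_measurable_continuous_on_restrict[OF f])
  have ind: "(\<lambda>\<omega>. indicator B \<omega> :: complex) \<in> borel_measurable sigma_S" using B by measurable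
  have "indep_var borel (\<lambda>\<omega>. f (W u \<omega>)) borel (\<lambda>\<omega>. indicator B \<omega> :: complex)"
    unfolding indep_var_eq
  proof (intro conjI)
    show "random_variable borel (\<lambda>\<omega>. f (W u \<omega>))" by (rule continuous_W_measurable[OF x u f])
    show "random_variable borel (\<lambda>\<omega>. indicator B \<omega> :: complex)" using BM by measurable
    have 1: "sigma_sets (space (P x)) {(\<lambda>\<omega>. f (W u \<omega>)) -` A \<inter> space (P x) | A. A \<in> sets borel} \<subseteq> sets sigma_W"
    proof -
      have "{(\<lambda>\<omega>. f (W u \<omega>)) -` A \<inter> space (P x) | A. A \<in> sets borel} \<subseteq> sets sigma_W"
        using measurable_sets[OF fW] by auto
      from sets.sigma_sets_subset[OF this] show ?thesis by simp
    qed
    have 2: "sigma_sets (space (P x)) {(\<lambda>\<omega>. indicator B \<omega> :: complex) -` A \<inter> space (P x) | A. A \<in> sets borel} \<subseteq> sets sigma_S"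
    proof -
      have "{(\<lambda>\<omega>. indicator B \<omega> :: complex) -` A \<inter> space (P x) | A. A \<in> sets borel} \<subseteq> sets sigma_S"
        using measurable_sets[OF ind] by auto
      from sets.sigma_sets_subset[OF this] show ?thesis by simp
    qed
    show "indep_set (sigma_sets (space (P x)) {(\<lambda>\<omega>. f (W u \<omega>)) -` A \<inter> space (P x) | A. A \<in> sets borel})
        (sigma_sets (space (P x)) {(\<lambda>\<omega>. indicator B \<omega> :: complex) -` A \<inter> space (P x) | A. A \<in> sets borel})"
      using indep_sigma 1 2 unfolding indep_sets2_eq by blast
  qed
  then show ?thesis
    by (rule indep_var_lebesgue_integral[OF _ continuous_W_integrable[OF x u f] indicator_integrable[OF BM]])
qed

text \<open>For the discretised time the expectation splits into finitely many products by independence; the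
  continuity of the paths and dominated convergence remove the discretisation.\<close>
lemma expectation_time_changed_sph_harm:
  assumes m: "m \<in> {- int l..int l}"
  shows "(\<integral>\<omega>. sph_harm l m (time_changed W S t \<omega>) \<partial>P x) = e_fun (P x) S t (eigenvalue \<mu> l m) * sph_harm l m x"
proof -
  let ?Y = "sph_harm l m" and ?ev = "eigenvalue \<mu> l m"
  have cY: "continuous_on S2 ?Y" by (rule continuous_on_sph_harm[OF m])
  obtain B where B: "\<And>x. x \<in> S2 \<Longrightarrow> norm (?Y x) \<le> B" using continuous_S2_bounded[OF cY] by metis
  have Ymeas: "?Y \<in> borel_measurable S2_borel" by (rule borel_measurable_continuous_on_restrict[OF cY])
  have discrete: "(\<integral>\<omega>. ?Y (W (approx_L n t \<omega>) \<omega>) \<partial>P x) = (\<integral>\<omega>. exp (?ev * of_real (approx_L n t \<omega>)) \<partial>P x) * ?Y x" for n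
  proof -
    define N where "N = Suc n * Suc n"
    let ?u = "\<lambda>k. real k / real (Suc n)"
    define B where "B k = {\<omega> \<in> space (P x). grid n t \<omega> = k}" for k
    have Bs: "B k \<in> sets sigma_S" for k
    proof -
      have "grid n t -` {k} \<inter> space sigma_S \<in> sets sigma_S"
        using grid_measurable[OF L_sigma_S] by (rule measurable_sets) simp
      moreover have "grid n t -` {k} \<inter> space sigma_S = B k" by (auto simp: B_def)
      ultimately show ?thesis by simp
    qed
    have Bm: "B k \<in> events" for k using indep_sigma Bs[of k] unfolding indep_sets2_eq by blast
    \<comment> \<open>the discretised time takes the value \<open>?u k\<close> exactly on \<open>B k\<close>\<close>
    have decomp: "g (approx_L n t \<omega>) = (\<Sum>k\<le>N. g (?u k) * indicator (B k) \<omega>)"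
      if "\<omega> \<in> space (P x)" for g :: "real \<Rightarrow> complex" and \<omega>
    proof -
      have "(\<Sum>k\<le>N. g (?u k) * indicator (B k) \<omega>) = (\<Sum>k\<le>N. if k = grid n t \<omega> then g (?u k) else 0)"
        using that by (intro sum.cong refl) (auto simp: B_def indicator_def)
      also have "\<dots> = g (?u (grid n t \<omega>))"
        by (subst sum.delta) (auto simp: grid_def N_def)
      finally show ?thesis by (simp add: approx_L_def)
    qed
    have "(\<integral>\<omega>. ?Y (W (approx_L n t \<omega>) \<omega>) \<partial>P x) = (\<integral>\<omega>. (\<Sum>k\<le>N. ?Y (W (?u k) \<omega>) * indicator (B k) \<omega>) \<partial>P x)"
    proof (rule Bochner_Integration.integral_cong[OF refl])
      fix \<omega> assume "\<omega> \<in> space (P x)"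
      then show "?Y (W (approx_L n t \<omega>) \<omega>) = (\<Sum>k\<le>N. ?Y (W (?u k) \<omega>) * indicator (B k) \<omega>)"
        by (rule decomp[of \<omega> "\<lambda>u. ?Y (W u \<omega>)"])
    qed
    also have "\<dots> = (\<Sum>k\<le>N. (\<integral>\<omega>. ?Y (W (?u k) \<omega>) * indicator (B k) \<omega> \<partial>P x))"
    proof (rule Bochner_Integration.integral_sum)
      fix k
      have "integrable (P x) (\<lambda>\<omega>. ?Y (W (?u k) \<omega>))" by (rule continuous_W_integrable[OF x _ cY]) simp
      from integrable_mult_indicator[OF Bm this]
      show "integrable (P x) (\<lambda>\<omega>. ?Y (W (?u k) \<omega>) * indicator (B k) \<omega>)"
        by (rule Bochner_Integration.integrable_cong[OF refl, THEN iffD1, rotated]) (auto simp: indicator_def)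
    qed
    also have "\<dots> = (\<Sum>k\<le>N. exp (?ev * of_real (?u k)) * ?Y x * (\<integral>\<omega>. indicator (B k) \<omega> \<partial>P x))"
      using expectation_independent[OF cY _ Bs] ctrans_sph_harm[OF m x]
      by (intro sum.cong refl) (simp add: ctrans_def)
    also have "\<dots> = (\<Sum>k\<le>N. (\<integral>\<omega>. exp (?ev * of_real (?u k)) * indicator (B k) \<omega> \<partial>P x)) * ?Y x"
      unfolding integral_mult_right_zero sum_distrib_right by (simp only: mult_ac)
    also have "(\<Sum>k\<le>N. (\<integral>\<omega>. exp (?ev * of_real (?u k)) * indicator (B k) \<omega> \<partial>P x))
      = (\<integral>\<omega>. (\<Sum>k\<le>N. exp (?ev * of_real (?u k)) * indicator (B k) \<omega>) \<partial>P x)"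
      by (rule Bochner_Integration.integral_sum[symmetric])
         (intro integrable_mult_right indicator_integrable Bm)
    also have "\<dots> = (\<integral>\<omega>. exp (?ev * of_real (approx_L n t \<omega>)) \<partial>P x)"
    proof (rule Bochner_Integration.integral_cong[OF refl])
      fix \<omega> assume "\<omega> \<in> space (P x)"
      then show "(\<Sum>k\<le>N. exp (?ev * of_real (?u k)) * indicator (B k) \<omega>) = exp (?ev * of_real (approx_L n t \<omega>))"
        by (rule decomp[symmetric, of \<omega> "\<lambda>u. exp (?ev * of_real u)"])
    qed
    finally show ?thesis .
  qed
  have lim1: "(\<lambda>n. \<integral>\<omega>. ?Y (W (approx_L n t \<omega>) \<omega>) \<partial>P x) \<longlonglongrightarrow> (\<integral>\<omega>. ?Y (time_changed W S t \<omega>) \<partial>P x)"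
  proof (rule integral_dominated_convergence[where w="\<lambda>_. B"])
    show "(\<lambda>\<omega>. ?Y (time_changed W S t \<omega>)) \<in> borel_measurable (P x)"
      by (rule measurable_compose[OF time_changed_measurable Ymeas])
    show "(\<lambda>\<omega>. ?Y (W (approx_L n t \<omega>) \<omega>)) \<in> borel_measurable (P x)" for n
      by (rule measurable_compose[OF W_approx_measurable Ymeas])
    show "AE \<omega> in P x. (\<lambda>n. ?Y (W (approx_L n t \<omega>) \<omega>)) \<longlonglongrightarrow> ?Y (time_changed W S t \<omega>)"
    proof (rule AE_I2)
      fix \<omega> assume w: "\<omega> \<in> space (P x)"
      show "(\<lambda>n. ?Y (W (approx_L n t \<omega>) \<omega>)) \<longlonglongrightarrow> ?Y (time_changed W S t \<omega>)"
        unfolding time_changed_eq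
      proof (rule continuous_on_tendsto_compose[OF cY W_approx_tendsto[OF w]])
        show "W (L t \<omega>) \<omega> \<in> S2" by (rule W_in_S2[OF x inv_sub_nonneg w])
        show "\<forall>\<^sub>F n in sequentially. W (approx_L n t \<omega>) \<omega> \<in> S2"
          by (intro always_eventually allI W_in_S2[OF x approx_L_nonneg w])
      qed
    qed
    show "AE \<omega> in P x. norm (?Y (W (approx_L n t \<omega>) \<omega>)) \<le> B" for n
      by (intro AE_I2 B W_in_S2[OF x] approx_L_nonneg)
  qed simp
  have "continuous_on UNIV (\<lambda>u::real. exp (?ev * of_real u))" by (intro continuous_intros)
  then have em: "(\<lambda>u::real. exp (?ev * of_real u)) \<in> borel_measurable borel" by (rule borel_measurable_continuous_onI)
  have am: "approx_L n t \<in> borel_measurable (P x)" for n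
    using grid_measurable[OF inv_sub_rv, of n t] unfolding approx_L_def[abs_def] by measurable
  have lim2: "(\<lambda>n. \<integral>\<omega>. exp (?ev * of_real (approx_L n t \<omega>)) \<partial>P x) \<longlonglongrightarrow> e_fun (P x) S t ?ev"
    unfolding e_fun_def
  proof (rule integral_dominated_convergence[where w="\<lambda>_. 1"])
    show "(\<lambda>\<omega>. exp (?ev * of_real (L t \<omega>))) \<in> borel_measurable (P x)"
      by (rule measurable_compose[OF inv_sub_rv em])
    show "(\<lambda>\<omega>. exp (?ev * of_real (approx_L n t \<omega>))) \<in> borel_measurable (P x)" for n
      by (rule measurable_compose[OF am em])
    show "AE \<omega> in P x. (\<lambda>n. exp (?ev * of_real (approx_L n t \<omega>))) \<longlonglongrightarrow> exp (?ev * of_real (L t \<omega>))"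
      by (intro AE_I2 tendsto_intros approx_L_tendsto)
    show "AE \<omega> in P x. norm (exp (?ev * of_real (approx_L n t \<omega>))) \<le> 1" for n
      by (intro AE_I2 norm_exp_eigenvalue_le_1 approx_L_nonneg)
  qed simp
  show ?thesis
    by (rule LIMSEQ_unique[OF lim1]) (unfold discrete, intro tendsto_mult lim2 tendsto_const)
qed

lemma time_changed_initial_limit:
  fixes f :: "real^3 \<Rightarrow> real"
  assumes f: "continuous_on S2 f"
  shows "((\<lambda>t. \<integral>\<omega>. f (time_changed W S t \<omega>) \<partial>P x) \<longlongrightarrow> f x) (at_right 0)"
  unfolding tendsto_at_iff_sequentially o_def
proof (intro allI impI)
  fix X :: "nat \<Rightarrow> real" assume X: "\<forall>i. X i \<in> {0<..} - {0}" "X \<longlonglongrightarrow> 0"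
  obtain B where B: "\<And>x. x \<in> S2 \<Longrightarrow> norm (f x) \<le> B" using continuous_S2_bounded[OF f] by metis
  have fm: "f \<in> borel_measurable S2_borel" by (rule borel_measurable_continuous_on_restrict[OF f])
  have "(\<lambda>n. \<integral>\<omega>. f (time_changed W S (X n) \<omega>) \<partial>P x) \<longlonglongrightarrow> (\<integral>\<omega>. f x \<partial>P x)"
  proof (rule integral_dominated_convergence[where w="\<lambda>_. B"])
    show "(\<lambda>\<omega>. f (time_changed W S (X n) \<omega>)) \<in> borel_measurable (P x)" for n
      by (rule measurable_compose[OF time_changed_measurable fm])
    show "AE \<omega> in P x. norm (f (time_changed W S (X n) \<omega>)) \<le> B" for n
      unfolding time_changed_eq by (intro AE_I2 B W_in_S2[OF x] inv_sub_nonneg)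
    show "AE \<omega> in P x. (\<lambda>n. f (time_changed W S (X n) \<omega>)) \<longlonglongrightarrow> f x"
      using AE_inv_sub_tendsto_0 start[OF x] AE_space
    proof eventually_elim
      case (elim \<omega>)
      have "filterlim X (at_right 0) sequentially"
        using X unfolding filterlim_at by (auto intro!: always_eventually simp: order_less_imp_not_eq2)
      then have "(\<lambda>n. L (X n) \<omega>) \<longlonglongrightarrow> 0" by (rule filterlim_compose[OF elim(1)])
      then have "(\<lambda>n. W (L (X n) \<omega>) \<omega>) \<longlonglongrightarrow> W 0 \<omega>"
        by (rule continuous_on_tendsto_compose[OF continuous_paths[OF x elim(3)]]) (auto simp: inv_sub_nonneg)
      then have "(\<lambda>n. f (W (L (X n) \<omega>) \<omega>)) \<longlonglongrightarrow> f (W 0 \<omega>)"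
        by (rule continuous_on_tendsto_compose[OF f])
           (use W_in_S2[OF x _ elim(3)] inv_sub_nonneg in auto)
      then show ?case using elim(2) by (simp add: time_changed_eq)
    qed
  qed auto
  then show "(\<lambda>n. \<integral>\<omega>. f (time_changed W S (X n) \<omega>) \<partial>P x) \<longlonglongrightarrow> f x" by (simp add: prob_space)
qed

end

section \<open>Identification of a measure by its spherical harmonic coefficients\<close>

lemma closed_indicator_limit:
  fixes C :: "'a::metric_space set"
  assumes "closed C" "C \<noteq> {}"
  shows "(\<lambda>n. max 0 (1 - real n * infdist y C)) \<longlonglongrightarrow> indicator C y"
proof (cases "y \<in> C")
  case True
  then have "infdist y C = 0" using assms in_closed_iff_infdist_zero by blast
  then show ?thesis using True by simp
next
  case False
  then have pos: "infdist y C > 0"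
    using assms in_closed_iff_infdist_zero[of C y] infdist_nonneg[of y C] by linarith
  obtain N where N: "1 < real N * infdist y C" using reals_Archimedean3[OF pos] by blast
  have "max 0 (1 - real n * infdist y C) = 0" if "n \<ge> N" for n
  proof -
    have "real N * infdist y C \<le> real n * infdist y C" using that pos by (intro mult_right_mono) auto
    then show ?thesis using N by simp
  qed
  then have "(\<lambda>n. max 0 (1 - real n * infdist y C)) \<longlonglongrightarrow> 0"
    by (intro tendsto_eventually) (auto simp: eventually_sequentially)
  then show ?thesis using False by simp
qed

text \<open>The function \<open>p\<close> is not known to be nonnegative here, so that it does not define a measure whose
  uniqueness could be invoked. Equality holds for closed sets, whose indicator functions are bounded
  limits of continuous functions, and extends by a Dynkin argument.\<close>
lemma measure_eq_density_of_continuous: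
  fixes \<rho> :: "(real^3) measure" and p :: "real^3 \<Rightarrow> real"
  assumes "finite_measure \<rho>" and sets: "sets \<rho> = sets S2_borel" and p: "integrable surf p"
    and eq: "\<And>f::real^3 \<Rightarrow> real. continuous_on S2 f \<Longrightarrow> (\<integral>y. f y \<partial>\<rho>) = (\<integral>y. p y * f y \<partial>surf)"
    and A: "A \<in> sets borel"
  shows "measure \<rho> (A \<inter> S2) = (LINT y:A \<inter> S2|surf. p y)"
proof -
  interpret \<rho>: finite_measure \<rho> by fact
  have space: "space \<rho> = S2" using sets_eq_imp_space_eq[OF sets] by (simp add: space_restrict_space)
  have in_sets: "B \<inter> S2 \<in> sets \<rho>" "B \<inter> S2 \<in> sets surf" if "B \<in> sets borel" for B
    using that by (auto simp: sets sets_restrict_space)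
  have sint: "set_integrable surf (B \<inter> S2) p" if "B \<in> sets borel" for B
    unfolding set_integrable_def by (rule integrable_mult_indicator[OF in_sets(2)[OF that] p])
  have closed: "measure \<rho> (C \<inter> S2) = (LINT y:C \<inter> S2|surf. p y)" if C: "closed C" for C
  proof (cases "C \<inter> S2 = {}")
    case False
    define K where "K = C \<inter> S2"
    have K: "closed K" "K \<noteq> {}" "K \<in> sets \<rho>" using C False in_sets(1)[of C] by (auto simp: K_def)
    let ?f = "\<lambda>n y. max 0 (1 - real n * infdist y K)"
    have cf: "continuous_on S2 (?f n)" for n by (intro continuous_intros)
    have fm: "?f n \<in> borel_measurable S2_borel" for n by (rule continuous_S2_measurable[OF cf])
    have f1: "\<bar>?f n y\<bar> \<le> 1" for n y using infdist_nonneg[of y K] by auto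
    have lim1: "(\<lambda>n. \<integral>y. ?f n y \<partial>\<rho>) \<longlonglongrightarrow> (\<integral>y. indicator K y \<partial>\<rho>)"
    proof (rule integral_dominated_convergence[where w="\<lambda>_. 1"])
      show "(\<lambda>y. indicat_real K y) \<in> borel_measurable \<rho>" using K by simp
      show "(\<lambda>y. ?f n y) \<in> borel_measurable \<rho>" for n using fm[of n] by (simp cong: measurable_cong_sets add: sets)
    qed (use closed_indicator_limit[OF K(1,2)] f1 in auto)
    have lim2: "(\<lambda>n. \<integral>y. p y * ?f n y \<partial>surf) \<longlonglongrightarrow> (\<integral>y. p y * indicator K y \<partial>surf)"
    proof (rule integral_dominated_convergence[where w="\<lambda>y. \<bar>p y\<bar>"])
      have "indicat_real K \<in> borel_measurable surf" using K by (simp add: sets)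
      then show "(\<lambda>y. p y * indicator K y) \<in> borel_measurable surf" using p by measurable
      show "(\<lambda>y. p y * ?f n y) \<in> borel_measurable surf" for n
        using fm[of n] p by (intro borel_measurable_times) (auto cong: measurable_cong_sets)
      show "AE y in surf. (\<lambda>n. p y * ?f n y) \<longlonglongrightarrow> p y * indicator K y"
        by (intro AE_I2 tendsto_mult tendsto_const closed_indicator_limit K)
      show "AE y in surf. norm (p y * ?f n y) \<le> \<bar>p y\<bar>" for n
        using f1 by (intro AE_I2) (auto simp: abs_mult intro: mult_left_le)
    qed (use p in auto)
    have "(\<integral>y. indicator K y \<partial>\<rho>) = (\<integral>y. p y * indicator K y \<partial>surf)"
      using lim1 lim2 unfolding eq[OF cf] by (rule LIMSEQ_unique)
    then show ?thesis using K unfolding K_def[symmetric] set_lebesgue_integral_def by (simp add: mult.commute)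
  qed (simp add: set_lebesgue_integral_def)
  have A': "A \<in> sigma_sets UNIV (Collect closed)"
    using A unfolding borel_eq_closed by (simp add: sets_measure_of)
  have "Int_stable (Collect closed :: (real^3) set set)" by (auto simp: Int_stable_def)
  moreover have "Collect closed \<subseteq> Pow (UNIV :: (real^3) set)" by simp
  ultimately show ?thesis using A'
  proof (induction rule: sigma_sets_induct_disjoint)
    case (basic A)
    then show ?case using closed by simp
  next
    case empty
    then show ?case by (simp add: set_lebesgue_integral_def)
  next
    case (compl A)
    then have A: "A \<in> sets borel" unfolding borel_eq_closed by (simp add: sets_measure_of)
    have split: "(UNIV - A) \<inter> S2 = S2 - A \<inter> S2" by auto
    have "measure \<rho> (S2 - A \<inter> S2) = measure \<rho> S2 - measure \<rho> (A \<inter> S2)"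
      using in_sets(1)[OF A] in_sets(1)[of UNIV] by (intro \<rho>.finite_measure_Diff) auto
    also have "measure \<rho> S2 = (LINT y:S2|surf. p y)" using closed[of UNIV] by simp
    also have "(LINT y:S2|surf. p y) = (LINT y:(S2 - A \<inter> S2) \<union> (A \<inter> S2)|surf. p y)"
      by (rule arg_cong[where f="\<lambda>B. LINT y:B|surf. p y"]) auto
    also have "\<dots> = (LINT y:S2 - A \<inter> S2|surf. p y) + (LINT y:A \<inter> S2|surf. p y)"
      using sint[of "UNIV - A"] sint[OF A] A unfolding split by (intro set_integral_Un) auto
    finally show ?case unfolding split compl.IH by simp
  next
    case (union A)
    then have A: "A i \<in> sets borel" for i unfolding borel_eq_closed by (auto simp: sets_measure_of)
    have dis: "disjoint_family (\<lambda>i. A i \<inter> S2)" using union(1) by (auto simp: disjoint_family_on_def)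
    have "(\<lambda>i. measure \<rho> (A i \<inter> S2)) sums measure \<rho> (\<Union>i. A i \<inter> S2)"
      using in_sets(1)[OF A] dis by (intro \<rho>.finite_measure_UNION) auto
    moreover have "(LINT y:(\<Union>i. A i \<inter> S2)|surf. p y) = (\<Sum>i. (LINT y:A i \<inter> S2|surf. p y))"
    proof (rule lebesgue_integral_countable_add)
      show "set_integrable surf (\<Union>i. A i \<inter> S2) p" using sint[of "\<Union>i. A i"] A by simp
    qed (use in_sets(2)[OF A] dis in \<open>auto simp: disjoint_family_on_def\<close>)
    ultimately show ?case unfolding union.IH by (simp add: sums_iff)
  qed
qed

lemma harm_span_continuous: "harm_span f \<Longrightarrow> continuous_on S2 f"
proof (induction rule: harm_span.induct)
  case (harm m l c)
  then show ?case by (intro continuous_intros continuous_on_sph_harm)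
next
  case (sum f g)
  then show ?case by (intro continuous_intros)
next
  case (on_sphere f g)
  show ?case by (rule continuous_on_eq[OF on_sphere.IH]) (simp add: on_sphere.hyps)
qed

lemma measure_eq_density_of_coefficients:
  fixes \<rho> :: "(real^3) measure" and p :: "real^3 \<Rightarrow> real"
  assumes fin: "finite_measure \<rho>" and sets: "sets \<rho> = sets S2_borel" and p: "integrable surf p"
    and Y: "\<And>l m. m \<in> {- int l..int l} \<Longrightarrow> (\<integral>y. sph_harm l m y \<partial>\<rho>) = (\<integral>y. of_real (p y) * sph_harm l m y \<partial>surf)"
    and f: "continuous_on S2 (f :: real^3 \<Rightarrow> real)"
  shows "(\<integral>y. f y \<partial>\<rho>) = (\<integral>y. p y * f y \<partial>surf)"
proof -
  interpret \<rho>: finite_measure \<rho> by fact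
  have space: "space \<rho> = S2" using sets_eq_imp_space_eq[OF sets] by (simp add: space_restrict_space)
  have int\<rho>: "integrable \<rho> g" if g: "continuous_on S2 g" for g :: "real^3 \<Rightarrow> 'b::{banach, second_countable_topology}"
  proof -
    obtain B where "\<And>x. x \<in> S2 \<Longrightarrow> norm (g x) \<le> B" using continuous_S2_bounded[OF g] by metis
    then show ?thesis
      using continuous_S2_measurable[OF g]
      by (intro \<rho>.integrable_const_bound[of _ B]) (auto simp: space sets cong: measurable_cong_sets intro!: AE_I2)
  qed
  have intp: "integrable surf (\<lambda>y. p y *\<^sub>R g y)" if g: "continuous_on S2 g" for g :: "real^3 \<Rightarrow> 'b::{banach, second_countable_topology}"
  proof -
    obtain B where B: "\<And>x. x \<in> S2 \<Longrightarrow> norm (g x) \<le> B" using continuous_S2_bounded[OF g] by metis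
    have "integrable surf (\<lambda>y. B * p y)" using p by simp
    then show ?thesis
    proof (rule Bochner_Integration.integrable_bound)
      show "(\<lambda>y. p y *\<^sub>R g y) \<in> borel_measurable surf"
        using p continuous_S2_measurable[OF g] by (intro borel_measurable_scaleR) (auto cong: measurable_cong_sets)
      show "AE y in surf. norm (p y *\<^sub>R g y) \<le> norm (B * p y)"
      proof (rule AE_I2)
        fix y assume "y \<in> space surf"
        then have "norm (g y) \<le> \<bar>B\<bar>" using B[of y] by simp
        then have "\<bar>p y\<bar> * norm (g y) \<le> \<bar>p y\<bar> * \<bar>B\<bar>" by (rule mult_left_mono) simp
        then show "norm (p y *\<^sub>R g y) \<le> norm (B * p y)" by (simp add: abs_mult mult.commute)
      qed
    qed
  qed
  have span: "(\<integral>y. h y \<partial>\<rho>) = (\<integral>y. p y *\<^sub>R h y \<partial>surf)" if "harm_span h" for h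
    using that
  proof (induction rule: harm_span.induct)
    case (harm m l c)
    have "(\<integral>y. p y *\<^sub>R (c * sph_harm l m y) \<partial>surf) = (\<integral>y. c * (of_real (p y) * sph_harm l m y) \<partial>surf)"
      by (intro Bochner_Integration.integral_cong) (auto simp: scaleR_conv_of_real)
    then show ?case using Y[OF harm] by simp
  next
    case (sum f g)
    then show ?case
      using int\<rho>[OF harm_span_continuous] intp[OF harm_span_continuous] by (simp add: scaleR_add_right)
  next
    case (on_sphere f g)
    have "(\<integral>y. g y \<partial>\<rho>) = (\<integral>y. f y \<partial>\<rho>)"
      by (intro Bochner_Integration.integral_cong) (auto simp: space on_sphere.hyps)
    moreover have "(\<integral>y. p y *\<^sub>R g y \<partial>surf) = (\<integral>y. p y *\<^sub>R f y \<partial>surf)"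
      by (intro Bochner_Integration.integral_cong) (auto simp: on_sphere.hyps)
    ultimately show ?case using on_sphere.IH by simp
  qed
  define D where "D = measure \<rho> S2 + (\<integral>y. \<bar>p y\<bar> \<partial>surf) + 1"
  have D: "D > 0" unfolding D_def by (intro add_nonneg_pos add_nonneg_nonneg) auto
  have "\<bar>(\<integral>y. f y \<partial>\<rho>) - (\<integral>y. p y * f y \<partial>surf)\<bar> \<le> 0 + e" if e: "e > 0" for e
  proof -
    have "e / D > 0" using e D by simp
    then obtain g where g: "harm_span (\<lambda>x. of_real (g x))" "\<And>x. x \<in> S2 \<Longrightarrow> \<bar>f x - g x\<bar> < e / D"
      using harm_span_dense[OF f] by metis
    have cg: "continuous_on S2 g"
    proof -
      have "continuous_on S2 (\<lambda>x. Re (of_real (g x)))"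
        by (intro continuous_intros harm_span_continuous[OF g(1)])
      then show ?thesis by simp
    qed
    have "complex_of_real (\<integral>y. g y \<partial>\<rho>) = of_real (\<integral>y. p y * g y \<partial>surf)"
      using span[OF g(1)] by (simp add: scaleR_conv_of_real of_real_mult[symmetric] del: of_real_mult)
    then have geq: "(\<integral>y. g y \<partial>\<rho>) = (\<integral>y. p y * g y \<partial>surf)" by (simp only: of_real_eq_iff)
    have "\<bar>(\<integral>y. f y \<partial>\<rho>) - (\<integral>y. g y \<partial>\<rho>)\<bar> = \<bar>\<integral>y. f y - g y \<partial>\<rho>\<bar>"
      using int\<rho>[OF f] int\<rho>[OF cg] by simp
    also have "\<dots> \<le> (\<integral>y. \<bar>f y - g y\<bar> \<partial>\<rho>)" by (rule integral_abs_bound)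
    also have "\<dots> \<le> (\<integral>y. e / D \<partial>\<rho>)"
      using g(2) by (intro integral_mono integrable_abs Bochner_Integration.integrable_diff int\<rho> f cg) (auto simp: space intro: less_imp_le)
    also have "\<dots> = measure \<rho> S2 * (e / D)" by (simp add: space)
    finally have 1: "\<bar>(\<integral>y. f y \<partial>\<rho>) - (\<integral>y. g y \<partial>\<rho>)\<bar> \<le> measure \<rho> S2 * (e / D)" .
    have "\<bar>(\<integral>y. p y * f y \<partial>surf) - (\<integral>y. p y * g y \<partial>surf)\<bar> = \<bar>\<integral>y. p y * f y - p y * g y \<partial>surf\<bar>"
      using intp[OF f] intp[OF cg] by simp
    also have "\<dots> \<le> (\<integral>y. \<bar>p y * f y - p y * g y\<bar> \<partial>surf)" by (rule integral_abs_bound)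
    also have "\<dots> \<le> (\<integral>y. \<bar>p y\<bar> * (e / D) \<partial>surf)"
    proof (rule integral_mono)
      show "integrable surf (\<lambda>y. \<bar>p y * f y - p y * g y\<bar>)"
        using intp[OF f] intp[OF cg] by simp
      show "integrable surf (\<lambda>y. \<bar>p y\<bar> * (e / D))" using p by simp
      fix y assume "y \<in> space surf"
      then have "\<bar>f y - g y\<bar> \<le> e / D" using g(2)[of y] by simp
      then show "\<bar>p y * f y - p y * g y\<bar> \<le> \<bar>p y\<bar> * (e / D)"
        unfolding right_diff_distrib[symmetric] abs_mult by (intro mult_left_mono) auto
    qed
    also have "\<dots> = (\<integral>y. \<bar>p y\<bar> \<partial>surf) * (e / D)" by simp
    finally have 2: "\<bar>(\<integral>y. p y * f y \<partial>surf) - (\<integral>y. p y * g y \<partial>surf)\<bar> \<le> (\<integral>y. \<bar>p y\<bar> \<partial>surf) * (e / D)" .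
    have "measure \<rho> S2 * (e / D) + (\<integral>y. \<bar>p y\<bar> \<partial>surf) * (e / D) \<le> D * (e / D)"
      unfolding distrib_right[symmetric] using \<open>e / D > 0\<close> by (intro mult_right_mono) (auto simp: D_def)
    also have "\<dots> = e" using D by simp
    finally show ?thesis using 1 2 geq by linarith
  qed
  then have "\<bar>(\<integral>y. f y \<partial>\<rho>) - (\<integral>y. p y * f y \<partial>surf)\<bar> \<le> 0" by (rule field_le_epsilon)
  then show ?thesis by simp
qed

section \<open>Orthogonal series in \<open>L\<^sup>2\<close>\<close>

lemma (in finite_measure) integrable_of_square:
  fixes f :: "'a \<Rightarrow> real"
  assumes [measurable]: "f \<in> borel_measurable M" and "integrable M (\<lambda>x. (f x)\<^sup>2)"
  shows "integrable M f"
proof (rule Bochner_Integration.integrable_bound)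
  show "integrable M (\<lambda>x. 1 + (f x)\<^sup>2)" using assms by simp
  show "AE x in M. norm (f x) \<le> norm (1 + (f x)\<^sup>2)"
  proof (rule AE_I2)
    fix x
    have "0 \<le> (\<bar>f x\<bar> - 1)\<^sup>2" by simp
    then have "2 * \<bar>f x\<bar> \<le> 1 + (f x)\<^sup>2" by (simp add: power2_eq_square algebra_simps)
    moreover have "0 \<le> \<bar>f x\<bar>" by simp
    ultimately have "\<bar>f x\<bar> \<le> 1 + (f x)\<^sup>2" by linarith
    then show "norm (f x) \<le> norm (1 + (f x)\<^sup>2)" by simp
  qed
qed simp

text \<open>Fatou's lemma, applied to the partial sums beyond \<open>N\<close>: their squared norms are partial sums of the
  remainder of the series of squared norms.\<close>
lemma orthogonal_series_L2:
  fixes B :: "nat \<Rightarrow> 'a \<Rightarrow> real" and p :: "'a \<Rightarrow> real"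
  assumes fin: "finite_measure M"
    and int: "\<And>j k. integrable M (\<lambda>x. B j x * B k x)"
    and meas [measurable]: "\<And>k. B k \<in> borel_measurable M" "p \<in> borel_measurable M"
    and orth: "\<And>j k. j \<noteq> k \<Longrightarrow> (\<integral>x. B j x * B k x \<partial>M) = 0"
    and norm: "\<And>k. (\<integral>x. B k x * B k x \<partial>M) = n k" and sum: "summable n"
    and conv: "AE x in M. (\<lambda>k. B k x) sums p x"
  shows "integrable M (\<lambda>x. (p x - (\<Sum>k<N. B k x))\<^sup>2)"
    and "(\<integral>x. (p x - (\<Sum>k<N. B k x))\<^sup>2 \<partial>M) \<le> (\<Sum>k. n (k + N))"
proof -
  have n0: "0 \<le> n k" for k unfolding norm[symmetric] by (rule integral_nonneg_AE) simp
  have sumN: "summable (\<lambda>k. n (k + N))" using sum by (simp add: summable_iff_shift)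
  have sq: "integrable M (\<lambda>x. (\<Sum>k\<in>K. B k x)\<^sup>2)" "(\<integral>x. (\<Sum>k\<in>K. B k x)\<^sup>2 \<partial>M) = (\<Sum>k\<in>K. n k)"
    if K: "finite K" for K
  proof -
    have eq: "(\<Sum>k\<in>K. B k x)\<^sup>2 = (\<Sum>j\<in>K. \<Sum>k\<in>K. B j x * B k x)" for x
      by (simp add: power2_eq_square sum_product)
    show "integrable M (\<lambda>x. (\<Sum>k\<in>K. B k x)\<^sup>2)" unfolding eq by (intro Bochner_Integration.integrable_sum int)
    have "(\<integral>x. (\<Sum>k\<in>K. B k x)\<^sup>2 \<partial>M) = (\<Sum>j\<in>K. \<Sum>k\<in>K. (\<integral>x. B j x * B k x \<partial>M))"
      unfolding eq by (subst Bochner_Integration.integral_sum, intro Bochner_Integration.integrable_sum int)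
        (simp add: Bochner_Integration.integral_sum int)
    also have "\<dots> = (\<Sum>j\<in>K. \<Sum>k\<in>K. if k = j then n j else 0)"
      using orth norm by (intro sum.cong refl) auto
    also have "\<dots> = (\<Sum>j\<in>K. n j)" using K by (simp add: sum.delta)
    finally show "(\<integral>x. (\<Sum>k\<in>K. B k x)\<^sup>2 \<partial>M) = (\<Sum>k\<in>K. n k)" .
  qed
  have tail: "(\<Sum>k\<in>{N..<N + R}. n k) \<le> (\<Sum>k. n (k + N))" for R
  proof -
    have "(\<Sum>k\<in>{N..<N + R}. n k) = (\<Sum>k<R. n (k + N))"
      by (rule sum.reindex_bij_witness[of _ "\<lambda>k. k + N" "\<lambda>k. k - N"]) auto
    also have "\<dots> \<le> (\<Sum>k. n (k + N))" by (rule sum_le_suminf[OF sumN]) (use n0 in auto)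
    finally show ?thesis .
  qed
  have lim: "AE x in M. (\<lambda>R. ennreal ((\<Sum>k\<in>{N..<N + R}. B k x)\<^sup>2)) \<longlonglongrightarrow> ennreal ((p x - (\<Sum>k<N. B k x))\<^sup>2)"
    using conv
  proof eventually_elim
    case (elim x)
    have "(\<lambda>R. \<Sum>k<R. B k x) \<longlonglongrightarrow> p x" using elim by (simp add: sums_def)
    then have "(\<lambda>R. \<Sum>k<R + N. B k x) \<longlonglongrightarrow> p x" by (rule LIMSEQ_ignore_initial_segment)
    then have "(\<lambda>R. (\<Sum>k<R + N. B k x) - (\<Sum>k<N. B k x)) \<longlonglongrightarrow> p x - (\<Sum>k<N. B k x)"
      by (intro tendsto_intros)
    moreover have "(\<Sum>k<R + N. B k x) - (\<Sum>k<N. B k x) = (\<Sum>k\<in>{N..<N + R}. B k x)" for R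
    proof -
      have "{..<R + N} = {..<N} \<union> {N..<N + R}" by auto
      moreover have "(\<Sum>k\<in>{..<N} \<union> {N..<N + R}. B k x) = (\<Sum>k<N. B k x) + (\<Sum>k\<in>{N..<N + R}. B k x)"
        by (rule sum.union_disjoint) auto
      ultimately show ?thesis by simp
    qed
    ultimately have "(\<lambda>R. \<Sum>k\<in>{N..<N + R}. B k x) \<longlonglongrightarrow> p x - (\<Sum>k<N. B k x)" by simp
    then show ?case by (intro tendsto_ennrealI tendsto_power)
  qed
  have "(\<integral>\<^sup>+x. ennreal ((p x - (\<Sum>k<N. B k x))\<^sup>2) \<partial>M)
     = (\<integral>\<^sup>+x. liminf (\<lambda>R. ennreal ((\<Sum>k\<in>{N..<N + R}. B k x)\<^sup>2)) \<partial>M)"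
    by (rule nn_integral_cong_AE, rule eventually_mono[OF lim], rule lim_imp_Liminf[symmetric]) simp_all
  also have "\<dots> \<le> liminf (\<lambda>R. \<integral>\<^sup>+x. ennreal ((\<Sum>k\<in>{N..<N + R}. B k x)\<^sup>2) \<partial>M)"
    by (rule nn_integral_liminf) measurable
  also have "\<dots> \<le> ennreal (\<Sum>k. n (k + N))"
  proof (rule Liminf_le)
    show "\<forall>\<^sub>F R in sequentially. (\<integral>\<^sup>+x. ennreal ((\<Sum>k\<in>{N..<N + R}. B k x)\<^sup>2) \<partial>M) \<le> ennreal (\<Sum>k. n (k + N))"
    proof (intro always_eventually allI)
      fix R
      have "(\<integral>\<^sup>+x. ennreal ((\<Sum>k\<in>{N..<N + R}. B k x)\<^sup>2) \<partial>M) = ennreal (\<Sum>k\<in>{N..<N + R}. n k)"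
        by (subst nn_integral_eq_integral) (auto simp: sq)
      then show "(\<integral>\<^sup>+x. ennreal ((\<Sum>k\<in>{N..<N + R}. B k x)\<^sup>2) \<partial>M) \<le> ennreal (\<Sum>k. n (k + N))"
        using tail[of R] by (simp add: ennreal_leI)
    qed
  qed simp
  finally have bd: "(\<integral>\<^sup>+x. ennreal ((p x - (\<Sum>k<N. B k x))\<^sup>2) \<partial>M) \<le> ennreal (\<Sum>k. n (k + N))" .
  show int': "integrable M (\<lambda>x. (p x - (\<Sum>k<N. B k x))\<^sup>2)"
    by (rule integrableI_nonneg) (use bd in \<open>auto intro: le_less_trans\<close>)
  have "ennreal (\<integral>x. (p x - (\<Sum>k<N. B k x))\<^sup>2 \<partial>M) = (\<integral>\<^sup>+x. ennreal ((p x - (\<Sum>k<N. B k x))\<^sup>2) \<partial>M)"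
    by (rule nn_integral_eq_integral[OF int', symmetric]) simp
  with bd have "ennreal (\<integral>x. (p x - (\<Sum>k<N. B k x))\<^sup>2 \<partial>M) \<le> ennreal (\<Sum>k. n (k + N))" by simp
  then show "(\<integral>x. (p x - (\<Sum>k<N. B k x))\<^sup>2 \<partial>M) \<le> (\<Sum>k. n (k + N))"
    using suminf_nonneg[OF sumN] n0 by (simp add: ennreal_le_iff)
qed

text \<open>The remainder is small in \<open>L\<^sup>2\<close>, and \<open>\<bar>a\<bar> \<le> d + a\<^sup>2 / d\<close> with a suitable \<open>d\<close> turns this into smallness
  in \<open>L\<^sup>1\<close> on a finite measure space.\<close>
lemma orthogonal_series_inner:
  fixes B :: "nat \<Rightarrow> 'a \<Rightarrow> real" and p :: "'a \<Rightarrow> real" and g :: "'a \<Rightarrow> complex"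
  assumes fin: "finite_measure M"
    and int: "\<And>j k. integrable M (\<lambda>x. B j x * B k x)"
    and meas [measurable]: "\<And>k. B k \<in> borel_measurable M" "p \<in> borel_measurable M" "g \<in> borel_measurable M"
    and orth: "\<And>j k. j \<noteq> k \<Longrightarrow> (\<integral>x. B j x * B k x \<partial>M) = 0"
    and norm: "\<And>k. (\<integral>x. B k x * B k x \<partial>M) = n k" and sum: "summable n"
    and conv: "AE x in M. (\<lambda>k. B k x) sums p x"
    and g: "\<And>x. x \<in> space M \<Longrightarrow> norm (g x) \<le> c"
  shows "(\<lambda>k. \<integral>x. of_real (B k x) * g x \<partial>M) sums (\<integral>x. of_real (p x) * g x \<partial>M)"
proof -
  interpret finite_measure M by fact
  let ?S = "\<lambda>N x. \<Sum>k<N. B k x"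
  define C where "C = max c 0"
  have gC: "norm (g x) \<le> C" if "x \<in> space M" for x using g[OF that] by (simp add: C_def)
  have C0: "C \<ge> 0" by (simp add: C_def)
  have intB: "integrable M (B k)" for k
    by (rule integrable_of_square[OF meas(1)]) (use int[of k k] in \<open>simp add: power2_eq_square\<close>)
  have intD: "integrable M (\<lambda>x. p x - ?S N x)" for N
    by (rule integrable_of_square[OF _ orthogonal_series_L2(1)[OF fin int meas(1,2) orth norm sum conv]]) auto
  have intg: "integrable M (\<lambda>x. of_real (f x) * g x)" if f: "integrable M f" for f :: "'a \<Rightarrow> real"
  proof (rule Bochner_Integration.integrable_bound[of _ "\<lambda>x. C * f x"])
    show "integrable M (\<lambda>x. C * f x)" using f by simp
    show "(\<lambda>x. of_real (f x) * g x) \<in> borel_measurable M" using f by measurable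
    show "AE x in M. norm (of_real (f x) * g x) \<le> norm (C * f x)"
    proof (rule AE_I2)
      fix x assume "x \<in> space M"
      then have "\<bar>f x\<bar> * norm (g x) \<le> \<bar>f x\<bar> * C" using gC by (intro mult_left_mono) auto
      then show "norm (of_real (f x) * g x) \<le> norm (C * f x)" using C0 by (simp add: norm_mult abs_mult mult.commute)
    qed
  qed
  have intS: "integrable M (?S N)" for N by (intro Bochner_Integration.integrable_sum intB)
  have intp: "integrable M p" using intD[of 0] by simp
  have bound: "norm ((\<integral>x. of_real (p x) * g x \<partial>M) - (\<Sum>k<N. \<integral>x. of_real (B k x) * g x \<partial>M))
     \<le> C * (d * measure M (space M) + (\<Sum>k. n (k + N)) / d)" if d: "d > 0" for d N
  proof -
    have "(\<Sum>k<N. \<integral>x. of_real (B k x) * g x \<partial>M) = (\<integral>x. of_real (?S N x) * g x \<partial>M)"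
      using intg[OF intB] by (simp add: sum_distrib_right)
    then have "(\<integral>x. of_real (p x) * g x \<partial>M) - (\<Sum>k<N. \<integral>x. of_real (B k x) * g x \<partial>M)
        = (\<integral>x. of_real (p x) * g x \<partial>M) - (\<integral>x. of_real (?S N x) * g x \<partial>M)" by simp
    also have "\<dots> = (\<integral>x. of_real (p x - ?S N x) * g x \<partial>M)"
      using intg[OF intp] intg[OF intS[of N]]
      by (subst Bochner_Integration.integral_diff[symmetric]) (auto simp: left_diff_distrib)
    also have "norm \<dots> \<le> (\<integral>x. norm (of_real (p x - ?S N x) * g x) \<partial>M)" by (rule integral_norm_bound)
    also have "\<dots> \<le> (\<integral>x. C * (d + (p x - ?S N x)\<^sup>2 / d) \<partial>M)"
    proof (rule integral_mono)
      show "integrable M (\<lambda>x. norm (of_real (p x - ?S N x) * g x))"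
        using intg[OF intD[of N]] by (rule integrable_norm)
      show "integrable M (\<lambda>x. C * (d + (p x - ?S N x)\<^sup>2 / d))"
        using orthogonal_series_L2(1)[OF fin int meas(1,2) orth norm sum conv] by simp
      fix x assume x: "x \<in> space M"
      let ?a = "\<bar>p x - ?S N x\<bar>"
      have "?a \<le> d + ?a\<^sup>2 / d"
      proof (cases "?a \<le> d")
        case True
        then show ?thesis using d by (simp add: add_increasing2)
      next
        case False
        then have "?a * d \<le> ?a * ?a" by (intro mult_left_mono) auto
        then have "?a \<le> ?a\<^sup>2 / d" using d by (simp add: le_divide_eq power2_eq_square)
        then show ?thesis using d by linarith
      qed
      then have "?a * norm (g x) \<le> (d + ?a\<^sup>2 / d) * C"
        using gC[OF x] d by (intro mult_mono) auto
      then show "norm (of_real (p x - ?S N x) * g x) \<le> C * (d + (p x - ?S N x)\<^sup>2 / d)"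
        by (simp add: norm_mult mult.commute del: of_real_diff)
    qed
    also have "\<dots> = C * (d * measure M (space M) + (\<integral>x. (p x - ?S N x)\<^sup>2 \<partial>M) / d)"
      using orthogonal_series_L2(1)[OF fin int meas(1,2) orth norm sum conv, of N] by simp
    also have "\<dots> \<le> C * (d * measure M (space M) + (\<Sum>k. n (k + N)) / d)"
      using orthogonal_series_L2(2)[OF fin int meas(1,2) orth norm sum conv, of N] C0 d
      by (intro mult_left_mono add_left_mono divide_right_mono) auto
    finally show ?thesis .
  qed
  have tail0: "(\<lambda>N. \<Sum>k. n (k + N)) \<longlonglongrightarrow> 0" by (rule suminf_exist_split2[OF sum])
  show ?thesis
    unfolding sums_def
  proof (rule LIMSEQ_I)
    fix e :: real assume e: "e > 0"
    define D where "D = C * measure M (space M) + 1"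
    have D: "D > 0" using C0 by (auto simp: D_def intro!: add_nonneg_pos)
    \<comment> \<open>this choice makes the first part of \<open>bound\<close> at most \<open>e / 2\<close>\<close>
    define d where "d = e / (2 * D)"
    have d: "d > 0" using e D by (simp add: d_def)
    have "C * (d * measure M (space M)) = d * (C * measure M (space M))" by simp
    also have "\<dots> \<le> d * D" using d by (intro mult_left_mono) (auto simp: D_def)
    also have "\<dots> = e / 2" using D by (simp add: d_def)
    finally have half: "C * (d * measure M (space M)) \<le> e / 2" .
    have "(\<lambda>N. C * ((\<Sum>k. n (k + N)) / d)) \<longlonglongrightarrow> C * (0 / d)"
      by (intro tendsto_intros tail0) (use d in simp)
    then have "\<forall>\<^sub>F N in sequentially. C * ((\<Sum>k. n (k + N)) / d) < e / 2"
      by (rule order_tendstoD) (use e in simp)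
    then obtain N0 where N0: "\<And>N. N \<ge> N0 \<Longrightarrow> C * ((\<Sum>k. n (k + N)) / d) < e / 2"
      by (auto simp: eventually_sequentially)
    show "\<exists>no. \<forall>N\<ge>no. norm ((\<Sum>k<N. \<integral>x. of_real (B k x) * g x \<partial>M) - (\<integral>x. of_real (p x) * g x \<partial>M)) < e"
    proof (intro exI allI impI)
      fix N assume "N \<ge> N0"
      then show "norm ((\<Sum>k<N. \<integral>x. of_real (B k x) * g x \<partial>M) - (\<integral>x. of_real (p x) * g x \<partial>M)) < e"
        using bound[OF d, of N] N0[of N] half unfolding norm_minus_commute[of "\<Sum>k<N. _ k"] distrib_left by linarith
    qed
  qed
qed

lemma sph_harm_series_L2:
  fixes a :: "nat \<Rightarrow> int \<Rightarrow> complex" and B :: "nat \<Rightarrow> real^3 \<Rightarrow> real" and p :: "real^3 \<Rightarrow> real"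
  assumes B: "\<And>l y. y \<in> S2 \<Longrightarrow> of_real (B l y) = (\<Sum>m = - int l..int l. a l m * cnj (sph_harm l m y))"
    and sum: "summable (\<lambda>l. \<Sum>m = - int l..int l. (norm (a l m))\<^sup>2)"
    and p: "p \<in> borel_measurable surf"
    and conv: "AE y in surf. (\<lambda>l. B l y) sums p y"
  shows "integrable surf p" "integrable surf (\<lambda>y. (p y)\<^sup>2)"
    and "\<And>l m. m \<in> {- int l..int l} \<Longrightarrow> (\<integral>y. of_real (p y) * sph_harm l m y \<partial>surf) = a l m"
proof -
  have fin: "finite_measure surf" by (rule finite_measure_surf)
  have cblock: "continuous_on S2 (\<lambda>y. \<Sum>m = - int l..int l. a l m * cnj (sph_harm l m y))" for l
    by (intro continuous_intros continuous_on_sph_harm) auto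
  have cB: "continuous_on S2 (B l)" for l
  proof -
    have "continuous_on S2 (\<lambda>y. Re (\<Sum>m = - int l..int l. a l m * cnj (sph_harm l m y)))"
      by (intro continuous_on_Re cblock)
    then show ?thesis by (rule continuous_on_eq) (simp add: B[symmetric])
  qed
  have mB: "B l \<in> borel_measurable surf" for l
    using continuous_S2_measurable[OF cB[of l]] by (simp cong: measurable_cong_sets)
  have intB: "integrable surf (\<lambda>y. B j y * B k y)" for j k
    by (intro continuous_S2_integrable continuous_intros cB)
  have cY: "integrable surf (\<lambda>y. c * (cnj (sph_harm l m y) * sph_harm l' m' y))"
    if "m \<in> {- int l..int l}" "m' \<in> {- int l'..int l'}" for l m l' m' c
    using that by (intro continuous_S2_integrable continuous_intros continuous_on_sph_harm)
  have BY: "(\<integral>y. of_real (B j y) * sph_harm l m y \<partial>surf) = (if j = l then a l m else 0)"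
    if m: "m \<in> {- int l..int l}" for j l m
  proof -
    have "(\<integral>y. of_real (B j y) * sph_harm l m y \<partial>surf)
      = (\<integral>y. (\<Sum>m' = - int j..int j. a j m' * (cnj (sph_harm j m' y) * sph_harm l m y)) \<partial>surf)"
      by (intro Bochner_Integration.integral_cong) (auto simp: B sum_distrib_right mult.assoc)
    also have "\<dots> = (\<Sum>m' = - int j..int j. (\<integral>y. a j m' * (cnj (sph_harm j m' y) * sph_harm l m y) \<partial>surf))"
      by (rule Bochner_Integration.integral_sum) (use cY m in auto)
    also have "\<dots> = (\<Sum>m' = - int j..int j. a j m' * (if l = j \<and> m = m' then 1 else 0))"
    proof (rule sum.cong[OF refl])
      fix m' assume m': "m' \<in> {- int j..int j}"
      have "(\<integral>y. a j m' * (cnj (sph_harm j m' y) * sph_harm l m y) \<partial>surf)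
         = a j m' * (\<integral>y. sph_harm l m y * cnj (sph_harm j m' y) \<partial>surf)"
        by (simp add: mult.commute)
      then show "(\<integral>y. a j m' * (cnj (sph_harm j m' y) * sph_harm l m y) \<partial>surf) = a j m' * (if l = j \<and> m = m' then 1 else 0)"
        by (simp only: sph_harm_orthonormal[OF m m'])
    qed
    also have "\<dots> = (if j = l then a l m else 0)"
    proof (cases "j = l")
      case True
      have "(\<Sum>m' = - int j..int j. a j m' * (if l = j \<and> m = m' then 1 else 0))
         = (\<Sum>m' = - int j..int j. if m' = m then a j m' else 0)"
        using True by (intro sum.cong) auto
      then show ?thesis using True m by (simp add: sum.delta)
    qed auto
    finally show ?thesis .
  qed
  have BB: "(\<integral>y. B j y * B k y \<partial>surf) = (if j = k then (\<Sum>m = - int k..int k. (norm (a k m))\<^sup>2) else 0)" for j k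
  proof -
    have "complex_of_real (\<integral>y. B j y * B k y \<partial>surf) = (\<integral>y. of_real (B j y) * cnj (of_real (B k y)) \<partial>surf)"
      by (simp add: of_real_mult[symmetric] del: of_real_mult)
    also have "\<dots> = (\<integral>y. (\<Sum>m = - int k..int k. cnj (a k m) * (of_real (B j y) * sph_harm k m y)) \<partial>surf)"
      by (intro Bochner_Integration.integral_cong refl) (auto simp: B[of _ k] sum_distrib_left mult_ac)
    also have "\<dots> = (\<Sum>m = - int k..int k. (\<integral>y. cnj (a k m) * (of_real (B j y) * sph_harm k m y) \<partial>surf))"
      by (intro Bochner_Integration.integral_sum continuous_S2_integrable continuous_intros continuous_on_sph_harm cB)
    also have "\<dots> = (\<Sum>m = - int k..int k. cnj (a k m) * (if j = k then a k m else 0))"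
      using BY by (intro sum.cong refl) simp
    also have "\<dots> = of_real (if j = k then (\<Sum>m = - int k..int k. (norm (a k m))\<^sup>2) else 0)"
      by (simp add: complex_norm_square mult.commute del: of_real_power)
    finally show ?thesis by (simp only: of_real_eq_iff)
  qed
  have norm: "(\<integral>y. B k y * B k y \<partial>surf) = (\<Sum>m = - int k..int k. (norm (a k m))\<^sup>2)" for k using BB by simp
  have orth: "(\<integral>y. B j y * B k y \<partial>surf) = 0" if "j \<noteq> k" for j k using BB that by simp
  show sq: "integrable surf (\<lambda>y. (p y)\<^sup>2)"
    using orthogonal_series_L2(1)[OF fin intB mB p orth norm sum conv, of 0] by simp
  show "integrable surf p" by (rule surf.integrable_of_square[OF p sq])
  fix l m assume m: "m \<in> {- int l..int l}"
  obtain c where c: "\<And>x. x \<in> S2 \<Longrightarrow> norm (sph_harm l m x) \<le> c"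
    using continuous_S2_bounded[OF continuous_on_sph_harm[OF m]] by metis
  have mY: "sph_harm l m \<in> borel_measurable surf"
    using continuous_S2_measurable[OF continuous_on_sph_harm[OF m]] by (simp cong: measurable_cong_sets)
  have "(\<lambda>k. \<integral>y. of_real (B k y) * sph_harm l m y \<partial>surf) sums (\<integral>y. of_real (p y) * sph_harm l m y \<partial>surf)"
    by (rule orthogonal_series_inner[OF fin intB mB p mY orth norm sum conv, of c]) (use c in auto)
  then have "(\<lambda>k. if k = l then a l m else 0) sums (\<integral>y. of_real (p y) * sph_harm l m y \<partial>surf)"
    by (simp only: BY[OF m])
  moreover have "(\<lambda>k. if k = l then a l m else 0) sums a l m" by (rule sums_single)
  ultimately show "(\<integral>y. of_real (p y) * sph_harm l m y \<partial>surf) = a l m" by (rule sums_unique2)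
qed

section \<open>The density of the time-changed process\<close>

text \<open>The reproducing kernel of degree \<open>l\<close> as a function of the cosine of the angle, as in
  \<open>addition_theorem\<close>.\<close>
definition zonal :: "nat \<Rightarrow> real \<Rightarrow> real" where
  "zonal l c = (2 * real l + 1) / (4 * pi) * (poly (rodrigues l l) c / (2 ^ l * fact l))"

lemma zonal_bound:
  assumes "\<bar>c\<bar> < 1"
  shows "\<bar>zonal l c\<bar> \<le> sqrt ((2 * real l + 1) / (1 - c\<^sup>2))"
proof -
  define K where "K = (2 ^ l * fact l :: real)"
  define q where "q = poly (rodrigues l l) c"
  define n where "n = 2 * real l + 1"
  have K: "K > 0" by (simp add: K_def)
  have n: "n > 0" by (simp add: n_def)
  have c: "1 - c\<^sup>2 > 0" using assms by (simp add: abs_square_less_1)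
  have "(1 - c\<^sup>2) * q\<^sup>2 \<le> 2 * K\<^sup>2 / n"
    using legendre_decay[of c l] assms by (simp add: q_def K_def n_def)
  then have "q\<^sup>2 \<le> 2 * K\<^sup>2 / n / (1 - c\<^sup>2)"
    using c by (subst pos_le_divide_eq) (simp_all only: mult.commute)
  then have "(n / (4 * pi))\<^sup>2 / K\<^sup>2 * q\<^sup>2 \<le> (n / (4 * pi))\<^sup>2 / K\<^sup>2 * (2 * K\<^sup>2 / n / (1 - c\<^sup>2))"
    by (intro mult_left_mono) auto
  also have "\<dots> = 2 / (4 * pi)\<^sup>2 * (n / (1 - c\<^sup>2))"
    using K n c by (simp add: power2_eq_square field_simps)
  also have "\<dots> \<le> 1 * (n / (1 - c\<^sup>2))"
  proof (rule mult_right_mono)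
    have "2 \<le> 4 * pi" using pi_gt3 by simp
    then have "2\<^sup>2 \<le> (4 * pi)\<^sup>2" by (intro power_mono) auto
    then have "2 \<le> (4 * pi)\<^sup>2" by simp
    then show "2 / (4 * pi)\<^sup>2 \<le> 1" by (simp add: divide_le_eq_1)
    show "0 \<le> n / (1 - c\<^sup>2)" using n c by simp
  qed
  finally have "(zonal l c)\<^sup>2 \<le> n / (1 - c\<^sup>2)"
    by (simp add: zonal_def q_def K_def n_def power_mult_distrib power_divide)
  then show ?thesis unfolding n_def by (simp add: real_le_rsqrt)
qed

text \<open>The pairs of points that no rotation about the third axis makes equal or antipodal.\<close>
definition off_axis :: "real^3 \<Rightarrow> real^3 \<Rightarrow> bool" where
  "off_axis x y \<longleftrightarrow> colat x \<noteq> colat y \<and> colat x \<noteq> pi - colat y"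

lemma off_axis_iff:
  assumes x: "x \<in> S2" and y: "y \<in> S2"
  shows "off_axis x y \<longleftrightarrow> y $ 3 \<noteq> x $ 3 \<and> y $ 3 \<noteq> - (x $ 3)"
proof -
  have "colat x = colat y \<longleftrightarrow> y $ 3 = x $ 3"
    unfolding colat_def using cos_colat[OF x] cos_colat[OF y] by (metis colat_def)
  moreover have "colat x = pi - colat y \<longleftrightarrow> y $ 3 = - (x $ 3)"
  proof
    assume "colat x = pi - colat y"
    then have "cos (colat x) = - cos (colat y)" by simp
    then show "y $ 3 = - (x $ 3)" using cos_colat[OF x] cos_colat[OF y] by simp
  next
    assume "y $ 3 = - (x $ 3)"
    then have "colat y = pi - colat x"
      unfolding colat_def using S2_third[OF x] by (simp add: arccos_minus abs_le_iff)
    then show "colat x = pi - colat y" by simp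
  qed
  ultimately show ?thesis unfolding off_axis_def by simp
qed

lemma off_axis_commute: "x \<in> S2 \<Longrightarrow> y \<in> S2 \<Longrightarrow> off_axis x y \<longleftrightarrow> off_axis y x"
  by (auto simp: off_axis_iff)

lemma AE_off_axis:
  assumes x: "x \<in> S2"
  shows "AE y in surf. off_axis x y"
  using AE_surf_latitude[of "x $ 3"] AE_surf_latitude[of "- (x $ 3)"] AE_space
  by eventually_elim (use x in \<open>simp add: off_axis_iff\<close>)

text \<open>Writing \<open>r\<close> and \<open>s\<close> for the distances of \<open>x\<close> and \<open>y\<close> from the axis, the inner product differs from the
  product of the third coordinates by at most \<open>r * s\<close>; the extreme values are those of two points on a
  common meridian circle, which are neither equal nor antipodal.\<close>
lemma inner_rot3_bound:
  assumes x: "x \<in> S2" and y: "y \<in> S2" and off: "off_axis x y"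
  obtains c0 where "c0 < 1" "\<And>a. \<bar>rot3 a x \<bullet> y\<bar> \<le> c0"
proof -
  define r s where "r = sqrt (1 - (x $ 3)\<^sup>2)" and "s = sqrt (1 - (y $ 3)\<^sup>2)"
  have r2: "r\<^sup>2 = 1 - (x $ 3)\<^sup>2" and s2: "s\<^sup>2 = 1 - (y $ 3)\<^sup>2"
    using S2_third[OF x] S2_third[OF y] by (simp_all add: r_def s_def abs_square_le_1)
  have ne: "x $ 3 - y $ 3 \<noteq> 0" "x $ 3 + y $ 3 \<noteq> 0" using off off_axis_iff[OF x y] by auto
  have bound: "\<bar>rot3 a x \<bullet> y - x $ 3 * y $ 3\<bar> \<le> r * s" for a
  proof -
    have "rot3 a x \<bullet> y - x $ 3 * y $ 3 = Re (planar (rot3 a x) * cnj (planar y))"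
      by (simp add: inner_vec_def sum_3 planar_def)
    also have "\<bar>\<dots>\<bar> \<le> norm (planar (rot3 a x) * cnj (planar y))" by (rule abs_Re_le_cmod)
    also have "\<dots> = r * s"
      using norm_planar[OF rot3_S2[OF x], of a] norm_planar[OF y] by (simp add: norm_mult r_def s_def)
    finally show ?thesis .
  qed
  \<comment> \<open>\<open>c0 < 1\<close> since \<open>2 - 2 * c0\<close> is a sum of squares, not all zero, for both alternatives\<close>
  define c0 where "c0 = max (x $ 3 * y $ 3 + r * s) (r * s - x $ 3 * y $ 3)"
  have "0 < (x $ 3 - y $ 3)\<^sup>2 + (r - s)\<^sup>2" using ne by (simp add: add_pos_nonneg)
  also have "\<dots> = 2 - 2 * (x $ 3 * y $ 3 + r * s)"
    using r2 s2 by (simp add: power2_diff)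
  finally have 1: "x $ 3 * y $ 3 + r * s < 1" by simp
  have "0 < (x $ 3 + y $ 3)\<^sup>2 + (r - s)\<^sup>2" using ne by (simp add: add_pos_nonneg)
  also have "\<dots> = 2 - 2 * (r * s - x $ 3 * y $ 3)"
    using r2 s2 by (simp add: power2_diff power2_sum)
  finally have 2: "r * s - x $ 3 * y $ 3 < 1" by simp
  show ?thesis
  proof (rule that[of c0])
    show "c0 < 1" using 1 2 by (simp add: c0_def)
    show "\<bar>rot3 a x \<bullet> y\<bar> \<le> c0" for a using bound[of a] by (simp add: c0_def abs_le_iff) linarith
  qed
qed

lemma summable_sqrt_decay: "summable (\<lambda>l. sqrt (2 * real l + 1) / real (l * (l + 1)))"
proof (rule summable_comparison_test)
  show "summable (\<lambda>l. 2 * real l powr (- 3 / 2))"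
    by (intro summable_mult) (simp add: summable_real_powr_iff)
  have "norm (sqrt (2 * real l + 1) / real (l * (l + 1))) \<le> 2 * real l powr (- 3 / 2)" if "l \<ge> 1" for l
  proof -
    have l: "real l \<ge> 1" using that by simp
    have "sqrt (2 * real l + 1) \<le> sqrt (4 * real l)" using l by simp
    also have "\<dots> = 2 * real l powr (1 / 2)" using l by (simp add: real_sqrt_mult powr_half_sqrt)
    finally have "sqrt (2 * real l + 1) / real (l * (l + 1)) \<le> 2 * real l powr (1 / 2) / real (l * (l + 1))"
      by (intro divide_right_mono) auto
    also have "\<dots> \<le> 2 * real l powr (1 / 2) / (real l powr 2)"
    proof (rule divide_left_mono)
      show "real l powr 2 \<le> real (l * (l + 1))" using l by (simp add: power2_eq_square)
      have "0 < real (l * (l + 1))" using that by (simp only: of_nat_0_less_iff) simp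
      then show "0 < real (l * (l + 1)) * real l powr 2" using l by (intro mult_pos_pos) auto
    qed simp
    also have "\<dots> = 2 * (real l powr (1 / 2) / real l powr 2)" by (simp only: times_divide_eq_right)
    also have "\<dots> = 2 * real l powr (- 3 / 2)" unfolding powr_diff[symmetric] by simp
    finally show ?thesis by simp
  qed
  then show "\<exists>N. \<forall>l\<ge>N. norm (sqrt (2 * real l + 1) / real (l * (l + 1))) \<le> 2 * real l powr (- 3 / 2)" by blast
qed

lemma summable_square_decay: "summable (\<lambda>l. (2 * real l + 1) / (real (l * (l + 1)))\<^sup>2)"
proof (rule summable_comparison_test)
  show "summable (\<lambda>l. 3 * (1 / (real l)\<^sup>2))"
    using inverse_power_summable[of 2] by (intro summable_mult) (simp add: inverse_eq_divide)
  have "norm ((2 * real l + 1) / (real (l * (l + 1)))\<^sup>2) \<le> 3 * (1 / (real l)\<^sup>2)" if "l \<ge> 1" for l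
  proof -
    have l: "real l \<ge> 1" using that by simp
    have "(2 * real l + 1) * (real l)\<^sup>2 \<le> 3 * (real l + 1)\<^sup>2 * (real l)\<^sup>2"
      using l by (intro mult_right_mono) (auto simp: power2_eq_square algebra_simps)
    then show ?thesis using l by (simp add: divide_le_eq le_divide_eq power_mult_distrib mult_ac)
        (simp add: field_simps power2_eq_square)
  qed
  then show "\<exists>N. \<forall>l\<ge>N. norm ((2 * real l + 1) / (real (l * (l + 1)))\<^sup>2) \<le> 3 * (1 / (real l)\<^sup>2)" by blast
qed

context time_changed_diffusion
begin

lemma AE_inv_sub_pos:
  assumes t: "t > 0"
  shows "AE \<omega> in P x. L t \<omega> > 0"
proof -
  let ?N = "{\<omega> \<in> space (P x). L t \<omega> \<le> 0}" and ?K = "\<Phi> 1 / (1 - exp (- t))"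
  have N: "?N \<in> events" using inv_sub_rv by measurable
  have "prob ?N \<le> inverse (real (Suc n)) * ?K" for n
  proof -
    have "prob ?N \<le> prob {\<omega> \<in> space (P x). L t \<omega> < inverse (real (Suc n))}"
      by (rule finite_measure_mono) (use inv_sub_rv in \<open>auto intro: le_less_trans\<close>)
    also have "\<dots> \<le> inverse (real (Suc n)) * ?K" by (rule prob_inv_sub_less[OF t]) simp
    finally show ?thesis .
  qed
  then have bd: "\<exists>N0. \<forall>n\<ge>N0. prob ?N \<le> inverse (real (Suc n)) * ?K" by blast
  have "(\<lambda>n. inverse (real (Suc n)) * ?K) \<longlonglongrightarrow> 0 * ?K"
    by (intro tendsto_intros LIMSEQ_inverse_real_of_nat)
  from LIMSEQ_le_const[OF this bd] have "prob ?N = 0" by (simp add: measure_le_0_iff)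
  then have "AE \<omega> in P x. \<omega> \<notin> ?N" using N by (intro AE_not_in) (simp add: null_sets_def emeasure_eq_measure)
  then show ?thesis by (rule AE_mp) (auto intro!: AE_I2 simp: not_le)
qed

text \<open>The terms of degree \<open>l\<close> of \<open>trans_density\<close> at the random time, in the real form that the addition theorem
  gives them.\<close>
definition block_integrand :: "real \<Rightarrow> real^3 \<Rightarrow> nat \<Rightarrow> 'a \<Rightarrow> real" where
  "block_integrand t y l \<omega> = exp (- real (l * (l + 1)) * L t \<omega>) * zonal l (rot3 (\<mu> * L t \<omega>) x \<bullet> y)"

definition block :: "real \<Rightarrow> real^3 \<Rightarrow> nat \<Rightarrow> real" where
  "block t y l = (\<integral>\<omega>. block_integrand t y l \<omega> \<partial>P x)"

text \<open>The phases \<open>exp (\<i> * \<mu> * m * u)\<close> amount to a rotation of \<open>x\<close> about the axis by \<open>\<mu> * u\<close>.\<close>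
lemma sum_exp_eigenvalue:
  assumes y: "y \<in> S2"
  shows "(\<Sum>m = - int l..int l. exp (eigenvalue \<mu> l m * of_real u) * sph_harm l m x * cnj (sph_harm l m y))
    = of_real (exp (- real (l * (l + 1)) * u) * zonal l (rot3 (\<mu> * u) x \<bullet> y))"
proof -
  have ex: "exp (eigenvalue \<mu> l m * of_real u)
      = of_real (exp (- real (l * (l + 1)) * u)) * exp (\<i> * of_int m * of_real (\<mu> * u))" for m
    unfolding exp_of_real[symmetric] mult_exp_exp eigenvalue_def by (simp add: algebra_simps)
  have "(\<Sum>m = - int l..int l. exp (eigenvalue \<mu> l m * of_real u) * sph_harm l m x * cnj (sph_harm l m y))
    = (\<Sum>m = - int l..int l. of_real (exp (- real (l * (l + 1)) * u)) * (sph_harm l m (rot3 (\<mu> * u) x) * cnj (sph_harm l m y)))"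
    unfolding ex by (intro sum.cong refl) (simp add: sph_harm_rot3[OF x] mult_ac)
  also have "\<dots> = of_real (exp (- real (l * (l + 1)) * u) * zonal l (rot3 (\<mu> * u) x \<bullet> y))"
    unfolding sum_distrib_left[symmetric] addition_theorem[OF rot3_S2[OF x] y] zonal_def[symmetric]
    by (simp only: of_real_mult)
  finally show ?thesis .
qed

lemma exp_eigenvalue_measurable: "(\<lambda>\<omega>. exp (z * complex_of_real (L t \<omega>))) \<in> borel_measurable (P x)"
proof -
  have "continuous_on UNIV (\<lambda>u::real. exp (z * of_real u))" by (intro continuous_intros)
  then show ?thesis by (intro measurable_compose[OF inv_sub_rv] borel_measurable_continuous_onI)
qed

lemma exp_eigenvalue_integrable: "integrable (P x) (\<lambda>\<omega>. exp (eigenvalue \<mu> l m * complex_of_real (L t \<omega>)))"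
  by (rule integrable_const_bound[of _ 1])
     (intro AE_I2 norm_exp_eigenvalue_le_1 inv_sub_nonneg exp_eigenvalue_measurable)+

lemma block_integrand_integrable:
  assumes y: "y \<in> S2"
  shows "integrable (P x) (block_integrand t y l)"
proof -
  have "integrable (P x) (\<lambda>\<omega>. \<Sum>m = - int l..int l. exp (eigenvalue \<mu> l m * of_real (L t \<omega>)) * sph_harm l m x * cnj (sph_harm l m y))"
    by (intro Bochner_Integration.integrable_sum integrable_mult_left exp_eigenvalue_integrable)
  then have "integrable (P x) (\<lambda>\<omega>. complex_of_real (block_integrand t y l \<omega>))"
    unfolding sum_exp_eigenvalue[OF y] block_integrand_def .
  from integrable_Re[OF this] show ?thesis by simp
qed

lemma block_eq:
  assumes y: "y \<in> S2"
  shows "of_real (block t y l) = (\<Sum>m = - int l..int l. e_fun (P x) S t (eigenvalue \<mu> l m) * sph_harm l m x * cnj (sph_harm l m y))"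
proof -
  have "of_real (block t y l) = (\<integral>\<omega>. complex_of_real (block_integrand t y l \<omega>) \<partial>P x)"
    unfolding block_def by (rule integral_complex_of_real[symmetric])
  also have "\<dots> = (\<integral>\<omega>. (\<Sum>m = - int l..int l. exp (eigenvalue \<mu> l m * of_real (L t \<omega>)) * sph_harm l m x * cnj (sph_harm l m y)) \<partial>P x)"
    unfolding sum_exp_eigenvalue[OF y] block_integrand_def ..
  also have "\<dots> = (\<Sum>m = - int l..int l. (\<integral>\<omega>. exp (eigenvalue \<mu> l m * of_real (L t \<omega>)) * sph_harm l m x * cnj (sph_harm l m y) \<partial>P x))"
    by (intro Bochner_Integration.integral_sum integrable_mult_left exp_eigenvalue_integrable)
  also have "\<dots> = (\<Sum>m = - int l..int l. e_fun (P x) S t (eigenvalue \<mu> l m) * sph_harm l m x * cnj (sph_harm l m y))"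
    unfolding e_fun_def by simp
  finally show ?thesis .
qed

text \<open>The integrand of degree \<open>l\<close> is at most a constant times \<open>sqrt (2 * l + 1) * exp (- l * (l + 1) * L)\<close>, with
  expectation of order \<open>l powr (- 3 / 2)\<close>. This justifies the exchange of the sum over \<open>l\<close> with the
  expectation.\<close>
lemma block_series:
  assumes y: "y \<in> S2" and off: "off_axis x y" and t: "t > 0"
  shows "block t y sums (\<Sum>l. block t y l)"
    and "has_bochner_integral (P x) (\<lambda>\<omega>. trans_density \<mu> (L t \<omega>) y x) (complex_of_real (\<Sum>l. block t y l))"
proof -
  obtain c0 where c0: "c0 < 1" "\<And>a. \<bar>rot3 a x \<bullet> y\<bar> \<le> c0" using inner_rot3_bound[OF x y off] by blast
  have c00: "0 \<le> c0" using c0(2)[of 0] by linarith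
  have d: "1 - c0\<^sup>2 > 0" using c0(1) c00 by (simp add: abs_square_less_1)
  define D where "D = 1 / sqrt (1 - c0\<^sup>2)"
  have D: "D \<ge> 0" using d by (simp add: D_def)
  have z: "\<bar>zonal l (rot3 a x \<bullet> y)\<bar> \<le> D * sqrt (2 * real l + 1)" for l a
  proof -
    let ?c = "rot3 a x \<bullet> y"
    have "\<bar>?c\<bar>\<^sup>2 \<le> c0\<^sup>2" using c0(2)[of a] by (intro power_mono) auto
    then have "(2 * real l + 1) / (1 - ?c\<^sup>2) \<le> (2 * real l + 1) / (1 - c0\<^sup>2)"
      using d by (intro divide_left_mono mult_pos_pos) auto
    then have "sqrt ((2 * real l + 1) / (1 - ?c\<^sup>2)) \<le> sqrt ((2 * real l + 1) / (1 - c0\<^sup>2))"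
      by (rule real_sqrt_le_mono)
    also have "\<dots> = D * sqrt (2 * real l + 1)" by (simp add: D_def real_sqrt_divide)
    finally show ?thesis using zonal_bound[of ?c l] c0(2)[of a] c0(1) by linarith
  qed
  obtain C where C: "C \<ge> 0" "\<And>r. r > 0 \<Longrightarrow> expectation (\<lambda>\<omega>. exp (- r * inv_sub S t \<omega>)) \<le> C / r"
    using laplace_inv_sub_decay[OF t] by blast
  have bi: "\<bar>block_integrand t y l \<omega>\<bar> \<le> D * sqrt (2 * real l + 1) * exp (- real (l * (l + 1)) * L t \<omega>)" for l \<omega>
    unfolding block_integrand_def abs_mult using z[of l "\<mu> * L t \<omega>"] by (simp add: mult.commute mult_left_mono)
  have int: "integrable (P x) (block_integrand t y l)" for l by (rule block_integrand_integrable[OF y])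
  \<comment> \<open>here \<open>exp (- u) \<le> 1 / u\<close> is enough as the random time is positive\<close>
  have AEs: "AE \<omega> in P x. summable (\<lambda>l. norm (block_integrand t y l \<omega>))"
    using AE_inv_sub_pos[OF t]
  proof eventually_elim
    case (elim \<omega>)
    show ?case
    proof (rule summable_comparison_test)
      show "summable (\<lambda>l. D / L t \<omega> * (sqrt (2 * real l + 1) / real (l * (l + 1))))"
        by (intro summable_mult summable_sqrt_decay)
      have "norm (norm (block_integrand t y l \<omega>)) \<le> D / L t \<omega> * (sqrt (2 * real l + 1) / real (l * (l + 1)))" if "l \<ge> 1" for l
      proof -
        define r where "r = real (l * (l + 1))"
        have r: "r > 0" unfolding r_def using that by (simp only: of_nat_0_less_iff) simp
        have u: "r * L t \<omega> > 0" using r elim by simp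
        have "exp (- r * L t \<omega>) \<le> 1 / (r * L t \<omega>)"
        proof -
          have "r * L t \<omega> \<le> exp (r * L t \<omega>)" using exp_ge_add_one_self[of "r * L t \<omega>"] by linarith
          then have "1 / exp (r * L t \<omega>) \<le> 1 / (r * L t \<omega>)" using u by (intro divide_left_mono) auto
          then show ?thesis by (simp add: exp_minus inverse_eq_divide)
        qed
        then have "D * sqrt (2 * real l + 1) * exp (- r * L t \<omega>) \<le> D * sqrt (2 * real l + 1) * (1 / (r * L t \<omega>))"
          using D by (intro mult_left_mono) auto
        then show ?thesis using bi[of l \<omega>] unfolding r_def[symmetric] by (simp add: mult_ac)
      qed
      then show "\<exists>N. \<forall>l\<ge>N. norm (norm (block_integrand t y l \<omega>)) \<le> D / L t \<omega> * (sqrt (2 * real l + 1) / real (l * (l + 1)))"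
        by blast
    qed
  qed
  have sumI: "summable (\<lambda>l. \<integral>\<omega>. norm (block_integrand t y l \<omega>) \<partial>P x)"
  proof (rule summable_comparison_test)
    show "summable (\<lambda>l. D * C * (sqrt (2 * real l + 1) / real (l * (l + 1))))"
      by (intro summable_mult summable_sqrt_decay)
    have "norm (\<integral>\<omega>. norm (block_integrand t y l \<omega>) \<partial>P x) \<le> D * C * (sqrt (2 * real l + 1) / real (l * (l + 1)))" if "l \<ge> 1" for l
    proof -
      define r where "r = real (l * (l + 1))"
      have r: "r > 0" unfolding r_def using that by (simp only: of_nat_0_less_iff) simp
      have "(\<integral>\<omega>. norm (block_integrand t y l \<omega>) \<partial>P x) \<le> (\<integral>\<omega>. D * sqrt (2 * real l + 1) * exp (- r * L t \<omega>) \<partial>P x)"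
        using int[of l] bi[of l] exp_inv_sub_integrable[of r t] r
        by (intro integral_mono) (auto simp: r_def)
      also have "\<dots> = D * sqrt (2 * real l + 1) * expectation (\<lambda>\<omega>. exp (- r * L t \<omega>))" by simp
      also have "\<dots> \<le> D * sqrt (2 * real l + 1) * (C / r)"
        using C(2)[OF r] D by (intro mult_left_mono) auto
      finally show ?thesis unfolding r_def[symmetric] by (simp add: mult_ac)
    qed
    then show "\<exists>N. \<forall>l\<ge>N. norm (\<integral>\<omega>. norm (block_integrand t y l \<omega>) \<partial>P x) \<le> D * C * (sqrt (2 * real l + 1) / real (l * (l + 1)))"
      by blast
  qed
  show "block t y sums (\<Sum>l. block t y l)"
    using sums_integral[OF int AEs sumI] unfolding block_def[abs_def] by (simp add: sums_iff)
  have td: "AE \<omega> in P x. complex_of_real (\<Sum>l. block_integrand t y l \<omega>) = trans_density \<mu> (L t \<omega>) y x"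
    using AEs
  proof eventually_elim
    case (elim \<omega>)
    then have "summable (\<lambda>l. block_integrand t y l \<omega>)" by (rule summable_norm_cancel)
    then have "complex_of_real (\<Sum>l. block_integrand t y l \<omega>) = (\<Sum>l. complex_of_real (block_integrand t y l \<omega>))"
      by (rule suminf_of_real)
    also have "\<dots> = trans_density \<mu> (L t \<omega>) y x"
      unfolding trans_density_def eigenvalue_def[symmetric] sum_exp_eigenvalue[OF y] block_integrand_def ..
    finally show ?case .
  qed
  have hb: "has_bochner_integral (P x) (\<lambda>\<omega>. \<Sum>l. block_integrand t y l \<omega>) (\<Sum>l. block t y l)"
    unfolding block_def has_bochner_integral_iff
    using integrable_suminf[OF int AEs sumI] integral_suminf[OF int AEs sumI] by simp
  then have hb': "has_bochner_integral (P x) (\<lambda>\<omega>. complex_of_real (\<Sum>l. block_integrand t y l \<omega>)) (complex_of_real (\<Sum>l. block t y l))"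
    by (rule has_bochner_integral_of_real)
  have meas: "(\<lambda>\<omega>. trans_density \<mu> (L t \<omega>) y x) \<in> borel_measurable (P x)"
    unfolding trans_density_def eigenvalue_def[symmetric]
    by (intro borel_measurable_suminf borel_measurable_sum borel_measurable_times exp_eigenvalue_measurable) auto
  show "has_bochner_integral (P x) (\<lambda>\<omega>. trans_density \<mu> (L t \<omega>) y x) (complex_of_real (\<Sum>l. block t y l))"
    using has_bochner_integralI_AE[OF hb' meas td] .
qed

text \<open>The value \<open>0\<close> on the null set of excluded points makes the function measurable whatever the behaviour of
  the series there.\<close>
definition time_changed_density :: "real \<Rightarrow> real^3 \<Rightarrow> real" where
  "time_changed_density t y = (if off_axis x y then \<Sum>l. block t y l else 0)"

lemma norm_e_fun_eigenvalue:
  "norm (e_fun (P x) S t (eigenvalue \<mu> l m)) \<le> expectation (\<lambda>\<omega>. exp (- real (l * (l + 1)) * L t \<omega>))"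
proof -
  have "norm (e_fun (P x) S t (eigenvalue \<mu> l m)) \<le> (\<integral>\<omega>. norm (exp (eigenvalue \<mu> l m * of_real (L t \<omega>))) \<partial>P x)"
    unfolding e_fun_def by (rule integral_norm_bound)
  then show ?thesis unfolding norm_exp_eigenvalue[OF inv_sub_nonneg] .
qed

lemma coefficients_square_summable:
  assumes t: "t > 0"
  shows "summable (\<lambda>l. \<Sum>m = - int l..int l. (norm (e_fun (P x) S t (eigenvalue \<mu> l m) * sph_harm l m x))\<^sup>2)"
proof -
  obtain C where C: "C \<ge> 0" "\<And>r. r > 0 \<Longrightarrow> expectation (\<lambda>\<omega>. exp (- r * inv_sub S t \<omega>)) \<le> C / r"
    using laplace_inv_sub_decay[OF t] by blast
  show ?thesis
  proof (rule summable_comparison_test)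
    show "summable (\<lambda>l. C\<^sup>2 / (4 * pi) * ((2 * real l + 1) / (real (l * (l + 1)))\<^sup>2))"
      by (intro summable_mult summable_square_decay)
    have "norm (\<Sum>m = - int l..int l. (norm (e_fun (P x) S t (eigenvalue \<mu> l m) * sph_harm l m x))\<^sup>2)
       \<le> C\<^sup>2 / (4 * pi) * ((2 * real l + 1) / (real (l * (l + 1)))\<^sup>2)" if "l \<ge> 1" for l
    proof -
      define r where "r = real (l * (l + 1))"
      have r: "r > 0" unfolding r_def using that by (simp only: of_nat_0_less_iff) simp
      have e: "norm (e_fun (P x) S t (eigenvalue \<mu> l m)) \<le> C / r" for m
        using norm_e_fun_eigenvalue[of t l m] C(2)[OF r] unfolding r_def[symmetric] by linarith
      have "(\<Sum>m = - int l..int l. (norm (e_fun (P x) S t (eigenvalue \<mu> l m) * sph_harm l m x))\<^sup>2)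
        \<le> (\<Sum>m = - int l..int l. (C / r)\<^sup>2 * (norm (sph_harm l m x))\<^sup>2)"
        unfolding norm_mult power_mult_distrib using e by (intro sum_mono mult_right_mono power_mono) auto
      also have "\<dots> = (C / r)\<^sup>2 * ((2 * real l + 1) / (4 * pi))"
        unfolding sum_distrib_left[symmetric] sum_sph_harm_square[OF x] ..
      also have "\<dots> = C\<^sup>2 / (4 * pi) * ((2 * real l + 1) / r\<^sup>2)" by (simp add: power_divide)
      finally show ?thesis unfolding r_def[symmetric] by (simp add: sum_nonneg)
    qed
    then show "\<exists>N. \<forall>l\<ge>N. norm (\<Sum>m = - int l..int l. (norm (e_fun (P x) S t (eigenvalue \<mu> l m) * sph_harm l m x))\<^sup>2)
       \<le> C\<^sup>2 / (4 * pi) * ((2 * real l + 1) / (real (l * (l + 1)))\<^sup>2)" by blast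
  qed
qed

lemma block_measurable: "(\<lambda>y. block t y l) \<in> borel_measurable surf"
proof -
  have "continuous_on S2 (\<lambda>y. Re (\<Sum>m = - int l..int l. e_fun (P x) S t (eigenvalue \<mu> l m) * sph_harm l m x * cnj (sph_harm l m y)))"
    by (intro continuous_on_Re continuous_intros continuous_on_sph_harm) auto
  then have "continuous_on S2 (\<lambda>y. block t y l)"
    by (rule continuous_on_eq) (simp add: block_eq[symmetric])
  from continuous_S2_measurable[OF this] show ?thesis by (simp cong: measurable_cong_sets)
qed

lemma off_axis_measurable: "{y \<in> space surf. off_axis x y} \<in> sets surf"
proof -
  have [measurable]: "(\<lambda>y::real^3. y $ 3) \<in> borel_measurable S2_borel"
    by (intro measurable_restrict_space1) simp
  have "{y \<in> space surf. off_axis x y} = {y \<in> space S2_borel. y $ 3 \<noteq> x $ 3 \<and> y $ 3 \<noteq> - (x $ 3)}"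
    using x by (auto simp: off_axis_iff space_restrict_space)
  also have "\<dots> \<in> sets S2_borel" by measurable
  finally show ?thesis by simp
qed

lemma time_changed_density_measurable: "time_changed_density t \<in> borel_measurable surf"
  unfolding time_changed_density_def[abs_def]
  by (intro measurable_If off_axis_measurable borel_measurable_suminf block_measurable) auto

lemma time_changed_density_L2:
  assumes t: "t > 0"
  shows "integrable surf (time_changed_density t)" "integrable surf (\<lambda>y. (time_changed_density t y)\<^sup>2)"
    and "\<And>l m. m \<in> {- int l..int l} \<Longrightarrow> (\<integral>y. of_real (time_changed_density t y) * sph_harm l m y \<partial>surf) = e_fun (P x) S t (eigenvalue \<mu> l m) * sph_harm l m x"
proof -
  have conv: "AE y in surf. block t y sums time_changed_density t y"
    using AE_off_axis[OF x] AE_space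
    by eventually_elim (use block_series(1) t in \<open>simp add: time_changed_density_def\<close>)
  note * = sph_harm_series_L2[OF _ coefficients_square_summable[OF t] time_changed_density_measurable conv]
  show "integrable surf (time_changed_density t)" by (rule *(1)) (rule block_eq)
  show "integrable surf (\<lambda>y. (time_changed_density t y)\<^sup>2)" by (rule *(2)) (rule block_eq)
  show "(\<integral>y. of_real (time_changed_density t y) * sph_harm l m y \<partial>surf) = e_fun (P x) S t (eigenvalue \<mu> l m) * sph_harm l m x"
    if "m \<in> {- int l..int l}" for l m by (rule *(3)[OF _ that]) (rule block_eq)
qed

text \<open>The law of the time-changed process and the density have the same spherical harmonic coefficients.\<close>
lemma expectation_eq_density:
  fixes f :: "real^3 \<Rightarrow> real"
  assumes t: "t > 0" and f: "continuous_on S2 f"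
  shows "(\<integral>\<omega>. f (time_changed W S t \<omega>) \<partial>P x) = (\<integral>y. time_changed_density t y * f y \<partial>surf)"
    and "\<And>A. A \<in> sets borel \<Longrightarrow> A \<subseteq> S2 \<Longrightarrow>
      measure (P x) {\<omega> \<in> space (P x). time_changed W S t \<omega> \<in> A} = (LINT y:A|surf. time_changed_density t y)"
proof -
  let ?T = "time_changed W S t"
  let ?\<rho> = "distr (P x) S2_borel ?T"
  note T = time_changed_measurable[of t]
  have fin: "finite_measure ?\<rho>" using finite_measure_distr[OF T] .
  have Y: "(\<integral>y. sph_harm l m y \<partial>?\<rho>) = (\<integral>y. of_real (time_changed_density t y) * sph_harm l m y \<partial>surf)"
    if m: "m \<in> {- int l..int l}" for l m
  proof -
    have "(\<integral>y. sph_harm l m y \<partial>?\<rho>) = (\<integral>\<omega>. sph_harm l m (?T \<omega>) \<partial>P x)"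
      by (rule integral_distr[OF T continuous_S2_measurable[OF continuous_on_sph_harm[OF m]]])
    then show ?thesis using expectation_time_changed_sph_harm[OF m] time_changed_density_L2(3)[OF t m] by simp
  qed
  have cont: "(\<integral>y. g y \<partial>?\<rho>) = (\<integral>y. time_changed_density t y * g y \<partial>surf)" if "continuous_on S2 g" for g :: "real^3 \<Rightarrow> real"
    by (rule measure_eq_density_of_coefficients[OF fin _ time_changed_density_L2(1)[OF t] Y that]) simp_all
  show "(\<integral>\<omega>. f (?T \<omega>) \<partial>P x) = (\<integral>y. time_changed_density t y * f y \<partial>surf)"
    using cont[OF f] integral_distr[OF T continuous_S2_measurable[OF f]] by simp
  fix A :: "(real^3) set" assume A: "A \<in> sets borel" "A \<subseteq> S2"
  have "measure ?\<rho> (A \<inter> S2) = (LINT y:A \<inter> S2|surf. time_changed_density t y)"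
    by (rule measure_eq_density_of_continuous[OF fin _ time_changed_density_L2(1)[OF t] cont A(1)]) simp
  moreover have "A \<inter> S2 = A" using A by blast
  moreover have "A \<in> sets S2_borel" using A by (auto simp: sets_restrict_space)
  then have "measure ?\<rho> A = measure (P x) (?T -` A \<inter> space (P x))" by (rule measure_distr[OF T])
  moreover have "?T -` A \<inter> space (P x) = {\<omega> \<in> space (P x). ?T \<omega> \<in> A}" by auto
  ultimately show "measure (P x) {\<omega> \<in> space (P x). ?T \<omega> \<in> A} = (LINT y:A|surf. time_changed_density t y)" by simp
qed

lemma time_changed_density_initial_limit:
  fixes f :: "real^3 \<Rightarrow> real"
  assumes f: "continuous_on S2 f"
  shows "((\<lambda>t. LINT y|surf. time_changed_density t y * f y) \<longlongrightarrow> f x) (at_right 0)"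
proof (rule Lim_transform_eventually[OF time_changed_initial_limit[OF f]])
  show "\<forall>\<^sub>F t in at_right 0. expectation (\<lambda>\<omega>. f (time_changed W S t \<omega>)) = (LINT y|surf. time_changed_density t y * f y)"
    using eventually_at_right_less[of "0::real"] by eventually_elim (rule expectation_eq_density(1)[OF _ f])
qed

end

section \<open>The transition density and its properties\<close>

lemma unbounded_subordinator_of_levy:
  assumes "infinite_levy_measure \<nu>" "subordinator M S (laplace_exponent \<nu>)"
  shows "unbounded_subordinator M S (laplace_exponent \<nu>)"
  using assms infinite_levy_measure.laplace_exponent_unbounded
  by (simp add: unbounded_subordinator_def unbounded_subordinator_axioms_def)

lemma e_fun_cnj: "e_fun M S t (cnj z) = cnj (e_fun M S t z)"
proof -
  have "exp (cnj z * complex_of_real u) = cnj (exp (z * complex_of_real u))" for u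
    by (simp add: exp_cnj)
  then show ?thesis unfolding e_fun_def by simp
qed

lemma eigenvalue_reflect: "eigenvalue (- \<mu>) l m = cnj (eigenvalue \<mu> l m)"
  by (simp add: eigenvalue_def)

theorem theorem3p9:
  fixes \<nu> :: "real measure"
    and P :: "real \<Rightarrow> real^3 \<Rightarrow> 'a measure"
    and W :: "real \<Rightarrow> real \<Rightarrow> 'a \<Rightarrow> real^3"
    and S :: "real \<Rightarrow> 'a \<Rightarrow> real"
  assumes "infinite_levy_measure \<nu>"
    and "\<And>\<mu>. sphere_diffusion (P \<mu>) (W \<mu>) \<mu>"
    and "\<And>\<mu> x. x \<in> S2 \<Longrightarrow> subordinator (P \<mu> x) S (laplace_exponent \<nu>)"
    and "\<And>\<mu> x. x \<in> S2 \<Longrightarrow> indep_processes (P \<mu> x) (W \<mu>) S"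
  shows "\<exists>p :: real \<Rightarrow> real \<Rightarrow> real^3 \<Rightarrow> real^3 \<Rightarrow> real. \<forall>\<mu>.
    (\<forall>x\<in>S2. \<forall>t>0. \<forall>A\<in>sets borel. A \<subseteq> S2 \<longrightarrow>
      measure (P \<mu> x) {\<omega> \<in> space (P \<mu> x). time_changed (W \<mu>) S t \<omega> \<in> A}
        = (LINT y:A|surf. p \<mu> t y x)) \<and>
    (\<forall>x\<in>S2. \<forall>y\<in>S2. colat x \<noteq> colat y \<longrightarrow> colat x \<noteq> pi - colat y \<longrightarrow> (\<forall>t>0.
      (\<lambda>l. \<Sum>m = - int l..int l.
        e_fun (P \<mu> x) S t (\<i> * complex_of_real \<mu> * of_int m - of_nat (l * (l + 1))) *
        sph_harm l m x * cnj (sph_harm l m y)) sums complex_of_real (p \<mu> t y x))) \<and>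
    (\<forall>t>0. \<forall>x\<in>S2. \<forall>y\<in>S2. colat x \<noteq> colat y \<longrightarrow> colat x \<noteq> pi - colat y \<longrightarrow>
      has_bochner_integral (P \<mu> x) (\<lambda>\<omega>. trans_density \<mu> (inv_sub S t \<omega>) y x)
        (complex_of_real (p \<mu> t y x)) \<and>
      p \<mu> t y x = p (- \<mu>) t x y) \<and>
    (\<forall>x\<in>S2. \<forall>t>0. square_integrable (\<lambda>y. p \<mu> t y x) \<and> square_integrable (\<lambda>y. p \<mu> t x y)) \<and>
    (\<forall>f. continuous_on S2 f \<longrightarrow> (\<forall>x\<in>S2.
      ((\<lambda>t. LINT y|surf. p \<mu> t y x * f y) \<longlongrightarrow> f x) (at_right 0)))"
proof -
  let ?\<Phi> = "laplace_exponent \<nu>"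
  have unb: "unbounded_subordinator (P \<mu> x) S ?\<Phi>" if "x \<in> S2" for \<mu> x
    by (rule unbounded_subordinator_of_levy[OF assms(1) assms(3)[OF that]])
  have tc: "time_changed_diffusion (P \<mu>) (W \<mu>) \<mu> S ?\<Phi> x" if "x \<in> S2" for \<mu> x
    using assms(2,4) unb that
    by (simp add: time_changed_diffusion_def time_changed_diffusion_axioms_def)
  define summand where "summand \<mu> t l x y = (\<Sum>m = - int l..int l.
    e_fun (P \<mu> x) S t (eigenvalue \<mu> l m) * sph_harm l m x * cnj (sph_harm l m y))" for \<mu> t l x y
  \<comment> \<open>one formula for all \<open>\<mu>\<close>; for fixed \<open>x\<close> it is the density constructed in the locale\<close>
  define p where "p \<mu> t y x = (if off_axis x y then \<Sum>l. Re (summand \<mu> t l x y) else 0)" for \<mu> t y x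
  have block: "time_changed_diffusion.block (P \<mu>) \<mu> S x t y l = Re (summand \<mu> t l x y)"
    if "x \<in> S2" "y \<in> S2" for \<mu> t l x y
  proof -
    interpret time_changed_diffusion "P \<mu>" "W \<mu>" \<mu> S ?\<Phi> x by (rule tc) fact
    show ?thesis unfolding summand_def block_eq[OF that(2), symmetric] by simp
  qed
  have p_eq: "p \<mu> t y x = time_changed_diffusion.time_changed_density (P \<mu>) \<mu> S x t y" if "x \<in> S2" "y \<in> S2" for \<mu> t x y
  proof -
    interpret time_changed_diffusion "P \<mu>" "W \<mu>" \<mu> S ?\<Phi> x by (rule tc) fact
    show ?thesis unfolding p_def time_changed_density_def block[OF that, symmetric] ..
  qed
  have symmetric: "p \<mu> t y x = p (- \<mu>) t x y" if x: "x \<in> S2" and y: "y \<in> S2" and t: "t > 0" for \<mu> t x y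
  proof -
    \<comment> \<open>the law of the random time is the same for all drifts and all starting points\<close>
    have e: "e_fun (P (- \<mu>) y) S t z = e_fun (P \<mu> x) S t z" for z
      by (rule e_fun_unique[OF unb[OF y] unb[OF x]]) (use t in simp)
    have "summand (- \<mu>) t l y x = cnj (summand \<mu> t l x y)" for l
      unfolding summand_def cnj_sum complex_cnj_mult complex_cnj_cnj e_fun_cnj[symmetric] eigenvalue_reflect e
      by (intro sum.cong refl) (simp only: mult_ac)
    then show ?thesis unfolding p_def using off_axis_commute[OF x y] by simp
  qed
  have L2: "square_integrable (\<lambda>y. p \<mu> t y x)" if x: "x \<in> S2" and t: "t > 0" for \<mu> t x
  proof -
    interpret time_changed_diffusion "P \<mu>" "W \<mu>" \<mu> S ?\<Phi> x by (rule tc) fact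
    have eq: "p \<mu> t y x = time_changed_density t y" if "y \<in> space surf" for y using p_eq[OF x] that by simp
    have "(\<lambda>y. p \<mu> t y x) \<in> borel_measurable surf"
      using time_changed_density_measurable[of t] by (subst measurable_cong[OF eq])
    moreover have "integrable surf (\<lambda>y. (p \<mu> t y x)\<^sup>2)"
      using time_changed_density_L2(2)[OF t] by (subst Bochner_Integration.integrable_cong[OF refl]) (auto simp: eq)
    ultimately show ?thesis unfolding square_integrable_def ..
  qed
  show ?thesis
  proof (intro exI[of _ p] allI conjI ballI impI)
    fix \<mu> x t A assume x: "x \<in> S2" and t: "(0::real) < t" and A: "A \<in> sets borel" "A \<subseteq> S2"
    interpret time_changed_diffusion "P \<mu>" "W \<mu>" \<mu> S ?\<Phi> x by (rule tc) fact
    have "measure (P \<mu> x) {\<omega> \<in> space (P \<mu> x). time_changed (W \<mu>) S t \<omega> \<in> A} = (LINT y:A|surf. time_changed_density t y)"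
      by (rule expectation_eq_density(2)[OF t continuous_on_const A])
    also have "\<dots> = (LINT y:A|surf. p \<mu> t y x)"
      unfolding set_lebesgue_integral_def
      by (intro Bochner_Integration.integral_cong) (use p_eq[OF x] in auto)
    finally show "measure (P \<mu> x) {\<omega> \<in> space (P \<mu> x). time_changed (W \<mu>) S t \<omega> \<in> A} = (LINT y:A|surf. p \<mu> t y x)" .
  next
    fix \<mu> x y t assume x: "x \<in> S2" and y: "y \<in> S2" and "colat x \<noteq> colat y" "colat x \<noteq> pi - colat y" and t: "(0::real) < t"
    then have off: "off_axis x y" by (simp add: off_axis_def)
    interpret time_changed_diffusion "P \<mu>" "W \<mu>" \<mu> S ?\<Phi> x by (rule tc) fact
    have "(\<lambda>l. complex_of_real (block t y l)) sums complex_of_real (p \<mu> t y x)"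
      using sums_of_real[OF block_series(1)[OF y off t]] p_eq[OF x y] off by (simp add: time_changed_density_def)
    then show "(\<lambda>l. \<Sum>m = - int l..int l.
        e_fun (P \<mu> x) S t (\<i> * complex_of_real \<mu> * of_int m - of_nat (l * (l + 1))) *
        sph_harm l m x * cnj (sph_harm l m y)) sums complex_of_real (p \<mu> t y x)"
      unfolding block_eq[OF y] eigenvalue_def .
  next
    fix \<mu> t x y assume x: "x \<in> S2" and y: "y \<in> S2" and "colat x \<noteq> colat y" "colat x \<noteq> pi - colat y" and t: "(0::real) < t"
    then have off: "off_axis x y" by (simp add: off_axis_def)
    interpret time_changed_diffusion "P \<mu>" "W \<mu>" \<mu> S ?\<Phi> x by (rule tc) fact
    show "has_bochner_integral (P \<mu> x) (\<lambda>\<omega>. trans_density \<mu> (inv_sub S t \<omega>) y x) (complex_of_real (p \<mu> t y x))"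
      using block_series(2)[OF y off t] p_eq[OF x y] off by (simp add: time_changed_density_def)
    show "p \<mu> t y x = p (- \<mu>) t x y" by (rule symmetric[OF x y t])
  next
    fix \<mu> x t assume x: "x \<in> S2" and t: "(0::real) < t"
    show "square_integrable (\<lambda>y. p \<mu> t y x)" by (rule L2[OF x t])
    have eq: "p \<mu> t x y = p (- \<mu>) t y x" if "y \<in> S2" for y by (rule symmetric[OF that x t])
    have "square_integrable (\<lambda>y. p \<mu> t x y) \<longleftrightarrow> square_integrable (\<lambda>y. p (- \<mu>) t y x)"
      unfolding square_integrable_def
      by (intro arg_cong2[where f="(\<and>)"] measurable_cong Bochner_Integration.integrable_cong refl) (simp_all add: eq)
    then show "square_integrable (\<lambda>y. p \<mu> t x y)" using L2[OF x t] by simp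
  next
    fix \<mu> f x assume f: "continuous_on S2 (f :: real^3 \<Rightarrow> real)" and x: "x \<in> S2"
    interpret time_changed_diffusion "P \<mu>" "W \<mu>" \<mu> S ?\<Phi> x by (rule tc) fact
    have "(LINT y|surf. p \<mu> t y x * f y) = (LINT y|surf. time_changed_density t y * f y)" for t
      by (intro Bochner_Integration.integral_cong) (use p_eq[OF x] in auto)
    then show "((\<lambda>t. LINT y|surf. p \<mu> t y x * f y) \<longlongrightarrow> f x) (at_right 0)"
      using time_changed_density_initial_limit[OF f] by simp
  qed
qed

end
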